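(* Let $\mathbf X$ and $Y$ be the state process and the CARMA process given by the state-space representation described in the context. Suppose that $\mathbb E L(1)=0$ and $\mathbb E|L(1)|^2=\sigma^2<\infty$, that $\mathbf X(0)$ is independent of $(L(t))_{t\ge 0}$, that all eigenvalues of $\mathbf A$ have strictly negative real parts, and that $\mathbf X(0)\stackrel{d}{=}\int_{-\infty}^0e^{-\mathbf Au}\mathbf e\,dL^*(u)$. Suppose that, for each $T>0$, the process $Y$ is observed at not necessarily equidistant (deterministic) points $0=x_0^{(T)}<x_1^{(T)}<\dots<x_{N(T)-1}^{(T)}=T$, and let $h_{\max}(T):=\max_{j=0,\dots,N(T)-2}\left(x_{j+1}^{(T)}-x_j^{(T)}\right)$. Let $\omega\in\mathbb R$ and let $\mathcal T_T(Y)(\omega)$ be the trapezoidal approximation of $\mathcal F_T(Y)(\omega)$ on this grid (see context). If $$\lim_{T\to\infty}N(T)h_{\max}^3(T)=0,$$ then $$\lim_{T\to\infty}\left\|\mathcal T_T(Y)(\omega)-\mathcal F_T(Y)(\omega)\right\|_{L^2}=0$$ and thus also $\mathcal T_T(Y)(\omega)-\mathcal F_T(Y)(\omega)\to0$ in probability as $T\to\infty$.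
   Context: Let $p>q\ge 0$ be integers, $a(z)=z^p+a_1z^{p-1}+\dots+a_p$ and $b(z)=b_0+b_1z+\dots+b_{p-1}z^{p-1}$ polynomials with real coefficients, with $b_q\ne 0$ and $b_j=0$ for $q<j<p$. Let $\mathbf A\in\mathbb R^{p\times p}$ be the companion matrix $$\mathbf A=\begin{pmatrix}0&1&0&\cdots&0\\0&0&1&\cdots&0\\ \vdots&\vdots&\vdots&\ddots&\vdots\\0&0&0&\cdots&1\\-a_p&-a_{p-1}&-a_{p-2}&\cdots&-a_1\end{pmatrix}$$ (with $\mathbf A=-a_1$ if $p=1$), $\mathbf e=[0,\dots,0,1]^T\in\mathbb R^p$, $\mathbf b=[b_0,b_1,\dots,b_{p-1}]^T\in\mathbb R^p$. Let $(L(t))_{t\ge 0}$ be a one-dimensional (real-valued) Lévy process with $L(0)=0$ a.s., on a filtered probability space satisfying the usual hypotheses. Its two-sided extension is $L^*(t)=L(t)$ for $t\ge0$ and $L^*(t)=-\widetilde L((-t)-)$ for $t<0$, where $\widetilde L$ is an independent copy of $L$ and $\widetilde L(s-)$ denotes the left limit. State-space representation: the $\mathbb R^p$-valued process $\mathbf X$ solves $d\mathbf X(t)=\mathbf A\mathbf X(t)\,dt+\mathbf e\,dL(t)$, i.e. $\mathbf X(t)=e^{\mathbf At}\mathbf X(0)+\int_0^te^{\mathbf A(t-u)}\mathbf e\,dL(u)$ for $t\ge 0$, and the CARMA process is $Y(t)=\mathbf b^T\mathbf X(t)$. The truncated Fourier transform of $Y$ at frequency $\omega\in\mathbb R$ is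 $\mathcal F_T(Y)(\omega)=\frac1{\sqrt T}\int_0^TY(t)e^{-i\omega t}\,dt$, $T>0$. Its trapezoidal approximation on the grid $(x_j^{(T)})_{j=0,\dots,N(T)-1}$ (with $N(T)\ge2$ points) is $$\mathcal T_T(Y)(\omega)=\frac1{\sqrt T}\sum_{j=0}^{N(T)-1}\alpha_j^{(N(T))}Y\left(x_j^{(T)}\right),$$ where, with $F(x)=e^{-i\omega x}$, $\alpha_0^{(N(T))}=\frac{x_1^{(T)}-x_0^{(T)}}2F(x_0^{(T)})$, $\alpha_{N(T)-1}^{(N(T))}=\frac{x_{N(T)-1}^{(T)}-x_{N(T)-2}^{(T)}}2F(x_{N(T)-1}^{(T)})$, and $\alpha_j^{(N(T))}=\frac{x_{j+1}^{(T)}-x_{j-1}^{(T)}}2F(x_j^{(T)})$ for $j=1,\dots,N(T)-2$. For a complex random variable $V$, $\|V\|_{L^2}=(\mathbb E|V|^2)^{1/2}$. *)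

theory Defs
  imports "HOL-Probability.Probability"
begin

text \<open>\<^bold>\<open>Indices and matrices.\<close>  The dimension \<open>p\<close> is \<open>CARD('n)\<close> for a finite, linearly ordered index
  type \<open>'n\<close>; \<open>idx\<close> is the order isomorphism from \<open>'n\<close> onto \<open>{0, \<dots>, p - 1}\<close>.\<close>

definition idx :: "'n::{finite,linorder} \<Rightarrow> nat" where
  "idx i = card {k. k < i}"

text \<open>Since \<open>a(z) = z^p + a_1 z^(p-1) + \<dots> + a_p\<close>, the number \<open>a_(p-j)\<close> is the coefficient of \<open>z^j\<close>.\<close>

definition companion :: "real poly \<Rightarrow> real ^ 'n::{finite,linorder} ^ 'n::{finite,linorder}" where
  "companion a = (\<chi> i j. if idx i = CARD('n) - 1 then - poly.coeff a (idx j)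
                         else if idx j = idx i + 1 then 1 else 0)"

definition e_vec :: "real ^ 'n::{finite,linorder}" where
  "e_vec = (\<chi> i. if idx i = CARD('n) - 1 then 1 else 0)"

definition coeff_vec :: "real poly \<Rightarrow> real ^ 'n::{finite,linorder}" where
  "coeff_vec b = (\<chi> i. poly.coeff b (idx i))"

definition is_eigenvalue :: "complex ^ 'n ^ 'n \<Rightarrow> complex \<Rightarrow> bool" where
  "is_eigenvalue A z \<longleftrightarrow> (\<exists>v. v \<noteq> 0 \<and> A *v v = z *s v)"

definition mexp :: "real ^ 'n ^ 'n \<Rightarrow> real ^ 'n ^ 'n" where
  "mexp A = (\<Sum>k. (((**) A) ^^ k) (mat 1) /\<^sub>R fact k)"

text \<open>\<^bold>\<open>Filtrations and Levy processes.\<close>  Processes are indexed by \<^typ>\<open>real\<close>; for one-sided processes and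
  filtrations only the indices \<open>t \<ge> 0\<close> are meaningful.\<close>

definition usual_filtration :: "'w measure \<Rightarrow> (real \<Rightarrow> 'w measure) \<Rightarrow> bool" where
  "usual_filtration M F \<longleftrightarrow>
     complete_measure M \<and>
     (\<forall>t\<ge>0. subalgebra M (F t)) \<and>
     (\<forall>s\<ge>0. \<forall>t\<ge>s. sets (F s) \<subseteq> sets (F t)) \<and>
     null_sets M \<subseteq> sets (F 0) \<and>
     (\<forall>t\<ge>0. (\<Inter>s\<in>{t<..}. sets (F s)) = sets (F t))"

definition cadlag :: "(real \<Rightarrow> 'b::topological_space) \<Rightarrow> bool" where
  "cadlag f \<longleftrightarrow> (\<forall>t\<ge>0. (f \<longlongrightarrow> f t) (at_right t)) \<and> (\<forall>t>0. \<exists>l. (f \<longlongrightarrow> l) (at_left t))"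

text \<open>Stochastic continuity is not listed because it follows from the other conditions:
  \<open>L (t + h) - L t\<close> is distributed as \<open>L h\<close>, and \<open>L h \<longlongrightarrow> L 0 = 0\<close> a.s. as \<open>h\<close> decreases to \<open>0\<close>.\<close>

definition levy_process :: "'w measure \<Rightarrow> (real \<Rightarrow> 'w measure) \<Rightarrow> (real \<Rightarrow> 'w \<Rightarrow> real) \<Rightarrow> bool" where
  "levy_process M F L \<longleftrightarrow>
     (\<forall>t\<ge>0. L t \<in> borel_measurable (F t)) \<and>
     (AE \<omega> in M. L 0 \<omega> = 0) \<and>
     (\<forall>s\<ge>0. \<forall>t\<ge>s. prob_space.indep_set M (sets (F s))
        {(\<lambda>\<omega>. L t \<omega> - L s \<omega>) -` B \<inter> space M | B. B \<in> sets borel}) \<and>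
     (\<forall>s\<ge>0. \<forall>t\<ge>s. distr M borel (\<lambda>\<omega>. L t \<omega> - L s \<omega>) = distr M borel (L (t - s))) \<and>
     (AE \<omega> in M. cadlag (\<lambda>t. L t \<omega>))"

text \<open>Independence of two random elements, as in the library's \<open>indep_var\<close>, but allowing the two
  value spaces to have different types.\<close>

definition indep_elements ::
  "'w measure \<Rightarrow> 'b measure \<Rightarrow> ('w \<Rightarrow> 'b) \<Rightarrow> 'c measure \<Rightarrow> ('w \<Rightarrow> 'c) \<Rightarrow> bool" where
  "indep_elements M S U T V \<longleftrightarrow>
     U \<in> measurable M S \<and> V \<in> measurable M T \<and>
     prob_space.indep_set M {U -` B \<inter> space M | B. B \<in> sets S} {V -` B \<inter> space M | B. B \<in> sets T}"

text \<open>The process \<open>(L(t))\<^sub>t\<close> as one random element of the product space over \<open>t \<ge> 0\<close>.\<close>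

abbreviation path_space :: "(real \<Rightarrow> real) measure" where
  "path_space \<equiv> Pi\<^sub>M {0..} (\<lambda>_. borel)"

definition sample_path :: "(real \<Rightarrow> 'w \<Rightarrow> real) \<Rightarrow> 'w \<Rightarrow> real \<Rightarrow> real" where
  "sample_path L \<omega> = (\<lambda>t\<in>{0..}. L t \<omega>)"

definition independent_copy :: "'w measure \<Rightarrow> (real \<Rightarrow> 'w \<Rightarrow> real) \<Rightarrow> (real \<Rightarrow> 'w \<Rightarrow> real) \<Rightarrow> bool" where
  "independent_copy M L L' \<longleftrightarrow>
     indep_elements M path_space (sample_path L) path_space (sample_path L') \<and>
     distr M path_space (sample_path L') = distr M path_space (sample_path L) \<and>
     (AE \<omega> in M. cadlag (\<lambda>t. L' t \<omega>))"

definition two_sided :: "(real \<Rightarrow> 'w \<Rightarrow> real) \<Rightarrow> (real \<Rightarrow> 'w \<Rightarrow> real) \<Rightarrow> real \<Rightarrow> 'w \<Rightarrow> real" where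
  "two_sided L L' t \<omega> = (if t \<ge> 0 then L t \<omega> else - Lim (at_left (- t)) (\<lambda>s. L' s \<omega>))"

text \<open>\<^bold>\<open>Stochastic integral of a deterministic integrand.\<close>  Step functions
  \<open>\<Sum>\<^sub>i\<^sub><\<^sub>m c\<^sub>i 1_(t\<^sub>i, t\<^sub>i\<^sub>+\<^sub>1]\<close> are integrated to \<open>\<Sum>\<^sub>i\<^sub><\<^sub>m (L(t\<^sub>i\<^sub>+\<^sub>1) - L(t\<^sub>i)) c\<^sub>i\<close>, and the integral over \<open>S\<close> (an interval)
  is the extension of this map from \<open>L\<^sup>2(S)\<close> to \<open>L\<^sup>2(P)\<close>.  For a driver with stationary, orthogonal
  increments, mean zero and finite variance (the only case used here) the map is, up to a constant
  factor, isometric; so the integral is determined up to a null set and is the usual Ito integral.\<close>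

definition step_fun :: "nat \<Rightarrow> (nat \<Rightarrow> real) \<Rightarrow> (nat \<Rightarrow> 'b::real_vector) \<Rightarrow> real \<Rightarrow> 'b" where
  "step_fun m t c u = (\<Sum>i<m. indicator {t i <.. t (Suc i)} u *\<^sub>R c i)"

definition step_integral ::
  "(real \<Rightarrow> 'w \<Rightarrow> real) \<Rightarrow> nat \<Rightarrow> (nat \<Rightarrow> real) \<Rightarrow> (nat \<Rightarrow> 'b::real_vector) \<Rightarrow> 'w \<Rightarrow> 'b" where
  "step_integral L m t c \<omega> = (\<Sum>i<m. (L (t (Suc i)) \<omega> - L (t i) \<omega>) *\<^sub>R c i)"

definition has_stoch_integral ::
  "'w measure \<Rightarrow> (real \<Rightarrow> 'w \<Rightarrow> real) \<Rightarrow> (real \<Rightarrow> 'b::euclidean_space) \<Rightarrow> real set \<Rightarrow> ('w \<Rightarrow> 'b) \<Rightarrow> bool" where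
  "has_stoch_integral M L f S I \<longleftrightarrow>
     I \<in> borel_measurable M \<and>
     (\<exists>(m :: nat \<Rightarrow> nat) (t :: nat \<Rightarrow> nat \<Rightarrow> real) (c :: nat \<Rightarrow> nat \<Rightarrow> 'b).
        (\<forall>n. mono_on {..m n} (t n) \<and> t n ` {..m n} \<subseteq> S) \<and>
        (\<lambda>n. \<integral>\<^sup>+u\<in>S. ennreal ((norm (f u - step_fun (m n) (t n) (c n) u))\<^sup>2) \<partial>lborel) \<longlonglongrightarrow> 0 \<and>
        (\<lambda>n. \<integral>\<^sup>+\<omega>. ennreal ((norm (I \<omega> - step_integral L (m n) (t n) (c n) \<omega>))\<^sup>2) \<partial>M) \<longlonglongrightarrow> 0)"

text \<open>\<^bold>\<open>State process.\<close>  \<open>dX = A X dt + e dL\<close> in its integrated form.  The integral determines each \<open>X t\<close>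
  only up to a null set; as usual for solutions of stochastic differential equations the version with
  cadlag paths is meant, which also gives a meaning to pathwise integrals of \<open>X\<close>.\<close>

definition carma_state ::
  "'w measure \<Rightarrow> (real \<Rightarrow> 'w \<Rightarrow> real) \<Rightarrow> real ^ 'n::{finite,linorder} ^ 'n::{finite,linorder}
     \<Rightarrow> (real \<Rightarrow> 'w \<Rightarrow> real ^ 'n::{finite,linorder}) \<Rightarrow> bool" where
  "carma_state M L A X \<longleftrightarrow>
     (\<forall>t\<ge>0. X t \<in> borel_measurable M) \<and>
     (AE \<omega> in M. cadlag (\<lambda>t. X t \<omega>)) \<and>
     (\<forall>t\<ge>0. \<exists>I. has_stoch_integral M L (\<lambda>u. mexp ((t - u) *\<^sub>R A) *v e_vec) {0..t} I \<and>
        (AE \<omega> in M. X t \<omega> = mexp (t *\<^sub>R A) *v X 0 \<omega> + I \<omega>))"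

text \<open>\<^bold>\<open>Fourier transforms\<close> of a path \<open>y\<close>.\<close>

definition trunc_fourier :: "(real \<Rightarrow> real) \<Rightarrow> real \<Rightarrow> real \<Rightarrow> complex" where
  "trunc_fourier y w T =
     complex_of_real (1 / sqrt T) * (LBINT t:{0..T}. complex_of_real (y t) * exp (- (\<i> * w * t)))"

definition trap_weight :: "nat \<Rightarrow> (nat \<Rightarrow> real) \<Rightarrow> real \<Rightarrow> nat \<Rightarrow> complex" where
  "trap_weight N x w j =
     complex_of_real (if j = 0 then (x 1 - x 0) / 2
                      else if j = N - 1 then (x (N - 1) - x (N - 2)) / 2
                      else (x (j + 1) - x (j - 1)) / 2)
     * exp (- (\<i> * w * x j))"

definition trap_fourier :: "nat \<Rightarrow> (nat \<Rightarrow> real) \<Rightarrow> (real \<Rightarrow> real) \<Rightarrow> real \<Rightarrow> real \<Rightarrow> complex" where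
  "trap_fourier N x y w T =
     complex_of_real (1 / sqrt T) * (\<Sum>j<N. trap_weight N x w j * complex_of_real (y (x j)))"

text \<open>\<^bold>\<open>Modes of convergence.\<close>  The Bochner integral is \<open>0\<close> for non-integrable functions, so \<open>L2_norm\<close> is
  the \<open>L\<^sup>2\<close> norm only for members of \<open>L2_space\<close>.\<close>

definition L2_space :: "'w measure \<Rightarrow> ('w \<Rightarrow> complex) set" where
  "L2_space M = {V \<in> borel_measurable M. integrable M (\<lambda>\<omega>. (cmod (V \<omega>))\<^sup>2)}"

definition L2_norm :: "'w measure \<Rightarrow> ('w \<Rightarrow> complex) \<Rightarrow> real" where
  "L2_norm M V = sqrt (\<integral>\<omega>. (cmod (V \<omega>))\<^sup>2 \<partial>M)"

definition tendsto_in_prob :: "'w measure \<Rightarrow> ('t \<Rightarrow> 'w \<Rightarrow> complex) \<Rightarrow> ('w \<Rightarrow> complex) \<Rightarrow> 't filter \<Rightarrow> bool" where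
  "tendsto_in_prob M V W G \<longleftrightarrow>
     (\<forall>\<epsilon>>0. ((\<lambda>T. measure M {\<omega> \<in> space M. cmod (V T \<omega> - W \<omega>) > \<epsilon>}) \<longlongrightarrow> 0) G)"

end

theory Submission
  imports Defs "HOL-Computational_Algebra.Fundamental_Theorem_Algebra"
begin

text \<open>Write \<open>G t = Y t * exp (- \<i> w t)\<close> and let \<open>h\<^sub>j\<close> be the length of the \<open>j\<close>-th grid interval
  \<open>[x\<^sub>j, x\<^sub>j\<^sub>+\<^sub>1]\<close>.  Up to the factor \<open>1 / sqrt T\<close>, the difference of the two transforms is the sum over
  the grid intervals of the trapezoid errors of \<open>G\<close>.  The paths of \<open>Y\<close> are as rough as those of \<open>L\<close>, so
  one trapezoid error has \<open>L\<^sup>2\<close> norm of order \<open>h\<^sub>j\<close> to the power \<open>3/2\<close>, and adding these norms would not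
  suffice: orthogonality must be used.

  On the \<open>j\<close>-th interval the state equation splits the state as
  \<open>X t = mexp ((t - x\<^sub>j) A) X(x\<^sub>j) + V\<^sub>j t\<close>, where \<open>V\<^sub>j t\<close>, here called the innovation, is the stochastic
  integral of \<open>mexp ((t - u) A) e\<close> over \<open>(x\<^sub>j, t]\<close>.

  \<^item> The first summand is a smooth function of \<open>t\<close>, so the classical bound for the trapezoidal rule
    (\<open>drift_trapezoid_error\<close>) gives an error of at most \<open>const * h\<^sub>j\<^sup>3 * norm (X(x\<^sub>j))\<close>.  Stability of \<open>A\<close>
    keeps the second moments of \<open>X\<close> bounded in time, whence the sum of these errors has second moment at most
    \<open>const * H\<^sup>2\<close> with \<open>H\<close> the sum of the \<open>h\<^sub>j\<^sup>3\<close>.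
  \<^item> The errors of the innovations on different intervals are orthogonal, because they are linear in the
    increments of \<open>L\<close> over disjoint intervals, and each has second moment at most \<open>const * h\<^sub>j\<^sup>3\<close>
    (\<open>quad_innovation_orthogonal\<close>, \<open>quad_innovation_square\<close>).  So the second moment of their sum
    is at most \<open>const * H\<close>.

  Since \<open>H \<le> N(T) hmax(T)\<^sup>3\<close>, the squared \<open>L\<^sup>2\<close> norm of the difference is at most
  \<open>const * (H\<^sup>2 + H) / T\<close>, which tends to \<open>0\<close>; convergence in probability follows from Markov's inequality.

  Three ingredients support this.  The decay of \<open>mexp (t A)\<close> (\<open>mexp_decay\<close>) comes from a polynomial that
  annihilates a given vector and has only eigenvalues of \<open>A\<close> as roots.  The isometry
  \<open>E (\<integral>f dL) (\<integral>g dL) = \<sigma>\<^sup>2 \<integral>f g\<close> (\<open>stoch_integral_isometry\<close>) rests on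
  \<open>E (L s) (L t) = \<sigma>\<^sup>2 min s t\<close> (\<open>levy_process_orthogonal\<close>).  Finally, a time integral of a cadlag path is
  a limit of Riemann sums (\<open>right_continuous_riemann\<close>), so all moments are computed for finite linear
  combinations of values of the process and carried to the limit by Fatou's lemma.\<close>

section \<open>The matrix exponential\<close>

abbreviation mpow :: "real ^ 'n ^ 'n \<Rightarrow> nat \<Rightarrow> real ^ 'n ^ 'n" where
  "mpow A k \<equiv> (((**) A) ^^ k) (mat 1)"

lemma mpow_Suc_right: "mpow A (Suc k) = mpow A k ** A"
proof (induction k)
  case (Suc k)
  have "mpow A (Suc (Suc k)) = A ** (mpow A k ** A)" using Suc by simp
  then show ?case by (simp add: matrix_mul_assoc)
qed simp

lemma mpow_scaleR: "mpow (c *\<^sub>R A) k = c ^ k *\<^sub>R mpow A k"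
  by (induction k)
     (auto simp: vec_eq_iff matrix_matrix_mult_def sum_distrib_left sum_distrib_right mult_ac)

lemma mpow_entry_bound: "\<bar>mpow A k $ i $ j\<bar> \<le> (\<Sum>i\<in>UNIV. \<Sum>j\<in>UNIV. \<bar>A $ i $ j\<bar>) ^ k"
proof (induction k arbitrary: i j)
  case 0
  show ?case by (simp add: mat_def)
next
  case (Suc k)
  let ?B = "(\<Sum>i\<in>UNIV. \<Sum>j\<in>UNIV. \<bar>A $ i $ j\<bar>)"
  have "\<bar>mpow A (Suc k) $ i $ j\<bar> \<le> (\<Sum>l\<in>UNIV. \<bar>A $ i $ l\<bar> * \<bar>mpow A k $ l $ j\<bar>)"
    by (simp add: matrix_matrix_mult_def flip: abs_mult)
  also have "\<dots> \<le> (\<Sum>l\<in>UNIV. \<bar>A $ i $ l\<bar> * ?B ^ k)"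
    by (intro sum_mono mult_left_mono Suc.IH) auto
  also have "\<dots> = (\<Sum>l\<in>UNIV. \<bar>A $ i $ l\<bar>) * ?B ^ k"
    by (simp add: sum_distrib_right)
  also have "\<dots> \<le> ?B * ?B ^ k"
    by (intro mult_right_mono member_le_sum[of i UNIV "\<lambda>i. \<Sum>l\<in>UNIV. \<bar>A $ i $ l\<bar>"] zero_le_power sum_nonneg) auto
  finally show ?case by simp
qed

lemma mpow_series_summable: "summable (\<lambda>k. mpow A k $ i $ j / fact k * (t::real) ^ k)"
proof (rule summable_comparison_test'[OF summable_exp])
  fix k :: nat assume "k \<ge> 0"
  have "norm (mpow A k $ i $ j / fact k * t ^ k) = inverse (fact k) * (\<bar>mpow A k $ i $ j\<bar> * \<bar>t\<bar> ^ k)"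
    by (simp add: abs_mult power_abs field_simps)
  also have "\<dots> \<le> inverse (fact k) * ((\<Sum>i\<in>UNIV. \<Sum>j\<in>UNIV. \<bar>A $ i $ j\<bar>) ^ k * \<bar>t\<bar> ^ k)"
    by (intro mult_left_mono mult_right_mono mpow_entry_bound) auto
  finally show "norm (mpow A k $ i $ j / fact k * t ^ k)
      \<le> inverse (fact k) * ((\<Sum>i\<in>UNIV. \<Sum>j\<in>UNIV. \<bar>A $ i $ j\<bar>) * \<bar>t\<bar>) ^ k"
    by (simp add: power_mult_distrib)
qed

lemma mexp_entry: "mexp (t *\<^sub>R A) $ i $ j = (\<Sum>k. mpow A k $ i $ j / fact k * t ^ k)"
proof -
  let ?f = "\<lambda>k. mpow (t *\<^sub>R A) k /\<^sub>R fact k"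
  let ?S = "\<chi> i j. \<Sum>k. mpow A k $ i $ j / fact k * t ^ k"
  have e: "?f k $ i $ j = mpow A k $ i $ j / fact k * t ^ k" for k i j
    by (simp add: mpow_scaleR field_simps)
  have "(\<lambda>n. (\<Sum>k<n. ?f k) $ i $ j) \<longlonglongrightarrow> ?S $ i $ j" for i j
    using summable_LIMSEQ[OF mpow_series_summable[of A i j t]]
    by (simp add: e sum_component del: vector_scaleR_component)
  then have "(\<lambda>n. (\<Sum>k<n. ?f k)) \<longlonglongrightarrow> ?S"
    by (intro vec_tendstoI)
  then have "?f sums ?S" by (simp add: sums_def)
  then have "mexp (t *\<^sub>R A) = ?S" unfolding mexp_def by (rule sums_unique[symmetric])
  then show ?thesis by simp
qed

lemma mexp_0 [simp]: "mexp (0 :: real ^ 'n ^ 'n) = mat 1"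
proof -
  have "mexp (0 *\<^sub>R (0 :: real ^ 'n ^ 'n)) $ i $ j = mat 1 $ i $ j" for i j
    unfolding mexp_entry powser_zero by simp
  then show ?thesis by (simp add: vec_eq_iff)
qed

lemma mult_mexp_entry:
  "(A ** mexp (t *\<^sub>R A)) $ i $ j = (\<Sum>k. mpow A (Suc k) $ i $ j / fact k * t ^ k)"
proof -
  have s: "summable (\<lambda>k. mpow A k $ i $ j / fact k * t ^ k)" for i j
    by (rule mpow_series_summable)
  have "(A ** mexp (t *\<^sub>R A)) $ i $ j = (\<Sum>l\<in>UNIV. \<Sum>k. A $ i $ l * (mpow A k $ l $ j / fact k * t ^ k))"
    unfolding matrix_matrix_mult_def[of A "mexp (t *\<^sub>R A)"] vec_lambda_beta mexp_entry
    by (intro sum.cong refl suminf_mult[symmetric] s)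
  also have "\<dots> = (\<Sum>k. \<Sum>l\<in>UNIV. A $ i $ l * (mpow A k $ l $ j / fact k * t ^ k))"
    by (intro suminf_sum[symmetric] summable_mult s)
  also have "\<dots> = (\<Sum>k. mpow A (Suc k) $ i $ j / fact k * t ^ k)"
    by (intro suminf_cong)
       (simp add: matrix_matrix_mult_def sum_distrib_right sum_divide_distrib mult.assoc)
  finally show ?thesis .
qed

lemma mexp_mult_entry:
  "(mexp (t *\<^sub>R A) ** A) $ i $ j = (\<Sum>k. mpow A (Suc k) $ i $ j / fact k * t ^ k)"
proof -
  have s: "summable (\<lambda>k. mpow A k $ i $ j / fact k * t ^ k)" for i j
    by (rule mpow_series_summable)
  have "(mexp (t *\<^sub>R A) ** A) $ i $ j = (\<Sum>l\<in>UNIV. \<Sum>k. (mpow A k $ i $ l / fact k * t ^ k) * A $ l $ j)"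
    unfolding matrix_matrix_mult_def[of "mexp (t *\<^sub>R A)" A] vec_lambda_beta mexp_entry
    by (intro sum.cong refl suminf_mult2 s)
  also have "\<dots> = (\<Sum>k. \<Sum>l\<in>UNIV. (mpow A k $ i $ l / fact k * t ^ k) * A $ l $ j)"
    by (intro suminf_sum[symmetric] summable_mult2 s)
  also have "\<dots> = (\<Sum>k. mpow A (Suc k) $ i $ j / fact k * t ^ k)"
    unfolding mpow_Suc_right
    by (intro suminf_cong)
       (simp add: matrix_matrix_mult_def sum_distrib_left sum_divide_distrib mult_ac)
  finally show ?thesis .
qed

lemma mexp_commute: "A ** mexp (t *\<^sub>R A) = mexp (t *\<^sub>R A) ** A"
  unfolding vec_eq_iff mult_mexp_entry mexp_mult_entry by simp

lemma mexp_entry_deriv: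
  "((\<lambda>t. mexp (t *\<^sub>R A) $ i $ j) has_real_derivative (A ** mexp (t *\<^sub>R A)) $ i $ j) (at t)"
proof -
  let ?c = "\<lambda>k. mpow A k $ i $ j / fact k"
  have "((\<lambda>t. \<Sum>k. ?c k * t ^ k) has_real_derivative (\<Sum>k. diffs ?c k * t ^ k)) (at t)"
    by (rule termdiffs_strong_converges_everywhere) (rule mpow_series_summable)
  moreover have "diffs ?c k = mpow A (Suc k) $ i $ j / fact k" for k
    by (simp add: diffs_def field_simps del: of_nat_Suc funpow.simps)
  ultimately show ?thesis unfolding mexp_entry mult_mexp_entry by (simp del: funpow.simps)
qed

text \<open>The derivative is written with \<open>A\<close> applied to the vector, so that it is again of the form
  \<open>mexp (t A) v\<close> and the rule can be iterated.\<close>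

lemma mexp_vec_deriv:
  "((\<lambda>t. (mexp (t *\<^sub>R A) *v v) $ i) has_real_derivative (mexp (t *\<^sub>R A) *v (A *v v)) $ i) (at t)"
  unfolding matrix_vector_mul_assoc mexp_commute[symmetric]
  unfolding matrix_vector_mult_def vec_lambda_beta
  by (auto intro!: derivative_eq_intros mexp_entry_deriv sum.cong)

lemma mexp_inner_deriv:
  "((\<lambda>t. c \<bullet> (mexp (t *\<^sub>R A) *v v)) has_real_derivative c \<bullet> (mexp (t *\<^sub>R A) *v (A *v v))) (at t)"
  unfolding inner_vec_def
  by (auto intro!: derivative_eq_intros mexp_vec_deriv sum.cong)

lemma continuous_on_mexp_vec:
  "continuous_on S g \<Longrightarrow> continuous_on S (\<lambda>t. mexp (g t *\<^sub>R A) *v v)"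
proof -
  have "continuous_on UNIV (\<lambda>t. mexp (t *\<^sub>R A) *v v)"
    by (rule continuous_on_componentwise[THEN iffD2])
       (auto intro!: DERIV_continuous_on mexp_inner_deriv simp: inner_commute)
  then show "continuous_on S g \<Longrightarrow> ?thesis"
    using continuous_on_compose2 by blast
qed

text \<open>By the commutation rule the function \<open>r \<mapsto> mexp ((s + t - r) A) ** mexp (r A)\<close> has derivative
  zero; its values at \<open>0\<close> and at \<open>t\<close> are the two sides.\<close>

lemma mexp_add: "mexp ((s + t) *\<^sub>R A) = mexp (s *\<^sub>R A) ** mexp (t *\<^sub>R A)"
proof -
  let ?E = "\<lambda>t. mexp (t *\<^sub>R A)"
  have "(?E (s + t)) $ i $ j = (?E s ** ?E t) $ i $ j" for i j
  proof -
    let ?g = "\<lambda>r. \<Sum>l\<in>UNIV. ?E (s + t - r) $ i $ l * ?E r $ l $ j"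
    have "(?g has_real_derivative 0) (at r)" for r
    proof -
      have d: "((\<lambda>r. ?E (s + t - r) $ i $ l) has_real_derivative - (?E (s + t - r) ** A) $ i $ l) (at r)" for l
      proof -
        have "((\<lambda>r. ?E (s + t - r) $ i $ l) has_real_derivative (A ** ?E (s + t - r)) $ i $ l * (- 1)) (at r)"
          by (rule DERIV_chain2[OF mexp_entry_deriv]) (auto intro!: derivative_eq_intros)
        then show ?thesis by (simp add: mexp_commute)
      qed
      have "(?g has_real_derivative (\<Sum>l\<in>UNIV. - (?E (s + t - r) ** A) $ i $ l * ?E r $ l $ j
               + (A ** ?E r) $ l $ j * ?E (s + t - r) $ i $ l)) (at r)"
        by (auto intro!: derivative_eq_intros d mexp_entry_deriv)
      also have "(\<Sum>l\<in>UNIV. - (?E (s + t - r) ** A) $ i $ l * ?E r $ l $ j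
               + (A ** ?E r) $ l $ j * ?E (s + t - r) $ i $ l)
          = - ((?E (s + t - r) ** A) ** ?E r) $ i $ j + (?E (s + t - r) ** (A ** ?E r)) $ i $ j"
        unfolding matrix_matrix_mult_def[of "?E (s + t - r) ** A"] matrix_matrix_mult_def[of "?E (s + t - r)" "A ** ?E r"]
        by (simp add: sum.distrib sum_negf mult.commute sum_subtractf)
      also have "\<dots> = 0" by (simp add: matrix_mul_assoc)
      finally show ?thesis .
    qed
    then have "?g 0 = ?g t" by (intro DERIV_isconst_all) auto
    then show ?thesis by (simp add: matrix_matrix_mult_def mat_def if_distrib cong: if_cong)
  qed
  then show ?thesis by (simp add: vec_eq_iff)
qed


section \<open>Exponential decay of the matrix exponential\<close>

text \<open>Variation of constants: \<open>z t = exp (- l t) y t\<close> satisfies \<open>z' = exp (- l t) g\<close>, whose integral is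
  dominated by that of an exponential.  The rate \<open>c'\<close> is chosen strictly below both \<open>c\<close> and \<open>- Re l\<close>;
  at the resonance \<open>c = - Re l\<close> the solution can decay more slowly than \<open>exp (- c t)\<close>.\<close>

lemma scalar_ode_decay:
  fixes y g :: "real \<Rightarrow> complex" and l :: complex
  assumes y: "\<And>t. (y has_vector_derivative l * y t + g t) (at t)"
    and g: "\<And>t. t \<ge> 0 \<Longrightarrow> cmod (g t) \<le> C * exp (- c * t)" and c: "c > 0" and l: "Re l < 0"
  shows "\<exists>C' c'. c' > 0 \<and> (\<forall>t\<ge>0. cmod (y t) \<le> C' * exp (- c' * t))"
proof -
  define c' where "c' = min c (- Re l) / 2"
  define \<mu> where "\<mu> = - Re l - c'"
  have c': "c' > 0" "c' \<le> c" "c' \<le> - Re l" and \<mu>: "\<mu> > 0"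
    using c l by (auto simp: c'_def \<mu>_def min_def field_simps)
  have C: "C \<ge> 0" using order.trans[OF norm_ge_zero g[of 0]] by simp
  define z where "z t = exp (- of_real t * l) * y t" for t
  have z': "(z has_vector_derivative exp (- of_real t * l) * g t) (at t)" for t
  proof -
    have "((\<lambda>t. exp (- of_real t * l)) has_vector_derivative (- l * exp (- of_real t * l))) (at t)"
      by (rule has_vector_derivative_real_field) (auto intro!: derivative_eq_intros)
    then show ?thesis unfolding z_def
      by (rule has_vector_derivative_eq_rhs[OF has_vector_derivative_mult[OF _ y]]) (simp add: algebra_simps)
  qed
  have bound: "cmod (y t) \<le> (cmod (y 0) + C / \<mu>) * exp (- c' * t)" if t: "t \<ge> 0" for t
  proof -
    have "cmod (z t - z 0) \<le> C / \<mu> * exp (\<mu> * t) - C / \<mu> * exp (\<mu> * 0)"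
    proof (cases "t = 0")
      case False
      with t have "0 < t" by simp
      then show ?thesis
      proof (rule differentiable_bound_general)
        show "continuous_on {0..t} z"
          by (intro continuous_at_imp_continuous_on ballI has_vector_derivative_continuous[OF z'])
        show "continuous_on {0..t} (\<lambda>t. C / \<mu> * exp (\<mu> * t))" by (intro continuous_intros)
        show "(z has_vector_derivative exp (- of_real s * l) * g s) (at s)" for s by (rule z')
        show "((\<lambda>t. C / \<mu> * exp (\<mu> * t)) has_vector_derivative C * exp (\<mu> * s)) (at s)" for s
          unfolding has_real_derivative_iff_has_vector_derivative[symmetric]
          using \<mu> by (auto intro!: derivative_eq_intros)
        show "norm (exp (- of_real s * l) * g s) \<le> C * exp (\<mu> * s)" if "0 < s" "s < t" for s
        proof -
          have "norm (exp (- of_real s * l) * g s) \<le> exp (- s * Re l) * (C * exp (- c * s))"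
            unfolding norm_mult using g[of s] that by (intro mult_mono) auto
          also have "\<dots> \<le> exp (- s * Re l) * (C * exp (- c' * s))"
            using C c' that by (intro mult_left_mono) auto
          also have "\<dots> = C * exp (\<mu> * s)"
            by (simp add: \<mu>_def algebra_simps flip: exp_add)
          finally show ?thesis .
        qed
      qed
    qed simp
    also have "\<dots> \<le> C / \<mu> * exp (\<mu> * t)" using C \<mu> by simp
    finally have "cmod (z t) \<le> cmod (y 0) + C / \<mu> * exp (\<mu> * t)"
      using norm_triangle_sub[of "z t" "z 0"] by (simp add: z_def)
    then have "exp (t * Re l) * cmod (z t) \<le> exp (t * Re l) * (cmod (y 0) + C / \<mu> * exp (\<mu> * t))"
      by (intro mult_left_mono) auto
    moreover have "exp (t * Re l) * cmod (z t) = cmod (y t)"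
      by (simp add: z_def norm_mult flip: exp_add mult.assoc)
    moreover have "exp (t * Re l) * (cmod (y 0) + C / \<mu> * exp (\<mu> * t))
        = cmod (y 0) * exp (t * Re l) + C / \<mu> * exp (- c' * t)"
      by (simp add: \<mu>_def algebra_simps flip: exp_add)
    moreover have "cmod (y 0) * exp (t * Re l) \<le> cmod (y 0) * exp (- c' * t)"
      using c'(3) t mult_right_mono[OF c'(3) t] by (intro mult_left_mono) (auto simp: mult.commute)
    ultimately have "cmod (y t) \<le> cmod (y 0) * exp (- c' * t) + C / \<mu> * exp (- c' * t)" by linarith
    then show ?thesis by (simp only: distrib_right)
  qed
  then show ?thesis using c'(1) by blast
qed

text \<open>If \<open>u k\<close> is the \<open>k\<close>-th derivative of a function \<open>y\<close>, this is the value of \<open>P(d/dt) y\<close>; if \<open>u k\<close> is a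
  component of \<open>A^k v\<close>, it is that component of \<open>P(A) v\<close>.  The fixed summation range makes the expression linear
  in \<open>P\<close>; it is used for polynomials of degree at most \<open>K\<close> only.\<close>

definition eval_seq :: "nat \<Rightarrow> complex poly \<Rightarrow> (nat \<Rightarrow> complex) \<Rightarrow> complex" where
  "eval_seq K P u = (\<Sum>k\<le>K. poly.coeff P k * u k)"

lemma eval_seq_linear_factor:
  assumes "degree P < K"
  shows "eval_seq K ([:- z, 1:] * P) u = eval_seq K P (\<lambda>k. u (Suc k)) - z * eval_seq K P u"
proof -
  obtain K' where K: "K = Suc K'" using assms by (cases K) auto
  have "poly.coeff P K = 0" using assms by (simp add: coeff_eq_0)
  then have 1: "eval_seq K (pCons 0 P) u = eval_seq K P (\<lambda>k. u (Suc k))"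
    unfolding eval_seq_def K by (subst sum.atMost_Suc_shift) simp
  have "[:- z, 1:] * P = pCons 0 P + smult (- z) P" by simp
  then have "eval_seq K ([:- z, 1:] * P) u = eval_seq K (pCons 0 P) u - z * eval_seq K P u"
    by (simp add: eval_seq_def sum.distrib sum_distrib_left algebra_simps sum_subtractf sum_negf)
  then show ?thesis using 1 by simp
qed

text \<open>More vectors than the dimension are linearly dependent.  Coinciding vectors must be treated apart,
  because dependence is a property of the set of vectors.\<close>

lemma annihilating_polynomial:
  fixes V :: "nat \<Rightarrow> real ^ 'n"
  shows "\<exists>m::complex poly. m \<noteq> 0 \<and> degree m \<le> CARD('n) \<and>
    (\<forall>i. eval_seq (Suc CARD('n)) m (\<lambda>k. of_real (V k $ i)) = 0)"
proof -
  let ?n = "CARD('n)"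
  have "\<exists>c::nat \<Rightarrow> real. (\<exists>k\<le>?n. c k \<noteq> 0) \<and> (\<Sum>k\<le>?n. c k *\<^sub>R V k) = 0"
  proof (cases "inj_on V {..?n}")
    case True
    then have "card (V ` {..?n}) = Suc ?n" by (simp add: card_image)
    then have "dependent (V ` {..?n})"
      using independent_bound[of "V ` {..?n}"] by force
    then obtain u v where uv: "v \<in> V ` {..?n}" "u v \<noteq> 0" "(\<Sum>v\<in>V ` {..?n}. u v *\<^sub>R v) = 0"
      by (auto simp: dependent_finite)
    have "(\<Sum>k\<le>?n. u (V k) *\<^sub>R V k) = 0"
      using uv(3) by (simp add: sum.reindex[OF True])
    then show ?thesis using uv by (intro exI[of _ "\<lambda>k. u (V k)"]) auto
  next
    case False
    then obtain i j where ij: "i \<le> ?n" "j \<le> ?n" "i \<noteq> j" "V i = V j"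
      by (auto simp: inj_on_def)
    let ?c = "\<lambda>k. (if k = i then 1 else 0) - (if k = j then 1 else (0::real))"
    have "(\<Sum>k\<le>?n. ?c k *\<^sub>R V k) = 0"
      using ij by (simp add: scaleR_diff_left sum_subtractf if_distrib[of "\<lambda>c. c *\<^sub>R _"] cong: if_cong)
    then show ?thesis using ij by (intro exI[of _ ?c]) auto
  qed
  then obtain c k0 where c: "k0 \<le> ?n" "c k0 \<noteq> 0" "(\<Sum>k\<le>?n. c k *\<^sub>R V k) = 0" by blast
  define m where "m = (\<Sum>k\<le>?n. monom (complex_of_real (c k)) k)"
  have co: "poly.coeff m k = (if k \<le> ?n then of_real (c k) else 0)" for k
    by (auto simp: m_def coeff_sum)
  have "m \<noteq> 0" using co[of k0] c by auto
  moreover have "degree m \<le> ?n" by (rule degree_le) (simp add: co)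
  moreover have "eval_seq (Suc ?n) m (\<lambda>k. of_real (V k $ i)) = 0" for i
  proof -
    have "eval_seq (Suc ?n) m (\<lambda>k. of_real (V k $ i)) = of_real ((\<Sum>k\<le>?n. c k *\<^sub>R V k) $ i)"
      by (simp add: eval_seq_def co)
    then show ?thesis by (simp add: c)
  qed
  ultimately show ?thesis by blast
qed

text \<open>Take an annihilating polynomial \<open>m\<close> of least degree.  If \<open>m = (X - z) m'\<close>, then \<open>m'(A) v\<close> is nonzero by
  minimality and is killed by \<open>A - z\<close>, so it is an eigenvector for \<open>z\<close>.\<close>

lemma annihilating_polynomial_eigenvalues:
  fixes A :: "real ^ 'n ^ 'n" and v :: "real ^ 'n"
  obtains m :: "complex poly"
  where "m \<noteq> 0" "degree m \<le> CARD('n)"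
    "\<And>i. eval_seq (Suc CARD('n)) m (\<lambda>k. of_real ((mpow A k *v v) $ i)) = 0"
    "\<And>z. poly m z = 0 \<Longrightarrow> is_eigenvalue (map_matrix complex_of_real A) z"
proof -
  let ?n = "CARD('n)"
  let ?V = "\<lambda>k. mpow A k *v v"
  let ?P = "\<lambda>m::complex poly. m \<noteq> 0 \<and> degree m \<le> ?n \<and> (\<forall>i. eval_seq (Suc ?n) m (\<lambda>k. of_real (?V k $ i)) = 0)"
  have "\<exists>m. ?P m" by (rule annihilating_polynomial)
  then obtain m where m: "?P m" and min: "\<And>m'. ?P m' \<Longrightarrow> degree m \<le> degree m'"
    using ex_has_least_nat[of ?P _ degree] by blast
  have "is_eigenvalue (map_matrix complex_of_real A) z" if z: "poly m z = 0" for z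
  proof -
    obtain m' where m': "m = [:- z, 1:] * m'" using z by (auto simp: poly_eq_0_iff_dvd)
    with m have "m' \<noteq> 0" by auto
    then have deg: "degree m = Suc (degree m')" unfolding m' by (subst degree_mult_eq) auto
    define x where "x = (\<chi> i. eval_seq (Suc ?n) m' (\<lambda>k. of_real (?V k $ i)))"
    have "\<not> ?P m'" using min[of m'] deg by auto
    then have "x \<noteq> 0" using \<open>m' \<noteq> 0\<close> deg m by (auto simp: x_def vec_eq_iff)
    moreover have "(map_matrix complex_of_real A *v x) $ i = (z *s x) $ i" for i
    proof -
      have "(map_matrix complex_of_real A *v x) $ i
          = (\<Sum>k\<le>Suc ?n. poly.coeff m' k * (\<Sum>j\<in>UNIV. of_real (A $ i $ j) * of_real (?V k $ j)))"
        unfolding matrix_vector_mult_def[of "map_matrix complex_of_real A"] x_def eval_seq_def vec_lambda_beta sum_distrib_left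
        by (subst sum.swap) (simp add: mult_ac)
      also have "\<dots> = eval_seq (Suc ?n) m' (\<lambda>k. of_real (?V (Suc k) $ i))"
        unfolding eval_seq_def
        by (simp add: matrix_vector_mul_assoc[symmetric]) (simp add: matrix_vector_mult_def)
      also have "\<dots> = z * eval_seq (Suc ?n) m' (\<lambda>k. of_real (?V k $ i))"
        using m eval_seq_linear_factor[of m' "Suc ?n" z "\<lambda>k. of_real (?V k $ i)"] deg
        unfolding m' by simp
      finally show ?thesis by (simp add: x_def)
    qed
    ultimately show ?thesis unfolding is_eigenvalue_def by (auto simp: vec_eq_iff)
  qed
  then show ?thesis using that m by blast
qed

text \<open>Let \<open>m\<close> annihilate \<open>v\<close> and have only eigenvalues of \<open>A\<close> as roots, and let \<open>y\<close> be a component of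
  \<open>mexp (t A) v\<close>, so that \<open>m(d/dt) y = 0\<close>.  For every factorization \<open>m = r s\<close> the function \<open>r(d/dt) y\<close>
  decays exponentially: for constant \<open>s\<close> it vanishes, and dividing a linear factor \<open>X - z\<close> out of \<open>s\<close>
  amounts to solving a scalar equation with coefficient \<open>z\<close>, where \<open>Re z < 0\<close>.  The case \<open>r = 1\<close> is the claim.\<close>

lemma mexp_component_decay:
  fixes A :: "real ^ 'n ^ 'n"
  assumes stable: "\<And>z. is_eigenvalue (map_matrix complex_of_real A) z \<Longrightarrow> Re z < 0"
  shows "\<exists>C c. c > 0 \<and> (\<forall>t\<ge>0. \<bar>(mexp (t *\<^sub>R A) *v v) $ i\<bar> \<le> C * exp (- c * t))"
proof -
  let ?n = "CARD('n)"
  obtain m :: "complex poly" where m: "m \<noteq> 0" "degree m \<le> ?n"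
    and m0: "\<And>i. eval_seq (Suc ?n) m (\<lambda>k. of_real ((mpow A k *v v) $ i)) = 0"
    and ev: "\<And>z. poly m z = 0 \<Longrightarrow> is_eigenvalue (map_matrix complex_of_real A) z"
    using annihilating_polynomial_eigenvalues[of A v] by metis
  define u where "u t k = complex_of_real ((mexp (t *\<^sub>R A) *v (mpow A k *v v)) $ i)" for t k
  have u': "((\<lambda>t. u t k) has_vector_derivative u t (Suc k)) (at t)" for t k
    unfolding u_def funpow.simps comp_apply matrix_vector_mul_assoc[symmetric, of A "mpow A k"]
    by (intro has_vector_derivative_of_real)
       (simp add: has_real_derivative_iff_has_vector_derivative[symmetric] mexp_vec_deriv)
  have eu': "((\<lambda>t. eval_seq K P (u t)) has_vector_derivative eval_seq K P (\<lambda>k. u t (Suc k))) (at t)" for K P t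
    unfolding eval_seq_def
    by (intro has_vector_derivative_sum has_vector_derivative_mult_right u')
  have mu: "eval_seq (Suc ?n) m (u t) = 0" for t
  proof -
    have "eval_seq (Suc ?n) m (u t) = (\<Sum>j\<in>UNIV. of_real (mexp (t *\<^sub>R A) $ i $ j) *
        eval_seq (Suc ?n) m (\<lambda>k. of_real ((mpow A k *v v) $ j)))"
      unfolding eval_seq_def u_def matrix_vector_mult_def[of "mexp (t *\<^sub>R A)"] sum_distrib_left
      by (subst sum.swap) (simp add: sum_distrib_left mult_ac)
    then show ?thesis by (simp add: m0)
  qed
  have "\<exists>C c. c > 0 \<and> (\<forall>t\<ge>0. cmod (eval_seq (Suc ?n) r (u t)) \<le> C * exp (- c * t))"
    if "degree s = d" "m = r * s" for d r s
    using that
  proof (induction d arbitrary: r s)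
    case 0
    then obtain a where s: "s = [:a:]" by (metis degree_eq_zeroE)
    with 0 m have "a \<noteq> 0" by auto
    have "eval_seq (Suc ?n) m (u t) = a * eval_seq (Suc ?n) r (u t)" for t
      using 0 s by (simp add: eval_seq_def sum_distrib_left algebra_simps)
    with mu \<open>a \<noteq> 0\<close> have "eval_seq (Suc ?n) r (u t) = 0" for t by simp
    then show ?case by (intro exI[of _ 0] exI[of _ 1]) simp
  next
    case (Suc d)
    then have "\<not> constant (poly s)" by (simp add: constant_degree)
    then obtain z where "poly s z = 0" using fundamental_theorem_of_algebra by blast
    then obtain s' where s': "s = [:- z, 1:] * s'" by (auto simp: poly_eq_0_iff_dvd)
    have nz: "r \<noteq> 0" "s' \<noteq> 0" using Suc m s' by auto
    have "degree s = degree [:- z, 1:] + degree s'" unfolding s' by (rule degree_mult_eq) (use nz in auto)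
    then have d: "degree s' = d" using Suc by simp
    have "degree m = degree r + degree s"
      unfolding Suc.prems(2) by (rule degree_mult_eq) (use nz Suc.prems(1) in auto)
    then have degr: "degree r < Suc ?n" using m Suc.prems by simp
    have "m = ([:- z, 1:] * r) * s'" using Suc.prems(2) s' by (simp only: mult_ac)
    from Suc.IH[OF d this] obtain C c where c: "c > 0"
      and g: "\<And>t. t \<ge> 0 \<Longrightarrow> cmod (eval_seq (Suc ?n) ([:- z, 1:] * r) (u t)) \<le> C * exp (- c * t)" by blast
    have "poly m z = 0" using Suc.prems(2) s' by simp
    then have "Re z < 0" using ev stable by blast
    show ?case
    proof (rule scalar_ode_decay[OF _ g c \<open>Re z < 0\<close>])
      show "((\<lambda>t. eval_seq (Suc ?n) r (u t)) has_vector_derivative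
          z * eval_seq (Suc ?n) r (u t) + eval_seq (Suc ?n) ([:- z, 1:] * r) (u t)) (at t)" for t
        unfolding eval_seq_linear_factor[OF degr] using eu' by simp
    qed
  qed
  from this[of m "degree m" 1]
  obtain C c where c: "c > 0" and b: "\<And>t. t \<ge> 0 \<Longrightarrow> cmod (eval_seq (Suc ?n) 1 (u t)) \<le> C * exp (- c * t)"
    by auto
  have "eval_seq (Suc ?n) 1 (u t) = u t 0" for t
    by (simp add: eval_seq_def if_distrib[of "\<lambda>c. c * _"] flip: one_pCons cong: if_cong)
  with b have "\<bar>(mexp (t *\<^sub>R A) *v v) $ i\<bar> \<le> C * exp (- c * t)" if "t \<ge> 0" for t
    using that by (simp add: u_def)
  with c show ?thesis by blast
qed

lemma mexp_decay:
  fixes A :: "real ^ 'n ^ 'n"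
  assumes stable: "\<And>z. is_eigenvalue (map_matrix complex_of_real A) z \<Longrightarrow> Re z < 0"
  obtains C c where "c > 0" "C \<ge> 0" "\<And>t v. t \<ge> 0 \<Longrightarrow> norm (mexp (t *\<^sub>R A) *v v) \<le> C * exp (- c * t) * norm v"
proof -
  have "\<forall>i j. \<exists>C c. c > 0 \<and> (\<forall>t\<ge>0. \<bar>(mexp (t *\<^sub>R A) *v axis j 1) $ i\<bar> \<le> C * exp (- c * t))"
    by (intro allI mexp_component_decay[OF stable])
  then obtain C where "\<forall>i j. \<exists>c. c > 0 \<and> (\<forall>t\<ge>0. \<bar>(mexp (t *\<^sub>R A) *v axis j 1) $ i\<bar> \<le> C i j * exp (- c * t))"
    by metis
  then obtain c where "\<forall>i j. c i j > 0 \<and> (\<forall>t\<ge>0. \<bar>(mexp (t *\<^sub>R A) *v axis j 1) $ i\<bar> \<le> C i j * exp (- c i j * t))"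
    by metis
  then have c: "\<And>i j. c i j > 0"
    and C: "\<And>i j t. t \<ge> 0 \<Longrightarrow> \<bar>(mexp (t *\<^sub>R A) *v axis j 1) $ i\<bar> \<le> C i j * exp (- c i j * t)"
    by auto
  define c0 where "c0 = Min (range (\<lambda>(i, j). c i j))"
  let ?C = "\<Sum>i\<in>UNIV. \<Sum>j\<in>UNIV. C i j"
  have C0: "C i j \<ge> 0" for i j using order.trans[OF abs_ge_zero C[of 0 j i]] by simp
  have entry: "\<bar>mexp (t *\<^sub>R A) $ i $ j\<bar> \<le> C i j * exp (- c0 * t)" if "t \<ge> 0" for i j t
  proof -
    have le: "c0 \<le> c i j" unfolding c0_def by (rule Min_le) (auto intro: image_eqI[of _ _ "(i, j)"])
    have "\<bar>mexp (t *\<^sub>R A) $ i $ j\<bar> \<le> C i j * exp (- c i j * t)"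
      using C[OF that, of j i] by (simp add: matrix_vector_mult_basis column_def)
    also have "\<dots> \<le> C i j * exp (- c0 * t)"
      using mult_right_mono[OF le that] C0 by (intro mult_left_mono) auto
    finally show ?thesis .
  qed
  have "norm (mexp (t *\<^sub>R A) *v v) \<le> ?C * exp (- c0 * t) * norm v" if t: "t \<ge> 0" for t v
  proof -
    have "norm (mexp (t *\<^sub>R A) *v v) \<le> (\<Sum>i\<in>UNIV. \<bar>(mexp (t *\<^sub>R A) *v v) $ i\<bar>)"
      by (rule norm_le_l1_cart)
    also have "\<dots> \<le> (\<Sum>i\<in>UNIV. \<Sum>j\<in>UNIV. C i j * exp (- c0 * t) * norm v)"
    proof (intro sum_mono)
      fix i :: 'n
      have "\<bar>(mexp (t *\<^sub>R A) *v v) $ i\<bar> \<le> (\<Sum>j\<in>UNIV. \<bar>mexp (t *\<^sub>R A) $ i $ j\<bar> * \<bar>v $ j\<bar>)"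
        by (simp add: matrix_vector_mult_def flip: abs_mult)
      also have "\<dots> \<le> (\<Sum>j\<in>UNIV. C i j * exp (- c0 * t) * norm v)"
        using entry[OF t] C0 by (intro sum_mono mult_mono component_le_norm_cart) auto
      finally show "\<bar>(mexp (t *\<^sub>R A) *v v) $ i\<bar> \<le> (\<Sum>j\<in>UNIV. C i j * exp (- c0 * t) * norm v)" .
    qed
    also have "\<dots> = ?C * exp (- c0 * t) * norm v" by (simp only: sum_distrib_right)
    finally show ?thesis .
  qed
  moreover have "c0 > 0" using c by (auto simp: c0_def)
  moreover have "?C \<ge> 0" using C0 by (intro sum_nonneg) auto
  ultimately show ?thesis using that by blast
qed

section \<open>Square-integrable functions\<close>

definition square_integrable :: "'a measure \<Rightarrow> ('a \<Rightarrow> real) \<Rightarrow> bool" where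
  "square_integrable M f \<longleftrightarrow> f \<in> borel_measurable M \<and> integrable M (\<lambda>x. (f x)\<^sup>2)"

lemma square_integrable_iff_nn:
  assumes "f \<in> borel_measurable M"
  shows "square_integrable M f \<longleftrightarrow> (\<integral>\<^sup>+x. ennreal ((f x)\<^sup>2) \<partial>M) < \<infinity>"
  using assms by (auto simp: square_integrable_def integrable_iff_bounded)

lemma square_integrable_measurable: "square_integrable M f \<Longrightarrow> f \<in> borel_measurable M"
  by (simp add: square_integrable_def)

lemma square_integrable_mult:
  assumes "square_integrable M f" "square_integrable M g"
  shows "integrable M (\<lambda>x. f x * g x)"
proof (rule Bochner_Integration.integrable_bound)
  show "integrable M (\<lambda>x. (f x)\<^sup>2 + (g x)\<^sup>2)" using assms by (auto simp: square_integrable_def)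
  show "(\<lambda>x. f x * g x) \<in> borel_measurable M" using assms by (auto simp: square_integrable_def)
  have "\<bar>f x * g x\<bar> \<le> (f x)\<^sup>2 + (g x)\<^sup>2" for x
  proof -
    have "2 * (\<bar>f x\<bar> * \<bar>g x\<bar>) \<le> (f x)\<^sup>2 + (g x)\<^sup>2"
      using sum_squares_bound[of "\<bar>f x\<bar>" "\<bar>g x\<bar>"] by (simp add: mult.assoc)
    moreover have "0 \<le> \<bar>f x\<bar> * \<bar>g x\<bar>" by simp
    ultimately show ?thesis unfolding abs_mult by linarith
  qed
  then show "AE x in M. norm (f x * g x) \<le> norm ((f x)\<^sup>2 + (g x)\<^sup>2)" by (auto simp: abs_mult)
qed

lemma square_integrable_add:
  assumes "square_integrable M f" "square_integrable M g"
  shows "square_integrable M (\<lambda>x. f x + g x)"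
proof -
  have "integrable M (\<lambda>x. (f x)\<^sup>2 + (g x)\<^sup>2 + 2 * (f x * g x))"
    using assms square_integrable_mult[OF assms] by (auto simp: square_integrable_def)
  then have "integrable M (\<lambda>x. (f x + g x)\<^sup>2)" by (simp add: power2_sum algebra_simps)
  then show ?thesis using assms by (auto simp: square_integrable_def)
qed

lemma square_integrable_cmult: "square_integrable M f \<Longrightarrow> square_integrable M (\<lambda>x. c * f x)"
  by (auto simp: square_integrable_def power_mult_distrib)

lemma square_integrable_diff:
  assumes "square_integrable M f" "square_integrable M g"
  shows "square_integrable M (\<lambda>x. f x - g x)"
  using square_integrable_add[OF assms(1) square_integrable_cmult[OF assms(2), of "-1"]] by simp

lemma square_integrable_zero: "square_integrable M (\<lambda>x. 0)"
  by (simp add: square_integrable_def)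

lemma square_integrable_sum:
  "(\<And>i. i \<in> I \<Longrightarrow> square_integrable M (f i)) \<Longrightarrow> square_integrable M (\<lambda>x. \<Sum>i\<in>I. f i x)"
  by (induction I rule: infinite_finite_induct) (auto intro: square_integrable_add square_integrable_zero)

lemma square_integrable_cong_AE:
  assumes "square_integrable M f" "AE x in M. f x = g x" "g \<in> borel_measurable M"
  shows "square_integrable M g"
proof -
  have "integrable M (\<lambda>x. (f x)\<^sup>2) \<longleftrightarrow> integrable M (\<lambda>x. (g x)\<^sup>2)"
    using assms by (intro integrable_cong_AE) (auto simp: square_integrable_def)
  then show ?thesis using assms by (auto simp: square_integrable_def)
qed

lemma Cauchy_Schwarz_integral:
  assumes f: "square_integrable M f" and g: "square_integrable M g"
  shows "\<bar>\<integral>x. f x * g x \<partial>M\<bar> \<le> sqrt (\<integral>x. (f x)\<^sup>2 \<partial>M) * sqrt (\<integral>x. (g x)\<^sup>2 \<partial>M)"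
proof -
  have [measurable]: "f \<in> borel_measurable M" "g \<in> borel_measurable M"
    using f g by (auto simp: square_integrable_def)
  have i: "integrable M (\<lambda>x. \<bar>f x\<bar> * \<bar>g x\<bar>)"
    using integrable_abs[OF square_integrable_mult[OF f g]] by (simp add: abs_mult)
  have "(\<integral>\<^sup>+x. ennreal \<bar>f x\<bar> * ennreal \<bar>g x\<bar> \<partial>M)\<^sup>2
      \<le> (\<integral>\<^sup>+x. (ennreal \<bar>f x\<bar>)\<^sup>2 \<partial>M) * (\<integral>\<^sup>+x. (ennreal \<bar>g x\<bar>)\<^sup>2 \<partial>M)"
    by (rule Cauchy_Schwarz_nn_integral) auto
  also have "(\<integral>\<^sup>+x. ennreal \<bar>f x\<bar> * ennreal \<bar>g x\<bar> \<partial>M) = ennreal (\<integral>x. \<bar>f x\<bar> * \<bar>g x\<bar> \<partial>M)"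
    using nn_integral_eq_integral[OF i] by (simp add: ennreal_mult)
  also have "(\<integral>\<^sup>+x. (ennreal \<bar>f x\<bar>)\<^sup>2 \<partial>M) = ennreal (\<integral>x. (f x)\<^sup>2 \<partial>M)"
    using f nn_integral_eq_integral[of M "\<lambda>x. (f x)\<^sup>2"] by (simp add: square_integrable_def ennreal_power)
  also have "(\<integral>\<^sup>+x. (ennreal \<bar>g x\<bar>)\<^sup>2 \<partial>M) = ennreal (\<integral>x. (g x)\<^sup>2 \<partial>M)"
    using g nn_integral_eq_integral[of M "\<lambda>x. (g x)\<^sup>2"] by (simp add: square_integrable_def ennreal_power)
  finally have "(\<integral>x. \<bar>f x\<bar> * \<bar>g x\<bar> \<partial>M)\<^sup>2 \<le> (\<integral>x. (f x)\<^sup>2 \<partial>M) * (\<integral>x. (g x)\<^sup>2 \<partial>M)"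
    by (simp add: ennreal_power flip: ennreal_mult)
  then have "(\<integral>x. \<bar>f x\<bar> * \<bar>g x\<bar> \<partial>M) \<le> sqrt (\<integral>x. (f x)\<^sup>2 \<partial>M) * sqrt (\<integral>x. (g x)\<^sup>2 \<partial>M)"
    by (simp add: real_le_rsqrt flip: real_sqrt_mult)
  moreover have "\<bar>\<integral>x. f x * g x \<partial>M\<bar> \<le> (\<integral>x. \<bar>f x\<bar> * \<bar>g x\<bar> \<partial>M)"
    using integral_abs_bound[of M "\<lambda>x. f x * g x"] by (simp add: abs_mult)
  ultimately show ?thesis by linarith
qed

text \<open>The hypothesis uses the nonnegative integral, which is defined whether or not \<open>f\<close> is square integrable; that
  \<open>f\<close> is square integrable is then a conclusion.\<close>

lemma square_integrable_L2_limit: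
  assumes a: "\<And>n. square_integrable M (a n)" and [measurable]: "f \<in> borel_measurable M"
    and lim: "(\<lambda>n. \<integral>\<^sup>+x. ennreal ((f x - a n x)\<^sup>2) \<partial>M) \<longlonglongrightarrow> 0"
  shows "\<forall>\<^sub>F n in sequentially. square_integrable M (\<lambda>x. f x - a n x)" "square_integrable M f"
    "(\<lambda>n. \<integral>x. (f x - a n x)\<^sup>2 \<partial>M) \<longlonglongrightarrow> 0"
proof -
  have [measurable]: "a n \<in> borel_measurable M" for n using a by (simp add: square_integrable_def)
  have "\<forall>\<^sub>F n in sequentially. (\<integral>\<^sup>+x. ennreal ((f x - a n x)\<^sup>2) \<partial>M) < 1"
    by (rule order_tendstoD[OF lim]) simp
  then show ev: "\<forall>\<^sub>F n in sequentially. square_integrable M (\<lambda>x. f x - a n x)"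
  proof eventually_elim
    case (elim n)
    then have "(\<integral>\<^sup>+x. ennreal ((f x - a n x)\<^sup>2) \<partial>M) < \<infinity>"
      using order.strict_trans[OF elim ennreal_one_less_top] by simp
    then show ?case by (subst square_integrable_iff_nn) auto
  qed
  then obtain n where "square_integrable M (\<lambda>x. f x - a n x)"
    by (auto simp: eventually_sequentially)
  from square_integrable_add[OF this a[of n]] show "square_integrable M f" by simp
  have "\<forall>\<^sub>F n in sequentially. (\<integral>x. (f x - a n x)\<^sup>2 \<partial>M) = enn2real (\<integral>\<^sup>+x. ennreal ((f x - a n x)\<^sup>2) \<partial>M)"
    using ev by eventually_elim (simp add: integral_eq_nn_integral)
  moreover have "(\<lambda>n. enn2real (\<integral>\<^sup>+x. ennreal ((f x - a n x)\<^sup>2) \<partial>M)) \<longlonglongrightarrow> 0"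
    using tendsto_enn2real[where l = 0] lim by simp
  ultimately show "(\<lambda>n. \<integral>x. (f x - a n x)\<^sup>2 \<partial>M) \<longlonglongrightarrow> 0"
    by (simp add: tendsto_cong)
qed

text \<open>With \<open>d = f - a\<close> and \<open>e = g - b\<close> one has \<open>a b = f g - d g - f e + d e\<close>, and the
  Cauchy-Schwarz inequality bounds the last three integrals.\<close>

lemma L2_limit_integral_mult:
  assumes a: "\<And>n. square_integrable M (a n)" and f: "f \<in> borel_measurable M"
    and limf: "(\<lambda>n. \<integral>\<^sup>+x. ennreal ((f x - a n x)\<^sup>2) \<partial>M) \<longlonglongrightarrow> 0"
    and b: "\<And>n. square_integrable M (b n)" and g: "g \<in> borel_measurable M"
    and limg: "(\<lambda>n. \<integral>\<^sup>+x. ennreal ((g x - b n x)\<^sup>2) \<partial>M) \<longlonglongrightarrow> 0"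
  shows "(\<lambda>n. \<integral>x. a n x * b n x \<partial>M) \<longlonglongrightarrow> (\<integral>x. f x * g x \<partial>M)"
proof -
  note F = square_integrable_L2_limit[OF a f limf] and G = square_integrable_L2_limit[OF b g limg]
  let ?d = "\<lambda>n x. f x - a n x" and ?e = "\<lambda>n x. g x - b n x"
  let ?N = "\<lambda>h. sqrt (\<integral>x. (h x)\<^sup>2 \<partial>M)"
  have "(\<lambda>n. ?N (?d n) * ?N g + ?N f * ?N (?e n) + ?N (?d n) * ?N (?e n)) \<longlonglongrightarrow> sqrt 0 * ?N g + ?N f * sqrt 0 + sqrt 0 * sqrt 0"
    by (intro tendsto_intros F G)
  then have z: "(\<lambda>n. ?N (?d n) * ?N g + ?N f * ?N (?e n) + ?N (?d n) * ?N (?e n)) \<longlonglongrightarrow> 0" by simp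
  have "\<forall>\<^sub>F n in sequentially. norm ((\<integral>x. a n x * b n x \<partial>M) - (\<integral>x. f x * g x \<partial>M))
      \<le> ?N (?d n) * ?N g + ?N f * ?N (?e n) + ?N (?d n) * ?N (?e n)"
    using F(1) G(1)
  proof eventually_elim
    case (elim n)
    have "(\<integral>x. a n x * b n x \<partial>M) = (\<integral>x. f x * g x - ?d n x * g x - f x * ?e n x + ?d n x * ?e n x \<partial>M)"
      by (simp add: algebra_simps)
    also have "\<dots> = (\<integral>x. f x * g x \<partial>M) - (\<integral>x. ?d n x * g x \<partial>M) - (\<integral>x. f x * ?e n x \<partial>M) + (\<integral>x. ?d n x * ?e n x \<partial>M)"
      using square_integrable_mult[OF F(2) G(2)] square_integrable_mult[OF elim(1) G(2)]
        square_integrable_mult[OF F(2) elim(2)] square_integrable_mult[OF elim] by simp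
    finally show ?case
      using Cauchy_Schwarz_integral[OF elim(1) G(2)] Cauchy_Schwarz_integral[OF F(2) elim(2)]
        Cauchy_Schwarz_integral[OF elim] by simp
  qed
  then have "(\<lambda>n. (\<integral>x. a n x * b n x \<partial>M) - (\<integral>x. f x * g x \<partial>M)) \<longlonglongrightarrow> 0"
    using z by (rule Lim_null_comparison)
  then show ?thesis by (rule LIM_zero_cancel)
qed

text \<open>Additivity and nonnegativity give monotonicity; squeezing \<open>n t\<close> between consecutive integers shows
  \<open>n * \<bar>v t - v 1 * t\<bar> \<le> v 1\<close> for all \<open>n\<close>.\<close>

lemma additive_nonneg_linear:
  fixes v :: "real \<Rightarrow> real"
  assumes add: "\<And>s t. s \<ge> 0 \<Longrightarrow> t \<ge> 0 \<Longrightarrow> v (s + t) = v s + v t"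
    and nn: "\<And>t. t \<ge> 0 \<Longrightarrow> v t \<ge> 0" and t: "t \<ge> 0"
  shows "v t = v 1 * t"
proof (rule ccontr)
  have v0: "v 0 = 0" using add[of 0 0] by simp
  have mult: "v (real n * t) = real n * v t" if "t \<ge> 0" for n t
    by (induction n) (use that v0 in \<open>auto simp: add distrib_right\<close>)
  have mono: "v s \<le> v t" if "0 \<le> s" "s \<le> t" for s t
    using add[of s "t - s"] nn[of "t - s"] that by simp
  have bound: "\<bar>v t - v 1 * t\<bar> * real n \<le> v 1" for n
  proof -
    let ?k = "nat \<lfloor>real n * t\<rfloor>"
    have k: "real ?k \<le> real n * t" "real n * t \<le> real (Suc ?k)"
    proof -
      have "real ?k = real_of_int \<lfloor>real n * t\<rfloor>" using t by simp
      then show "real ?k \<le> real n * t" "real n * t \<le> real (Suc ?k)" by linarith+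
    qed
    have v1: "v (real j) = real j * v 1" for j
      using mult[OF zero_le_one, of j] by (simp only: mult_1_right)
    have "real ?k * v 1 \<le> real n * v t" "real n * v t \<le> real (Suc ?k) * v 1"
      unfolding mult[OF t, symmetric] v1[symmetric] using mono k t by auto
    moreover have "real ?k * v 1 \<le> real n * t * v 1" "real n * t * v 1 \<le> real (Suc ?k) * v 1"
      using k nn[of 1] by (auto intro!: mult_right_mono)
    ultimately have "\<bar>real n * v t - real n * t * v 1\<bar> \<le> v 1" by (simp add: algebra_simps)
    moreover have "\<bar>v t - v 1 * t\<bar> * real n = \<bar>real n * v t - real n * t * v 1\<bar>"
    proof -
      have "real n * v t - real n * t * v 1 = (v t - v 1 * t) * real n" by (simp add: algebra_simps)
      then show ?thesis by (simp add: abs_mult)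
    qed
    ultimately show ?thesis by simp
  qed
  assume "v t \<noteq> v 1 * t"
  then have "0 < \<bar>v t - v 1 * t\<bar>" by simp
  then obtain n where "v 1 < real n * \<bar>v t - v 1 * t\<bar>" using reals_Archimedean3 by blast
  with bound[of n] show False by (simp add: mult.commute)
qed

section \<open>Second moments of a Levy process\<close>

text \<open>All that the second-order theory of the stochastic integral needs to know about the driving process: the
  covariance function of Brownian motion, up to the factor \<open>\<sigma>\<^sup>2\<close>.\<close>

definition orthogonal_driver :: "'w measure \<Rightarrow> (real \<Rightarrow> 'w \<Rightarrow> real) \<Rightarrow> real \<Rightarrow> bool" where
  "orthogonal_driver M L \<sigma> \<longleftrightarrow> (\<forall>t\<ge>0. square_integrable M (L t)) \<and>
     (\<forall>s\<ge>0. \<forall>t\<ge>s. (\<integral>\<omega>. L s \<omega> * L t \<omega> \<partial>M) = \<sigma>\<^sup>2 * s)"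

context prob_space begin

lemma square_integrable_const: "square_integrable M (\<lambda>_. c)"
  by (simp add: square_integrable_def)

lemma square_integrable_integrable: "square_integrable M f \<Longrightarrow> integrable M f"
  by (auto simp: square_integrable_def intro: square_integrable_imp_integrable)

text \<open>By Tonelli's theorem for the product law, \<open>u + V\<close> is square integrable for almost every value \<open>u\<close> of \<open>U\<close>,
  hence for at least one.\<close>

lemma square_integrable_indep_summand:
  assumes "indep_var borel U borel V" and "square_integrable M (\<lambda>\<omega>. U \<omega> + V \<omega>)"
  shows "square_integrable M V"
proof -
  have [measurable]: "U \<in> borel_measurable M" "V \<in> borel_measurable M"
    and d: "distr M borel U \<Otimes>\<^sub>M distr M borel V = distr M (borel \<Otimes>\<^sub>M borel) (\<lambda>x. (U x, V x))"
    using assms(1) by (auto simp: indep_var_distribution_eq)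
  interpret PU: prob_space "distr M borel U" by (rule prob_space_distr) simp
  interpret PV: prob_space "distr M borel V" by (rule prob_space_distr) simp
  have "(\<integral>\<^sup>+u. \<integral>\<^sup>+v. ennreal ((u + v)\<^sup>2) \<partial>distr M borel V \<partial>distr M borel U)
      = (\<integral>\<^sup>+p. ennreal ((fst p + snd p)\<^sup>2) \<partial>(distr M borel U \<Otimes>\<^sub>M distr M borel V))"
    by (subst PV.nn_integral_fst[symmetric]) (auto simp: measurable_distr_eq1)
  also have "\<dots> = (\<integral>\<^sup>+\<omega>. ennreal ((U \<omega> + V \<omega>)\<^sup>2) \<partial>M)"
    unfolding d by (subst nn_integral_distr) auto
  also have "\<dots> < \<infinity>"
    using assms(2) by (subst (asm) square_integrable_iff_nn) auto
  finally have "AE u in distr M borel U. (\<integral>\<^sup>+v. ennreal ((u + v)\<^sup>2) \<partial>distr M borel V) \<noteq> \<infinity>"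
    by (intro nn_integral_PInf_AE) (auto simp: PV.borel_measurable_nn_integral)
  then have "\<exists>u. (\<integral>\<^sup>+v. ennreal ((u + v)\<^sup>2) \<partial>distr M borel V) \<noteq> \<infinity>"
    using eventually_happens'[OF PU.ae_filter_bot] by blast
  then obtain u where "(\<integral>\<^sup>+v. ennreal ((u + v)\<^sup>2) \<partial>distr M borel V) \<noteq> \<infinity>" by blast
  then have "(\<integral>\<^sup>+\<omega>. ennreal ((u + V \<omega>)\<^sup>2) \<partial>M) < \<infinity>"
    by (subst (asm) nn_integral_distr) (auto simp: top.not_eq_extremum)
  then have "square_integrable M (\<lambda>\<omega>. u + V \<omega>)" by (subst square_integrable_iff_nn) auto
  from square_integrable_diff[OF this square_integrable_const[of u]] show ?thesis by simp
qed

lemma levy_process_indep: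
  assumes L: "levy_process M F L" and F: "usual_filtration M F" and st: "0 \<le> s" "s \<le> t"
  shows "indep_var borel (L s) borel (\<lambda>\<omega>. L t \<omega> - L s \<omega>)"
proof -
  have sub: "subalgebra M (F r)" if "r \<ge> 0" for r using F that by (simp add: usual_filtration_def)
  have LF: "L r \<in> borel_measurable (F r)" if "r \<ge> 0" for r using L that by (simp add: levy_process_def)
  have [measurable]: "L r \<in> borel_measurable M" if "r \<ge> 0" for r
    using measurable_from_subalg[OF sub LF] that by blast
  have m: "L s \<in> borel_measurable M" "L t \<in> borel_measurable M" using st by auto
  have sp: "space (F s) = space M" and ss: "sets (F s) \<subseteq> sets M"
    using sub[of s] st by (auto simp: subalgebra_def)
  let ?pre = "\<lambda>V. {V -` B \<inter> space M | B. B \<in> sets (borel :: real measure)}"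
  let ?incr = "\<lambda>\<omega>. L t \<omega> - L s \<omega>"
  have "indep_set (sets (F s)) (?pre ?incr)"
    using L st by (simp add: levy_process_def)
  moreover have "?pre (L s) \<subseteq> sets (F s)"
    using measurable_sets[OF LF[of s]] st sp by auto
  ultimately have "indep_set (?pre (L s)) (?pre ?incr)"
    unfolding indep_sets2_eq by blast
  then have "indep_set (sigma_sets (space M) (?pre (L s)))
      (sigma_sets (space M) (?pre ?incr))"
  proof (rule indep_set_sigma_sets)
    show "Int_stable (?pre X)" for X :: "'a \<Rightarrow> real"
    proof (rule Int_stableI)
      fix P Q assume "P \<in> ?pre X" "Q \<in> ?pre X"
      then obtain B C where "B \<in> sets borel" "C \<in> sets borel" "P = X -` B \<inter> space M" "Q = X -` C \<inter> space M" by auto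
      then have "B \<inter> C \<in> sets borel" "P \<inter> Q = X -` (B \<inter> C) \<inter> space M" by auto
      then show "P \<inter> Q \<in> ?pre X" by blast
    qed
    then show "Int_stable (?pre X)" for X :: "'a \<Rightarrow> real" .
  qed
  then show ?thesis using m by (auto simp: indep_var_eq)
qed

text \<open>Square integrability passes from \<open>L 1\<close> to integer times by adding increments, and to arbitrary times because
  \<open>L t\<close> has the law of an independent summand of \<open>L n\<close>, \<open>n \<ge> t\<close>.  The variance is additive and nonnegative in
  time, hence linear.  The mean is additive as well, but carries no sign: it vanishes at rational times since it
  does so at \<open>1\<close>, and right-continuity of the paths at \<open>0\<close> excludes the other solutions of Cauchy's functional
  equation.\<close>

lemma levy_process_orthogonal:
  assumes L: "levy_process M F L" and F: "usual_filtration M F"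
    and L1: "integrable M (\<lambda>\<omega>. (L 1 \<omega>)\<^sup>2)" and mean: "(\<integral>\<omega>. L 1 \<omega> \<partial>M) = 0"
    and var: "(\<integral>\<omega>. (L 1 \<omega>)\<^sup>2 \<partial>M) = \<sigma>\<^sup>2"
  shows "orthogonal_driver M L \<sigma>"
proof -
  have LF: "L r \<in> borel_measurable (F r)" and sub: "subalgebra M (F r)" if "r \<ge> 0" for r
    using L F that by (auto simp: levy_process_def usual_filtration_def)
  have meas: "L r \<in> borel_measurable M" if "r \<ge> 0" for r
    using measurable_from_subalg[OF sub LF] that by blast
  note indep = levy_process_indep[OF L F]
  have dist: "distr M borel (\<lambda>\<omega>. L t \<omega> - L s \<omega>) = distr M borel (L (t - s))" if "0 \<le> s" "s \<le> t" for s t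
    using L that by (simp add: levy_process_def)
  have dint: "integrable M (\<lambda>\<omega>. h (L t \<omega> - L s \<omega>)) = integrable M (\<lambda>\<omega>. h (L (t - s) \<omega>))"
    "(\<integral>\<omega>. h (L t \<omega> - L s \<omega>) \<partial>M) = (\<integral>\<omega>. h (L (t - s) \<omega>) \<partial>M)"
    if "0 \<le> s" "s \<le> t" "h \<in> borel_measurable borel" for s t and h :: "real \<Rightarrow> real"
  proof -
    have m: "(\<lambda>\<omega>. L t \<omega> - L s \<omega>) \<in> borel_measurable M" "L (t - s) \<in> borel_measurable M"
      using meas[of t] meas[of s] meas[of "t - s"] that by auto
    show "integrable M (\<lambda>\<omega>. h (L t \<omega> - L s \<omega>)) = integrable M (\<lambda>\<omega>. h (L (t - s) \<omega>))"
      unfolding integrable_distr_eq[OF m(1) that(3), symmetric] integrable_distr_eq[OF m(2) that(3), symmetric]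
        dist[OF that(1,2)] ..
    show "(\<integral>\<omega>. h (L t \<omega> - L s \<omega>) \<partial>M) = (\<integral>\<omega>. h (L (t - s) \<omega>) \<partial>M)"
      unfolding integral_distr[OF m(1) that(3), symmetric] integral_distr[OF m(2) that(3), symmetric]
        dist[OF that(1,2)] ..
  qed
  have dsq: "square_integrable M (\<lambda>\<omega>. L t \<omega> - L s \<omega>) \<longleftrightarrow> square_integrable M (L (t - s))"
    if "0 \<le> s" "s \<le> t" for s t
    using dint(1)[OF that, of "\<lambda>x. x\<^sup>2"] meas[of t] meas[of s] meas[of "t - s"] that
    by (auto simp: square_integrable_def)
  have L0: "AE \<omega> in M. L 0 \<omega> = 0" using L by (simp add: levy_process_def)
  have sqn: "square_integrable M (L (real n))" for n
  proof (induction n)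
    case 0
    have "AE \<omega> in M. 0 = L 0 \<omega>" using L0 by eventually_elim simp
    from square_integrable_cong_AE[OF square_integrable_const this] show ?case using meas[of 0] by simp
  next
    case (Suc n)
    have "square_integrable M (\<lambda>\<omega>. L (real (Suc n)) \<omega> - L (real n) \<omega>)"
      using dsq[of "real n" "real (Suc n)"] meas[of 1] L1 by (simp add: square_integrable_def)
    from square_integrable_add[OF this Suc] show ?case by simp
  qed
  have sq: "square_integrable M (L t)" if t: "t \<ge> 0" for t
  proof -
    obtain n where n: "t \<le> real n" using real_arch_simple by blast
    let ?s = "real n - t"
    have "square_integrable M (\<lambda>\<omega>. L ?s \<omega> + (L (real n) \<omega> - L ?s \<omega>))" using sqn[of n] by simp
    then have "square_integrable M (\<lambda>\<omega>. L (real n) \<omega> - L ?s \<omega>)"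
      by (rule square_integrable_indep_summand[OF indep, rotated 2]) (use n t in auto)
    then show ?thesis using dsq[of ?s "real n"] n t by simp
  qed
  have int: "integrable M (L t)" if "t \<ge> 0" for t using square_integrable_integrable[OF sq[OF that]] .
  define m where "m t = (\<integral>\<omega>. L t \<omega> \<partial>M)" for t
  have m_incr: "(\<integral>\<omega>. L t \<omega> - L s \<omega> \<partial>M) = m (t - s)" if "0 \<le> s" "s \<le> t" for s t
    using dint(2)[OF that, of "\<lambda>x. x"] by (simp add: m_def)
  have m_add: "m (s + t) = m s + m t" if "s \<ge> 0" "t \<ge> 0" for s t
    using m_incr[of s "s + t"] int[of s] int[of "s + t"] that by (simp add: m_def)
  have cross: "(\<integral>\<omega>. L s \<omega> * (L t \<omega> - L s \<omega>) \<partial>M) = m s * m (t - s)" if "0 \<le> s" "s \<le> t" for s t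
    using indep_var_lebesgue_integral[OF indep[OF that]] m_incr[OF that] int[of s] int[of t] that
    by (simp add: m_def)
  define v where "v t = (\<integral>\<omega>. (L t \<omega>)\<^sup>2 \<partial>M)" for t
  have v_add: "v (s + t) = v s + 2 * (m s * m t) + v t" if "s \<ge> 0" "t \<ge> 0" for s t
  proof -
    have "v (s + t) = (\<integral>\<omega>. (L s \<omega>)\<^sup>2 + 2 * (L s \<omega> * (L (s + t) \<omega> - L s \<omega>)) + (L (s + t) \<omega> - L s \<omega>)\<^sup>2 \<partial>M)"
      unfolding v_def by (intro Bochner_Integration.integral_cong) (auto simp: power2_eq_square algebra_simps)
    also have "\<dots> = v s + 2 * (m s * m t) + (\<integral>\<omega>. (L (s + t) \<omega> - L s \<omega>)\<^sup>2 \<partial>M)"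
    proof -
      have d: "square_integrable M (\<lambda>\<omega>. L (s + t) \<omega> - L s \<omega>)"
        using sq that by (intro square_integrable_diff) auto
      have i: "integrable M (\<lambda>\<omega>. (L s \<omega>)\<^sup>2)" "integrable M (\<lambda>\<omega>. (L (s + t) \<omega> - L s \<omega>)\<^sup>2)"
        using sq[of s] d that by (auto simp: square_integrable_def)
      have i2: "integrable M (\<lambda>\<omega>. L s \<omega> * (L (s + t) \<omega> - L s \<omega>))"
        using square_integrable_mult[OF sq d] that by auto
      show ?thesis
        using i i2 cross[of s "s + t"] that by (simp add: v_def)
    qed
    also have "(\<integral>\<omega>. (L (s + t) \<omega> - L s \<omega>)\<^sup>2 \<partial>M) = v t"
      using dint(2)[of s "s + t" "\<lambda>x. x\<^sup>2"] that by (simp add: v_def)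
    finally show ?thesis .
  qed
  have "v t - (m t)\<^sup>2 = (v 1 - (m 1)\<^sup>2) * t" if "t \<ge> 0" for t
  proof (rule additive_nonneg_linear[where v = "\<lambda>t. v t - (m t)\<^sup>2"])
    show "v (s + t) - (m (s + t))\<^sup>2 = v s - (m s)\<^sup>2 + (v t - (m t)\<^sup>2)" if "0 \<le> s" "0 \<le> t" for s t
      using v_add[OF that] m_add[OF that] by (simp add: power2_sum)
    show "0 \<le> v t - (m t)\<^sup>2" if "0 \<le> t" for t
    proof -
      have "variance (L t) = v t - (m t)\<^sup>2"
        unfolding v_def m_def using sq[OF that] int[OF that] by (intro variance_eq) (auto simp: square_integrable_def)
      then show ?thesis using variance_positive[of "L t"] by simp
    qed
  qed fact
  then have v: "v t = \<sigma>\<^sup>2 * t + (m t)\<^sup>2" if "t \<ge> 0" for t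
    using that var mean by (simp add: v_def[of 1] m_def[of 1] algebra_simps)
  have m_mult: "m (real n * t) = real n * m t" if "t \<ge> 0" for n t
    using that m_add[of 0 0] by (induction n) (auto simp: m_add distrib_right)
  have m0: "m t = 0" if t: "t \<ge> 0" for t
  proof -
    \<comment> \<open>\<open>t + h n\<close> is rational and decreases to \<open>t\<close>, so \<open>L (h n)\<close> has mean \<open>- m t\<close> and vanishing variance,
        but tends to \<open>0\<close>; Fatou's lemma then forces \<open>m t = 0\<close>.\<close>
    define h where "h n = real (Suc (nat \<lfloor>real (Suc n) * t\<rfloor>)) / real (Suc n) - t" for n
    have h: "h n > 0" "h n \<le> 1 / real (Suc n)" for n
    proof -
      have "real (nat \<lfloor>real (Suc n) * t\<rfloor>) = real_of_int \<lfloor>real (Suc n) * t\<rfloor>" using t by simp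
      then have k: "real (Suc n) * t < real (Suc (nat \<lfloor>real (Suc n) * t\<rfloor>))"
        "real (Suc (nat \<lfloor>real (Suc n) * t\<rfloor>)) \<le> real (Suc n) * t + 1" by linarith+
      show "h n > 0" using k(1) unfolding h_def by (simp add: field_simps del: of_nat_Suc)
      have "real (Suc (nat \<lfloor>real (Suc n) * t\<rfloor>)) / real (Suc n) \<le> (real (Suc n) * t + 1) / real (Suc n)"
        using k(2) by (rule divide_right_mono) simp
      then show "h n \<le> 1 / real (Suc n)"
        unfolding h_def add_divide_distrib by (simp del: of_nat_Suc)
    qed
    have hlim: "h \<longlonglongrightarrow> 0"
      by (rule real_tendsto_sandwich[OF _ _ tendsto_const LIMSEQ_Suc[OF lim_1_over_n]])
         (use h in \<open>auto intro!: always_eventually less_imp_le simp del: of_nat_Suc\<close>)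
    have mh: "m (h n) = - m t" for n
    proof -
      let ?k = "Suc (nat \<lfloor>real (Suc n) * t\<rfloor>)" and ?N = "real (Suc n)"
      have "?N * m (real ?k / ?N) = m (?N * (real ?k / ?N))" by (rule m_mult[symmetric]) simp
      also have "\<dots> = m (real ?k * 1)" by simp
      also have "\<dots> = 0" unfolding m_mult[OF zero_le_one] using mean by (simp add: m_def)
      finally have "m (real ?k / ?N) = 0" by simp
      then show ?thesis using m_add[of t "h n"] t h(1)[of n] by (simp add: h_def)
    qed
    have nn: "(\<integral>\<^sup>+\<omega>. ennreal ((L (h n) \<omega> + m t)\<^sup>2) \<partial>M) = ennreal (\<sigma>\<^sup>2 * h n)" for n
    proof -
      have h0: "h n \<ge> 0" using h(1)[of n] by simp
      have "square_integrable M (\<lambda>\<omega>. L (h n) \<omega> + m t)"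
        using sq[OF h0] square_integrable_const by (rule square_integrable_add)
      then have "(\<integral>\<^sup>+\<omega>. ennreal ((L (h n) \<omega> + m t)\<^sup>2) \<partial>M) = ennreal (\<integral>\<omega>. (L (h n) \<omega> + m t)\<^sup>2 \<partial>M)"
        by (intro nn_integral_eq_integral) (auto simp: square_integrable_def)
      also have "(\<integral>\<omega>. (L (h n) \<omega> + m t)\<^sup>2 \<partial>M) = v (h n) + 2 * m t * m (h n) + (m t)\<^sup>2"
        using sq[OF h0] int[OF h0] by (simp add: power2_sum v_def m_def square_integrable_def prob_space mult_ac)
      finally show ?thesis using v[OF h0] mh by (simp add: power2_eq_square)
    qed
    have "AE \<omega> in M. (\<lambda>n. L (h n) \<omega>) \<longlonglongrightarrow> 0"
    proof -
      have "AE \<omega> in M. cadlag (\<lambda>t. L t \<omega>)" using L by (simp add: levy_process_def)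
      then show ?thesis using L0
      proof eventually_elim
        case (elim \<omega>)
        then have "((\<lambda>t. L t \<omega>) \<longlongrightarrow> 0) (at_right 0)" by (metis cadlag_def order_refl)
        moreover have "filterlim h (at_right 0) sequentially"
          unfolding filterlim_at using hlim h(1)
          by (intro conjI always_eventually allI) (simp_all add: less_imp_neq[THEN not_sym])
        ultimately show ?case by (rule filterlim_compose)
      qed
    qed
    then have "AE \<omega> in M. liminf (\<lambda>n. ennreal ((L (h n) \<omega> + m t)\<^sup>2)) = ennreal ((m t)\<^sup>2)"
    proof eventually_elim
      case (elim \<omega>)
      have "(\<lambda>n. ennreal ((L (h n) \<omega> + m t)\<^sup>2)) \<longlonglongrightarrow> ennreal ((0 + m t)\<^sup>2)"
        by (intro tendsto_intros elim)
      then show ?case by (simp add: lim_imp_Liminf)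
    qed
    then have "ennreal ((m t)\<^sup>2) = (\<integral>\<^sup>+\<omega>. liminf (\<lambda>n. ennreal ((L (h n) \<omega> + m t)\<^sup>2)) \<partial>M)"
      by (subst nn_integral_cong_AE, assumption) (simp add: emeasure_space_1)
    also have "\<dots> \<le> liminf (\<lambda>n. \<integral>\<^sup>+\<omega>. ennreal ((L (h n) \<omega> + m t)\<^sup>2) \<partial>M)"
      using meas h(1) by (intro nn_integral_liminf) (simp add: less_imp_le)
    also have "(\<lambda>n. \<integral>\<^sup>+\<omega>. ennreal ((L (h n) \<omega> + m t)\<^sup>2) \<partial>M) = (\<lambda>n. ennreal (\<sigma>\<^sup>2 * h n))"
      by (simp only: nn)
    also have "liminf (\<lambda>n. ennreal (\<sigma>\<^sup>2 * h n)) = 0"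
    proof -
      have "(\<lambda>n. ennreal (\<sigma>\<^sup>2 * h n)) \<longlonglongrightarrow> ennreal (\<sigma>\<^sup>2 * 0)" by (intro tendsto_intros hlim)
      then show ?thesis by (simp add: lim_imp_Liminf)
    qed
    finally show ?thesis by simp
  qed
  have "(\<integral>\<omega>. L s \<omega> * L t \<omega> \<partial>M) = \<sigma>\<^sup>2 * s" if "0 \<le> s" "s \<le> t" for s t
  proof -
    have d: "square_integrable M (\<lambda>\<omega>. L t \<omega> - L s \<omega>)"
      using sq that by (intro square_integrable_diff) auto
    have "(\<integral>\<omega>. L s \<omega> * L t \<omega> \<partial>M) = (\<integral>\<omega>. (L s \<omega>)\<^sup>2 + L s \<omega> * (L t \<omega> - L s \<omega>) \<partial>M)"
      by (intro Bochner_Integration.integral_cong) (auto simp: power2_eq_square algebra_simps)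
    also have "\<dots> = v s + m s * m (t - s)"
      using sq[of s] square_integrable_mult[OF sq d, of s] cross[OF that] that
      by (simp add: v_def square_integrable_def)
    finally show ?thesis using v[of s] m0 that by simp
  qed
  then show ?thesis using sq by (simp add: orthogonal_driver_def)
qed

end

section \<open>The isometry of the stochastic integral\<close>

text \<open>Inner products of a fixed vector with vector-valued step functions and their integrals are scalar ones;
  the isometry is proved in the scalar setting.\<close>

definition scalar_step :: "nat \<Rightarrow> (nat \<Rightarrow> real) \<Rightarrow> (nat \<Rightarrow> real) \<Rightarrow> real \<Rightarrow> real" where
  "scalar_step m t a u = (\<Sum>i<m. indicator {t i <.. t (Suc i)} u * a i)"

definition scalar_step_integral :: "(real \<Rightarrow> 'w \<Rightarrow> real) \<Rightarrow> nat \<Rightarrow> (nat \<Rightarrow> real) \<Rightarrow> (nat \<Rightarrow> real) \<Rightarrow> 'w \<Rightarrow> real" where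
  "scalar_step_integral L m t a \<omega> = (\<Sum>i<m. (L (t (Suc i)) \<omega> - L (t i) \<omega>) * a i)"

lemma inner_step_fun: "c \<bullet> step_fun m t \<gamma> u = scalar_step m t (\<lambda>i. c \<bullet> \<gamma> i) u"
  by (simp add: step_fun_def scalar_step_def inner_sum_right)

lemma inner_step_integral: "c \<bullet> step_integral L m t \<gamma> \<omega> = scalar_step_integral L m t (\<lambda>i. c \<bullet> \<gamma> i) \<omega>"
  by (simp add: step_integral_def scalar_step_integral_def inner_sum_right)

lemma partition_point:
  assumes "mono_on {..m} t" "t ` {..m} \<subseteq> S" "i < m"
  shows "t i \<le> t (Suc i)" "t i \<in> S" "t (Suc i) \<in> S"
  using assms by (auto simp: mono_on_def)

text \<open>Expanding the product gives \<open>min b d - min b c - min a d + min a c\<close>, which is the length of the overlap of the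
  two intervals.\<close>

lemma orthogonal_driver_increments:
  assumes L: "orthogonal_driver M L \<sigma>" and ab: "0 \<le> a" "a \<le> b" and cd: "0 \<le> c" "c \<le> d"
  shows "(\<integral>\<omega>. (L b \<omega> - L a \<omega>) * (L d \<omega> - L c \<omega>) \<partial>M) = \<sigma>\<^sup>2 * measure lborel ({a<..b} \<inter> {c<..d})"
proof -
  have sq: "square_integrable M (L t)" if "t \<ge> 0" for t using L that by (simp add: orthogonal_driver_def)
  have cov: "(\<integral>\<omega>. L s \<omega> * L t \<omega> \<partial>M) = \<sigma>\<^sup>2 * min s t" if "s \<ge> 0" "t \<ge> 0" for s t
  proof (cases "s \<le> t")
    case True
    then show ?thesis using L that by (simp add: orthogonal_driver_def)
  next
    case False
    then have "(\<integral>\<omega>. L t \<omega> * L s \<omega> \<partial>M) = \<sigma>\<^sup>2 * min s t" using L that by (simp add: orthogonal_driver_def)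
    then show ?thesis by (simp only: mult.commute[of "L t _"])
  qed
  have int: "integrable M (\<lambda>\<omega>. L s \<omega> * L t \<omega>)" if "s \<ge> 0" "t \<ge> 0" for s t
    using square_integrable_mult[OF sq sq] that by auto
  have "(\<integral>\<omega>. (L b \<omega> - L a \<omega>) * (L d \<omega> - L c \<omega>) \<partial>M)
      = (\<integral>\<omega>. L b \<omega> * L d \<omega> - L b \<omega> * L c \<omega> - L a \<omega> * L d \<omega> + L a \<omega> * L c \<omega> \<partial>M)"
    by (simp add: algebra_simps)
  also have "\<dots> = \<sigma>\<^sup>2 * (min b d - min b c - min a d + min a c)"
    using int ab cd by (simp add: cov algebra_simps)
  also have "min b d - min b c - min a d + min a c = measure lborel ({a<..b} \<inter> {c<..d})"
  proof -
    have i: "{a<..b} \<inter> {c<..d} = {max a c<..min b d}" by auto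
    show ?thesis
    proof (cases "max a c \<le> min b d")
      case True
      then have "measure lborel {max a c<..min b d} = min b d - max a c" by simp
      moreover have "min b c = c" "min a d = a" using True by auto
      moreover have "min a c + max a c = a + c" by (simp add: min_def max_def)
      ultimately show ?thesis unfolding i by simp
    next
      case False
      then have "{max a c<..min b d} = {}" by auto
      moreover have "b < c \<or> d < a" using False ab cd by (auto simp: not_le max_less_iff_conj less_max_iff_disj min_less_iff_disj)
      then have "min b d - min b c - min a d + min a c = 0" using ab cd by auto
      ultimately show ?thesis unfolding i by simp
    qed
  qed
  finally show ?thesis .
qed

lemma scalar_step_square_integrable: "square_integrable lborel (scalar_step m t a)"
  unfolding scalar_step_def [abs_def]
proof (rule square_integrable_sum)
  fix i
  have "integrable lborel (indicator {t i<..t (Suc i)} :: real \<Rightarrow> real)"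
    by (rule integrable_real_indicator) (use emeasure_bounded_finite[OF bounded_Ioc] in auto)
  then have "square_integrable lborel (indicator {t i<..t (Suc i)} :: real \<Rightarrow> real)"
    by (simp add: square_integrable_def power2_eq_square flip: indicator_inter_arith)
  from square_integrable_cmult[OF this, of "a i"]
  show "square_integrable lborel (\<lambda>u. indicator {t i<..t (Suc i)} u * a i)" by (simp add: mult.commute)
qed

lemma scalar_step_integral_square_integrable:
  assumes L: "orthogonal_driver M L \<sigma>" and t: "mono_on {..m} t" "t ` {..m} \<subseteq> {0..T}"
  shows "square_integrable M (scalar_step_integral L m t a)"
  unfolding scalar_step_integral_def [abs_def]
proof (rule square_integrable_sum)
  fix i assume "i \<in> {..<m}"
  then have "square_integrable M (\<lambda>\<omega>. L (t (Suc i)) \<omega> - L (t i) \<omega>)"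
    using L partition_point[OF t, of i] by (intro square_integrable_diff) (auto simp: orthogonal_driver_def)
  from square_integrable_cmult[OF this, of "a i"]
  show "square_integrable M (\<lambda>\<omega>. (L (t (Suc i)) \<omega> - L (t i) \<omega>) * a i)" by (simp add: mult.commute)
qed

lemma scalar_step_isometry:
  assumes L: "orthogonal_driver M L \<sigma>"
    and t: "mono_on {..m} t" "t ` {..m} \<subseteq> {0..S}" and s: "mono_on {..k} s" "s ` {..k} \<subseteq> {0..T}"
  shows "(\<integral>\<omega>. scalar_step_integral L m t a \<omega> * scalar_step_integral L k s b \<omega> \<partial>M)
       = \<sigma>\<^sup>2 * (\<integral>u. scalar_step m t a u * scalar_step k s b u \<partial>lborel)"
proof -
  let ?D = "\<lambda>t i \<omega>. L (t (Suc i)) \<omega> - L (t i) \<omega>" and ?I = "\<lambda>t i. {t i<..t (Suc i)}"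
  have sq: "square_integrable M (\<lambda>\<omega>. ?D t i \<omega>)" if "i < m" for i
    using L partition_point[OF t that] by (intro square_integrable_diff) (auto simp: orthogonal_driver_def)
  have sq': "square_integrable M (\<lambda>\<omega>. ?D s j \<omega>)" if "j < k" for j
    using L partition_point[OF s that] by (intro square_integrable_diff) (auto simp: orthogonal_driver_def)
  have int: "integrable M (\<lambda>\<omega>. ?D t i \<omega> * a i * (?D s j \<omega> * b j))" if "i < m" "j < k" for i j
    using integrable_mult_left[OF square_integrable_mult[OF sq[OF that(1)] sq'[OF that(2)]], of "a i * b j"]
    by (simp add: mult_ac)
  have int': "integrable lborel (\<lambda>u. indicator (?I t i) u * a i * (indicator (?I s j) u * b j) :: real)" for i j
  proof -
    have "integrable lborel (indicator (?I t i \<inter> ?I s j) :: real \<Rightarrow> real)"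
      by (rule integrable_real_indicator)
         (use emeasure_bounded_finite[OF bounded_Int[OF disjI1, OF bounded_Ioc]] in
            \<open>auto simp del: Int_greaterThanAtMost\<close>)
    then have "integrable lborel (\<lambda>u. indicator (?I t i \<inter> ?I s j) u * (a i * b j))"
      by (intro integrable_mult_left)
    then show ?thesis by (simp only: indicator_inter_arith mult_ac)
  qed
  have "(\<integral>\<omega>. scalar_step_integral L m t a \<omega> * scalar_step_integral L k s b \<omega> \<partial>M)
      = (\<Sum>i<m. \<Sum>j<k. \<integral>\<omega>. ?D t i \<omega> * a i * (?D s j \<omega> * b j) \<partial>M)"
    unfolding scalar_step_integral_def sum_product
    by (subst Bochner_Integration.integral_sum, (auto intro!: Bochner_Integration.integrable_sum int)[1])
       (auto intro!: sum.cong Bochner_Integration.integral_sum int)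
  also have "\<dots> = (\<Sum>i<m. \<Sum>j<k. \<sigma>\<^sup>2 * measure lborel (?I t i \<inter> ?I s j) * (a i * b j))"
  proof (intro sum.cong refl)
    fix i j assume "i \<in> {..<m}" "j \<in> {..<k}"
    then have "(\<integral>\<omega>. ?D t i \<omega> * ?D s j \<omega> \<partial>M) = \<sigma>\<^sup>2 * measure lborel (?I t i \<inter> ?I s j)"
      using partition_point[OF t, of i] partition_point[OF s, of j]
      by (intro orthogonal_driver_increments[OF L]) auto
    moreover have "(\<integral>\<omega>. ?D t i \<omega> * a i * (?D s j \<omega> * b j) \<partial>M) = (\<integral>\<omega>. (?D t i \<omega> * ?D s j \<omega>) * (a i * b j) \<partial>M)"
      by (simp add: mult_ac)
    ultimately show "(\<integral>\<omega>. ?D t i \<omega> * a i * (?D s j \<omega> * b j) \<partial>M) = \<sigma>\<^sup>2 * measure lborel (?I t i \<inter> ?I s j) * (a i * b j)"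
      by (simp only: integral_mult_left_zero)
  qed
  also have "\<dots> = \<sigma>\<^sup>2 * (\<Sum>i<m. \<Sum>j<k. \<integral>u. indicator (?I t i) u * a i * (indicator (?I s j) u * b j) \<partial>lborel)"
  proof -
    have eq: "(\<integral>u. indicator (?I t i) u * a i * (indicator (?I s j) u * b j) \<partial>lborel)
        = measure lborel (?I t i \<inter> ?I s j) * (a i * b j)" for i j
    proof -
      have "(\<integral>u. indicator (?I t i) u * a i * (indicator (?I s j) u * b j) \<partial>lborel)
        = (\<integral>u. indicator (?I t i \<inter> ?I s j) u * (a i * b j) \<partial>lborel)"
        by (simp only: indicator_inter_arith mult_ac)
      then show ?thesis by (simp del: Int_greaterThanAtMost)
    qed
    show ?thesis unfolding eq sum_distrib_left by (simp only: mult.assoc)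
  qed
  also have "(\<Sum>i<m. \<Sum>j<k. \<integral>u. indicator (?I t i) u * a i * (indicator (?I s j) u * b j) \<partial>lborel)
      = (\<integral>u. scalar_step m t a u * scalar_step k s b u \<partial>lborel)"
    unfolding scalar_step_def sum_product
    by (subst Bochner_Integration.integral_sum, (auto intro!: Bochner_Integration.integrable_sum int')[1])
       (auto intro!: sum.cong Bochner_Integration.integral_sum[symmetric] int')
  finally show ?thesis .
qed

lemma nn_tendsto_0_dominated:
  fixes u v :: "nat \<Rightarrow> ennreal"
  assumes "v \<longlonglongrightarrow> 0" "\<And>n. u n \<le> ennreal K * v n"
  shows "u \<longlonglongrightarrow> 0"
proof -
  have "(\<lambda>n. ennreal K * v n) \<longlonglongrightarrow> ennreal K * 0"
    by (intro ennreal_tendsto_cmult assms(1)) simp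
  then have "(\<lambda>n. ennreal K * v n) \<longlonglongrightarrow> 0" by simp
  from tendsto_sandwich[OF _ _ tendsto_const this] assms(2) show ?thesis by auto
qed

lemma inner_square_le: "(c \<bullet> x)\<^sup>2 \<le> (norm c)\<^sup>2 * (norm x)\<^sup>2"
  using power_mono[OF Cauchy_Schwarz_ineq2 abs_ge_zero, of c x 2] by (simp add: power_mult_distrib)

text \<open>The time interval is closed, so that the supporting intervals of an approximating step function lie
  inside it; outside, both the truncated integrand and the step function are \<open>0\<close>.  This turns convergence on
  \<open>[0, T]\<close> into convergence on the whole line, where integrals over different horizons can be compared.\<close>

lemma has_stoch_integral_scalar_approx:
  fixes f :: "real \<Rightarrow> 'b::euclidean_space"
  assumes L: "orthogonal_driver M L \<sigma>" and I: "has_stoch_integral M L f {0..T} I"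
    and f: "f \<in> borel_measurable borel"
  obtains m :: "nat \<Rightarrow> nat" and t :: "nat \<Rightarrow> nat \<Rightarrow> real" and a :: "nat \<Rightarrow> nat \<Rightarrow> real"
  where "\<And>n. mono_on {..m n} (t n)" "\<And>n. t n ` {..m n} \<subseteq> {0..T}"
    "(\<lambda>n. \<integral>\<^sup>+u. ennreal ((indicator {0..T} u * (c \<bullet> f u) - scalar_step (m n) (t n) (a n) u)\<^sup>2) \<partial>lborel) \<longlonglongrightarrow> 0"
    "(\<lambda>n. \<integral>\<^sup>+\<omega>. ennreal ((c \<bullet> I \<omega> - scalar_step_integral L (m n) (t n) (a n) \<omega>)\<^sup>2) \<partial>M) \<longlonglongrightarrow> 0"
proof -
  have [measurable]: "f \<in> borel_measurable borel" "I \<in> borel_measurable M"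
    using f I by (auto simp: has_stoch_integral_def)
  obtain m t \<gamma> where mr: "\<forall>n. mono_on {..m n} (t n) \<and> t n ` {..m n} \<subseteq> {0..T}"
    and l1: "(\<lambda>n. \<integral>\<^sup>+u\<in>{0..T}. ennreal ((norm (f u - step_fun (m n) (t n) (\<gamma> n) u))\<^sup>2) \<partial>lborel) \<longlonglongrightarrow> 0"
    and l2: "(\<lambda>n. \<integral>\<^sup>+\<omega>. ennreal ((norm (I \<omega> - step_integral L (m n) (t n) (\<gamma> n) \<omega>))\<^sup>2) \<partial>M) \<longlonglongrightarrow> 0"
    using I unfolding has_stoch_integral_def by (elim conjE exE) (rule that)
  have mono: "mono_on {..m n} (t n)" and ran: "t n ` {..m n} \<subseteq> {0..T}" for n using mr by auto
  let ?d = "\<lambda>n u. indicator {0..T} u * (c \<bullet> f u) - scalar_step (m n) (t n) (\<lambda>i. c \<bullet> \<gamma> n i) u"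
  let ?D = "\<lambda>n \<omega>. c \<bullet> I \<omega> - scalar_step_integral L (m n) (t n) (\<lambda>i. c \<bullet> \<gamma> n i) \<omega>"
  let ?e = "\<lambda>n u. f u - step_fun (m n) (t n) (\<gamma> n) u"
  let ?E = "\<lambda>n \<omega>. I \<omega> - step_integral L (m n) (t n) (\<gamma> n) \<omega>"
  have outside: "scalar_step (m n) (t n) a u = 0" if "u \<notin> {0..T}" for n a u
    unfolding scalar_step_def
  proof (intro sum.neutral ballI)
    fix i assume "i \<in> {..<m n}"
    then have "t n i \<in> {0..T}" "t n (Suc i) \<in> {0..T}" using partition_point[OF mono ran, of i n] by auto
    then have "u \<notin> {t n i<..t n (Suc i)}" using that by auto
    then show "indicator {t n i<..t n (Suc i)} u * a i = 0" by simp
  qed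
  have [measurable]: "step_fun (m n) (t n) (\<gamma> n) \<in> borel_measurable borel" for n
    unfolding step_fun_def [abs_def] by measurable
  have "(\<lambda>\<omega>. L (t n (Suc i)) \<omega> - L (t n i) \<omega>) \<in> borel_measurable M" if "i < m n" for n i
    using partition_point[OF mono ran that] L
    by (intro borel_measurable_diff square_integrable_measurable) (auto simp: orthogonal_driver_def)
  then have [measurable]: "step_integral L (m n) (t n) (\<gamma> n) \<in> borel_measurable M" for n
    unfolding step_integral_def [abs_def] by (intro borel_measurable_sum borel_measurable_scaleR) auto
  have A: "(\<lambda>n. \<integral>\<^sup>+u. ennreal ((?d n u)\<^sup>2) \<partial>lborel) \<longlonglongrightarrow> 0"
  proof (rule nn_tendsto_0_dominated[OF l1])
    fix n
    have "(\<integral>\<^sup>+u. ennreal ((?d n u)\<^sup>2) \<partial>lborel)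
        \<le> (\<integral>\<^sup>+u. ennreal ((norm c)\<^sup>2) * (ennreal ((norm (?e n u))\<^sup>2) * indicator {0..T} u) \<partial>lborel)"
    proof (intro nn_integral_mono)
      fix u
      show "ennreal ((?d n u)\<^sup>2)
        \<le> ennreal ((norm c)\<^sup>2) * (ennreal ((norm (?e n u))\<^sup>2) * indicator {0..T} u)"
      proof (cases "u \<in> {0..T}")
        case True
        then have "indicator {0..T} u * (c \<bullet> f u) - scalar_step (m n) (t n) (\<lambda>i. c \<bullet> \<gamma> n i) u
          = c \<bullet> (?e n u)"
          by (simp add: inner_diff_right inner_step_fun)
        then show ?thesis using True
          using inner_square_le[of c] by (simp add: ennreal_leI flip: ennreal_mult)
      next
        case False
        then show ?thesis using outside[OF False] by simp
      qed
    qed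
    also have "\<dots> = ennreal ((norm c)\<^sup>2) * (\<integral>\<^sup>+u\<in>{0..T}. ennreal ((norm (?e n u))\<^sup>2) \<partial>lborel)"
      by (rule nn_integral_cmult) measurable
    finally show "(\<integral>\<^sup>+u. ennreal ((?d n u)\<^sup>2) \<partial>lborel)
        \<le> ennreal ((norm c)\<^sup>2) * (\<integral>\<^sup>+u\<in>{0..T}. ennreal ((norm (?e n u))\<^sup>2) \<partial>lborel)" .
  qed
  have B: "(\<lambda>n. \<integral>\<^sup>+\<omega>. ennreal ((?D n \<omega>)\<^sup>2) \<partial>M) \<longlonglongrightarrow> 0"
  proof (rule nn_tendsto_0_dominated[OF l2])
    fix n
    have "(\<integral>\<^sup>+\<omega>. ennreal ((?D n \<omega>)\<^sup>2) \<partial>M)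
        \<le> (\<integral>\<^sup>+\<omega>. ennreal ((norm c)\<^sup>2) * ennreal ((norm (?E n \<omega>))\<^sup>2) \<partial>M)"
    proof (intro nn_integral_mono)
      fix \<omega>
      have "c \<bullet> I \<omega> - scalar_step_integral L (m n) (t n) (\<lambda>i. c \<bullet> \<gamma> n i) \<omega> = c \<bullet> (?E n \<omega>)"
        by (simp only: inner_diff_right inner_step_integral)
      then show "ennreal ((?D n \<omega>)\<^sup>2)
          \<le> ennreal ((norm c)\<^sup>2) * ennreal ((norm (?E n \<omega>))\<^sup>2)"
        using inner_square_le[of c] by (simp add: ennreal_leI flip: ennreal_mult)
    qed
    also have "\<dots> = ennreal ((norm c)\<^sup>2) * (\<integral>\<^sup>+\<omega>. ennreal ((norm (?E n \<omega>))\<^sup>2) \<partial>M)"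
      by (rule nn_integral_cmult) measurable
    finally show "(\<integral>\<^sup>+\<omega>. ennreal ((?D n \<omega>)\<^sup>2) \<partial>M)
        \<le> ennreal ((norm c)\<^sup>2) * (\<integral>\<^sup>+\<omega>. ennreal ((norm (?E n \<omega>))\<^sup>2) \<partial>M)" .
  qed
  show ?thesis by (rule that[OF mono ran A B])
qed

text \<open>The integrals may have different horizons and dimensions.  This bilinear form spares the
  construction of a common partition for sums of stochastic integrals.\<close>

lemma stoch_integral_isometry:
  fixes f :: "real \<Rightarrow> 'b::euclidean_space" and g :: "real \<Rightarrow> 'c::euclidean_space"
  assumes L: "orthogonal_driver M L \<sigma>"
    and I: "has_stoch_integral M L f {0..S} I" and f: "f \<in> borel_measurable borel"
    and J: "has_stoch_integral M L g {0..T} J" and g: "g \<in> borel_measurable borel"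
  shows "square_integrable M (\<lambda>\<omega>. c \<bullet> I \<omega>)"
    and "square_integrable lborel (\<lambda>u. indicator {0..S} u * (c \<bullet> f u))"
    and "(\<integral>\<omega>. (c \<bullet> I \<omega>) * (d \<bullet> J \<omega>) \<partial>M)
      = \<sigma>\<^sup>2 * (\<integral>u. (indicator {0..S} u * (c \<bullet> f u)) * (indicator {0..T} u * (d \<bullet> g u)) \<partial>lborel)"
proof -
  have [measurable]: "f \<in> borel_measurable borel" "I \<in> borel_measurable M"
    "g \<in> borel_measurable borel" "J \<in> borel_measurable M"
    using f I g J by (auto simp: has_stoch_integral_def)
  obtain m t a where
      mono: "\<And>n. mono_on {..m n} (t n)" and ran: "\<And>n. t n ` {..m n} \<subseteq> {0..S}"
    and l1: "(\<lambda>n. \<integral>\<^sup>+u. ennreal ((indicator {0..S} u * (c \<bullet> f u) - scalar_step (m n) (t n) (a n) u)\<^sup>2) \<partial>lborel) \<longlonglongrightarrow> 0"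
    and l2: "(\<lambda>n. \<integral>\<^sup>+\<omega>. ennreal ((c \<bullet> I \<omega> - scalar_step_integral L (m n) (t n) (a n) \<omega>)\<^sup>2) \<partial>M) \<longlonglongrightarrow> 0"
    by (rule has_stoch_integral_scalar_approx[OF L I f, of c]) (rule that)
  obtain m' t' a' where
      mono': "\<And>n. mono_on {..m' n} (t' n)" and ran': "\<And>n. t' n ` {..m' n} \<subseteq> {0..T}"
    and l1': "(\<lambda>n. \<integral>\<^sup>+u. ennreal ((indicator {0..T} u * (d \<bullet> g u) - scalar_step (m' n) (t' n) (a' n) u)\<^sup>2) \<partial>lborel) \<longlonglongrightarrow> 0"
    and l2': "(\<lambda>n. \<integral>\<^sup>+\<omega>. ennreal ((d \<bullet> J \<omega> - scalar_step_integral L (m' n) (t' n) (a' n) \<omega>)\<^sup>2) \<partial>M) \<longlonglongrightarrow> 0"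
    by (rule has_stoch_integral_scalar_approx[OF L J g, of d]) (rule that)
  note sq = scalar_step_integral_square_integrable[OF L mono ran]
  note sq' = scalar_step_integral_square_integrable[OF L mono' ran']
  show "square_integrable M (\<lambda>\<omega>. c \<bullet> I \<omega>)"
    by (rule square_integrable_L2_limit(2)[OF sq _ l2]) measurable
  show "square_integrable lborel (\<lambda>u. indicator {0..S} u * (c \<bullet> f u))"
    by (rule square_integrable_L2_limit(2)[OF scalar_step_square_integrable _ l1]) measurable
  have "(\<lambda>n. \<integral>\<omega>. scalar_step_integral L (m n) (t n) (a n) \<omega> * scalar_step_integral L (m' n) (t' n) (a' n) \<omega> \<partial>M)
      \<longlonglongrightarrow> (\<integral>\<omega>. (c \<bullet> I \<omega>) * (d \<bullet> J \<omega>) \<partial>M)"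
    by (rule L2_limit_integral_mult[OF sq _ l2 sq' _ l2']) measurable
  moreover have "(\<lambda>n. \<sigma>\<^sup>2 * (\<integral>u. scalar_step (m n) (t n) (a n) u * scalar_step (m' n) (t' n) (a' n) u \<partial>lborel))
      \<longlonglongrightarrow> \<sigma>\<^sup>2 * (\<integral>u. (indicator {0..S} u * (c \<bullet> f u)) * (indicator {0..T} u * (d \<bullet> g u)) \<partial>lborel)"
    by (intro tendsto_mult_left L2_limit_integral_mult[OF scalar_step_square_integrable _ l1 scalar_step_square_integrable _ l1'])
       measurable
  ultimately show "(\<integral>\<omega>. (c \<bullet> I \<omega>) * (d \<bullet> J \<omega>) \<partial>M)
      = \<sigma>\<^sup>2 * (\<integral>u. (indicator {0..S} u * (c \<bullet> f u)) * (indicator {0..T} u * (d \<bullet> g u)) \<partial>lborel)"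
    unfolding scalar_step_isometry[OF L mono ran mono' ran'] by (rule LIMSEQ_unique)
qed

section \<open>The second moment of the stationary initial state\<close>

lemma square_integrable_abs: "square_integrable M f \<Longrightarrow> square_integrable M (\<lambda>x. \<bar>f x\<bar>)"
  by (auto simp: square_integrable_def)

text \<open>An \<open>L\<^sup>2\<close> limit of square-integrable variables is square integrable.  The driver enters through versions
  \<open>V t\<close>, since the values of the two-sided process at negative times are limits that exist almost surely only
  and need not be measurable.\<close>

lemma has_stoch_integral_second_moment:
  fixes I :: "'w \<Rightarrow> 'b::euclidean_space"
  assumes I: "has_stoch_integral M L f S I"
    and V: "\<And>t. t \<in> S \<Longrightarrow> square_integrable M (V t)" "\<And>t. t \<in> S \<Longrightarrow> AE \<omega> in M. L t \<omega> = V t \<omega>"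
  shows "(\<integral>\<^sup>+\<omega>. ennreal ((norm (I \<omega>))\<^sup>2) \<partial>M) < \<infinity>"
proof -
  have [measurable]: "I \<in> borel_measurable M" using I by (simp add: has_stoch_integral_def)
  obtain m t \<gamma> where mr: "\<forall>n. mono_on {..m n} (t n) \<and> t n ` {..m n} \<subseteq> S"
    and lim: "(\<lambda>n. \<integral>\<^sup>+\<omega>. ennreal ((norm (I \<omega> - step_integral L (m n) (t n) (\<gamma> n) \<omega>))\<^sup>2) \<partial>M) \<longlonglongrightarrow> 0"
    using I unfolding has_stoch_integral_def by (elim conjE exE) (rule that)
  have "\<forall>\<^sub>F n in sequentially. (\<integral>\<^sup>+\<omega>. ennreal ((norm (I \<omega> - step_integral L (m n) (t n) (\<gamma> n) \<omega>))\<^sup>2) \<partial>M) < 1"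
    by (rule order_tendstoD[OF lim]) simp
  then obtain n where n: "(\<integral>\<^sup>+\<omega>. ennreal ((norm (I \<omega> - step_integral L (m n) (t n) (\<gamma> n) \<omega>))\<^sup>2) \<partial>M) < 1"
    by (auto simp: eventually_sequentially)
  define k and s and c where "k = m n" and "s = t n" and "c = \<gamma> n"
  have s: "mono_on {..k} s" "s ` {..k} \<subseteq> S" using mr by (auto simp: k_def s_def)
  have "AE \<omega> in M. \<forall>i\<in>{..k}. L (s i) \<omega> = V (s i) \<omega>"
    using V(2) s(2) by (intro AE_finite_allI) auto
  then have eq: "AE \<omega> in M. step_integral L k s c \<omega> = step_integral V k s c \<omega>"
    by eventually_elim (auto simp: step_integral_def intro!: sum.cong)
  have d: "square_integrable M (\<lambda>\<omega>. V (s (Suc i)) \<omega> - V (s i) \<omega>)" if "i < k" for i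
    using V(1) partition_point[OF s that] by (intro square_integrable_diff) auto
  have [measurable]: "step_integral V k s c \<in> borel_measurable M"
    unfolding step_integral_def [abs_def]
    using d by (intro borel_measurable_sum borel_measurable_scaleR) (auto simp: square_integrable_def)
  \<comment> \<open>The triangle inequality reduces the vector-valued step integral to a sum of real square-integrable terms.\<close>
  define R where "R \<omega> = (\<Sum>i<k. norm (c i) * \<bar>V (s (Suc i)) \<omega> - V (s i) \<omega>\<bar>)" for \<omega>
  have R: "square_integrable M R"
    unfolding R_def [abs_def] using d
    by (intro square_integrable_sum square_integrable_cmult square_integrable_abs) auto
  then have [measurable]: "R \<in> borel_measurable M" by (simp add: square_integrable_def)
  have le: "norm (step_integral V k s c \<omega>) \<le> R \<omega>" for \<omega>
    unfolding step_integral_def R_def by (rule order.trans[OF norm_sum]) (simp add: mult.commute)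
  have "(\<integral>\<^sup>+\<omega>. ennreal ((norm (I \<omega>))\<^sup>2) \<partial>M)
      \<le> (\<integral>\<^sup>+\<omega>. ennreal 2 * ennreal ((norm (I \<omega> - step_integral V k s c \<omega>))\<^sup>2) + ennreal 2 * ennreal ((R \<omega>)\<^sup>2) \<partial>M)"
  proof (intro nn_integral_mono)
    fix \<omega>
    let ?x = "norm (I \<omega> - step_integral V k s c \<omega>)"
    have "norm (I \<omega>) \<le> ?x + R \<omega>"
      using norm_triangle_sub[of "I \<omega>" "step_integral V k s c \<omega>"] le[of \<omega>] by simp
    then have "(norm (I \<omega>))\<^sup>2 \<le> (?x + R \<omega>)\<^sup>2" by (rule power_mono) simp
    also have "\<dots> \<le> 2 * ?x\<^sup>2 + 2 * (R \<omega>)\<^sup>2"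
      using sum_squares_bound[of ?x "R \<omega>"] by (simp add: power2_sum)
    finally have "ennreal ((norm (I \<omega>))\<^sup>2) \<le> ennreal (2 * ?x\<^sup>2 + 2 * (R \<omega>)\<^sup>2)" by (rule ennreal_leI)
    then show "ennreal ((norm (I \<omega>))\<^sup>2) \<le> ennreal 2 * ennreal (?x\<^sup>2) + ennreal 2 * ennreal ((R \<omega>)\<^sup>2)"
      by (simp add: ennreal_mult ennreal_plus del: ennreal_numeral)
  qed
  also have "\<dots> = ennreal 2 * (\<integral>\<^sup>+\<omega>. ennreal ((norm (I \<omega> - step_integral V k s c \<omega>))\<^sup>2) \<partial>M)
      + ennreal 2 * (\<integral>\<^sup>+\<omega>. ennreal ((R \<omega>)\<^sup>2) \<partial>M)"
    by (simp add: nn_integral_add nn_integral_cmult del: ennreal_numeral)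
  also have "(\<integral>\<^sup>+\<omega>. ennreal ((norm (I \<omega> - step_integral V k s c \<omega>))\<^sup>2) \<partial>M)
      = (\<integral>\<^sup>+\<omega>. ennreal ((norm (I \<omega> - step_integral L k s c \<omega>))\<^sup>2) \<partial>M)"
    by (rule nn_integral_cong_AE) (use eq in eventually_elim, simp)
  also have "ennreal 2 * \<dots> + ennreal 2 * (\<integral>\<^sup>+\<omega>. ennreal ((R \<omega>)\<^sup>2) \<partial>M) < \<infinity>"
    using n order.strict_trans[OF n ennreal_one_less_top] R
    by (subst (asm) square_integrable_iff_nn) (auto simp: k_def s_def c_def ennreal_mult_less_top)
  finally show ?thesis .
qed

lemma independent_copy_second_moment:
  assumes copy: "independent_copy M L L'" and r: "r \<ge> 0"
  shows "L' r \<in> borel_measurable M"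
    "(\<integral>\<^sup>+\<omega>. ennreal ((L' r \<omega>)\<^sup>2) \<partial>M) = (\<integral>\<^sup>+\<omega>. ennreal ((L r \<omega>)\<^sup>2) \<partial>M)"
proof -
  have [measurable]: "sample_path L \<in> measurable M path_space" "sample_path L' \<in> measurable M path_space"
    and d: "distr M path_space (sample_path L') = distr M path_space (sample_path L)"
    using copy by (auto simp: independent_copy_def indep_elements_def)
  have [measurable]: "(\<lambda>f. f r) \<in> borel_measurable path_space"
    using r by (intro measurable_component_singleton) auto
  have ev: "sample_path K \<omega> r = K r \<omega>" for K :: "real \<Rightarrow> 'a \<Rightarrow> real" and \<omega>
    using r by (simp add: sample_path_def)
  have "(\<lambda>\<omega>. sample_path L' \<omega> r) \<in> borel_measurable M" by measurable
  then show "L' r \<in> borel_measurable M" by (simp add: ev)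
  have "(\<integral>\<^sup>+f. ennreal ((f r)\<^sup>2) \<partial>distr M path_space (sample_path L')) = (\<integral>\<^sup>+\<omega>. ennreal ((L' r \<omega>)\<^sup>2) \<partial>M)"
    by (subst nn_integral_distr) (auto simp: ev)
  moreover have "(\<integral>\<^sup>+f. ennreal ((f r)\<^sup>2) \<partial>distr M path_space (sample_path L)) = (\<integral>\<^sup>+\<omega>. ennreal ((L r \<omega>)\<^sup>2) \<partial>M)"
    by (subst nn_integral_distr) (auto simp: ev)
  ultimately show "(\<integral>\<^sup>+\<omega>. ennreal ((L' r \<omega>)\<^sup>2) \<partial>M) = (\<integral>\<^sup>+\<omega>. ennreal ((L r \<omega>)\<^sup>2) \<partial>M)"
    using d by simp
qed

text \<open>At a negative time the value is almost surely a limit of \<open>- L' r\<close> along a sequence \<open>r\<close> increasing to \<open>- t\<close>; the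
  second moments along the sequence are those of \<open>L\<close> and stay bounded, so Fatou's lemma applies.\<close>

lemma two_sided_square_integrable_version:
  assumes L: "orthogonal_driver M L \<sigma>" and copy: "independent_copy M L L'" and t: "t \<le> 0"
  shows "\<exists>V. square_integrable M V \<and> (AE \<omega> in M. two_sided L L' t \<omega> = V \<omega>)"
proof (cases "t = 0")
  case True
  then show ?thesis using L by (intro exI[of _ "L 0"]) (auto simp: two_sided_def orthogonal_driver_def)
next
  case False
  define s where "s = - t"
  have s: "s > 0" using False t by (simp add: s_def)
  define r where "r n = s * (1 - 1 / real (Suc n))" for n
  have r: "0 \<le> r n" "r n < s" for n using s by (auto simp: r_def field_simps)
  have "(\<lambda>n. s * (1 - 1 / real (Suc n))) \<longlonglongrightarrow> s * (1 - 0)"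
    by (intro tendsto_intros LIMSEQ_Suc[OF lim_1_over_n])
  then have rlim: "filterlim r (at_left s) sequentially"
    unfolding filterlim_at using r(2) by (auto intro!: always_eventually simp: r_def [abs_def] less_imp_neq)
  note mom = independent_copy_second_moment[OF copy r(1)]
  have m [measurable]: "L' (r n) \<in> borel_measurable M" for n by (rule mom)
  define V where "V \<omega> = - lim (\<lambda>n. L' (r n) \<omega>)" for \<omega>
  have Vm [measurable]: "V \<in> borel_measurable M" unfolding V_def [abs_def] by measurable
  have "AE \<omega> in M. cadlag (\<lambda>t. L' t \<omega>)" using copy by (simp add: independent_copy_def)
  then have AE: "AE \<omega> in M. two_sided L L' t \<omega> = V \<omega> \<and> (\<lambda>n. L' (r n) \<omega>) \<longlonglongrightarrow> - V \<omega>"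
  proof eventually_elim
    case (elim \<omega>)
    then obtain l where l: "((\<lambda>t. L' t \<omega>) \<longlongrightarrow> l) (at_left s)" using s by (auto simp: cadlag_def)
    then have "Lim (at_left s) (\<lambda>t. L' t \<omega>) = l" by (intro tendsto_Lim) auto
    moreover have c: "(\<lambda>n. L' (r n) \<omega>) \<longlonglongrightarrow> l" using l rlim by (rule filterlim_compose)
    then have "lim (\<lambda>n. L' (r n) \<omega>) = l" by (rule limI)
    ultimately show ?case using c False t by (simp add: two_sided_def V_def s_def)
  qed
  have "(\<integral>\<^sup>+\<omega>. ennreal ((V \<omega>)\<^sup>2) \<partial>M) = (\<integral>\<^sup>+\<omega>. liminf (\<lambda>n. ennreal ((L' (r n) \<omega>)\<^sup>2)) \<partial>M)"
  proof (rule nn_integral_cong_AE, use AE in eventually_elim)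
    case (elim \<omega>)
    then have "(\<lambda>n. ennreal ((L' (r n) \<omega>)\<^sup>2)) \<longlonglongrightarrow> ennreal ((- V \<omega>)\<^sup>2)" by (intro tendsto_intros) auto
    from lim_imp_Liminf[OF sequentially_bot this] show ?case by (simp only: power2_minus)
  qed
  also have "\<dots> \<le> liminf (\<lambda>n. \<integral>\<^sup>+\<omega>. ennreal ((L' (r n) \<omega>)\<^sup>2) \<partial>M)"
    by (rule nn_integral_liminf) measurable
  also have "\<dots> \<le> liminf (\<lambda>n. ennreal (\<sigma>\<^sup>2 * s))"
  proof (intro Liminf_mono always_eventually allI)
    fix n
    have "(\<integral>\<^sup>+\<omega>. ennreal ((L (r n) \<omega>)\<^sup>2) \<partial>M) = ennreal (\<integral>\<omega>. (L (r n) \<omega>)\<^sup>2 \<partial>M)"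
      using L r(1) by (intro nn_integral_eq_integral) (auto simp: orthogonal_driver_def square_integrable_def)
    also have "(\<integral>\<omega>. (L (r n) \<omega>)\<^sup>2 \<partial>M) = \<sigma>\<^sup>2 * r n"
      using L r(1) by (simp add: orthogonal_driver_def power2_eq_square)
    also have "ennreal \<dots> \<le> ennreal (\<sigma>\<^sup>2 * s)"
      using r[of n] by (intro ennreal_leI mult_left_mono) auto
    finally show "(\<integral>\<^sup>+\<omega>. ennreal ((L' (r n) \<omega>)\<^sup>2) \<partial>M) \<le> ennreal (\<sigma>\<^sup>2 * s)" by (simp add: mom)
  qed
  also have "\<dots> < \<infinity>" by (simp add: Liminf_const)
  finally have "square_integrable M V" by (subst square_integrable_iff_nn) auto
  then show ?thesis using AE by (intro exI[of _ V]) auto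
qed

text \<open>Equality in law carries the second moment of \<open>Z\<close> over to the initial state.\<close>

lemma stationary_initial_second_moment:
  fixes X0 Z :: "'w \<Rightarrow> real ^ 'n"
  assumes L: "orthogonal_driver M L \<sigma>" and copy: "independent_copy M L L'"
    and Z: "has_stoch_integral M (two_sided L L') f {..0} Z"
    and X0: "X0 \<in> borel_measurable M" and d: "distr M borel X0 = distr M borel Z"
  shows "integrable M (\<lambda>\<omega>. (norm (X0 \<omega>))\<^sup>2)"
proof -
  have [measurable]: "Z \<in> borel_measurable M" "X0 \<in> borel_measurable M"
    using Z X0 by (auto simp: has_stoch_integral_def)
  have "\<forall>t. \<exists>V. t \<le> 0 \<longrightarrow> square_integrable M V \<and> (AE \<omega> in M. two_sided L L' t \<omega> = V \<omega>)"
    using two_sided_square_integrable_version[OF L copy] by blast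
  from choice[OF this] obtain V
    where "\<forall>t. t \<le> 0 \<longrightarrow> square_integrable M (V t) \<and> (AE \<omega> in M. two_sided L L' t \<omega> = V t \<omega>)" ..
  then have "(\<integral>\<^sup>+\<omega>. ennreal ((norm (Z \<omega>))\<^sup>2) \<partial>M) < \<infinity>"
    by (intro has_stoch_integral_second_moment[OF Z, of V]) auto
  moreover have "(\<integral>\<^sup>+\<omega>. ennreal ((norm (Z \<omega>))\<^sup>2) \<partial>M) = (\<integral>\<^sup>+z. ennreal ((norm z)\<^sup>2) \<partial>distr M borel Z)"
    by (subst nn_integral_distr) auto
  moreover have "(\<integral>\<^sup>+\<omega>. ennreal ((norm (X0 \<omega>))\<^sup>2) \<partial>M) = (\<integral>\<^sup>+z. ennreal ((norm z)\<^sup>2) \<partial>distr M borel X0)"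
    by (subst nn_integral_distr) auto
  ultimately show ?thesis using d by (simp add: integrable_iff_bounded)
qed

section \<open>Innovations of the state process\<close>

lemma integral_diff_mult_diff:
  assumes "square_integrable M a" "square_integrable M b" "square_integrable M c" "square_integrable M d"
  shows "(\<integral>x. (a x - b x) * (c x - d x) \<partial>M)
    = (\<integral>x. a x * c x \<partial>M) - (\<integral>x. a x * d x \<partial>M) - (\<integral>x. b x * c x \<partial>M) + (\<integral>x. b x * d x \<partial>M)"
proof -
  note i = square_integrable_mult[OF assms(1,3)] square_integrable_mult[OF assms(1,4)]
    square_integrable_mult[OF assms(2,3)] square_integrable_mult[OF assms(2,4)]
  have "(\<integral>x. (a x - b x) * (c x - d x) \<partial>M) = (\<integral>x. a x * c x - a x * d x - b x * c x + b x * d x \<partial>M)"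
    by (simp add: algebra_simps)
  then show ?thesis using i by simp
qed

text \<open>The part of \<open>X v\<close> that is not predicted by \<open>X u\<close>.  For the state process it is almost surely the stochastic
  integral of \<open>mexp ((v - r) A) e\<close> over \<open>r\<close> in \<open>(u, v]\<close>.\<close>

definition innovation :: "real ^ 'n ^ 'n \<Rightarrow> (real \<Rightarrow> 'w \<Rightarrow> real ^ 'n) \<Rightarrow> real \<Rightarrow> real \<Rightarrow> 'w \<Rightarrow> real ^ 'n" where
  "innovation A X u v \<omega> = X v \<omega> - mexp ((v - u) *\<^sub>R A) *v X u \<omega>"

lemma matrix_vector_measurable:
  "f \<in> borel_measurable M \<Longrightarrow> (\<lambda>\<omega>. B *v f \<omega> :: real ^ 'n) \<in> borel_measurable M"
  using borel_measurable_continuous_on[OF matrix_vector_mult_linear_continuous_on[of UNIV B]] by blast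

text \<open>The initial state cancels by the semigroup property, which leaves the difference of two stochastic
  integrals from \<open>0\<close>.  Since \<open>mexp ((v - u) A)\<close> carries the kernel of \<open>X u\<close> into that of \<open>X v\<close>, the
  difference of the kernels is the kernel of \<open>X v\<close> restricted to \<open>(u, v]\<close>.\<close>

lemma innovation_covariance:
  fixes A :: "real ^ 'n::{finite,linorder} ^ 'n::{finite,linorder}"
  assumes L: "orthogonal_driver M L \<sigma>" and X: "carma_state M L A X"
    and uv: "0 \<le> u" "u \<le> v" and st: "0 \<le> s" "s \<le> t"
  defines "k \<equiv> (\<lambda>t r. mexp ((t - r) *\<^sub>R A) *v e_vec)"
  shows "square_integrable M (\<lambda>\<omega>. c \<bullet> innovation A X u v \<omega>)"
    and "(\<integral>\<omega>. (c \<bullet> innovation A X u v \<omega>) * (d \<bullet> innovation A X s t \<omega>) \<partial>M)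
      = \<sigma>\<^sup>2 * (\<integral>r. (indicator {u<..v} r * (c \<bullet> k v r)) * (indicator {s<..t} r * (d \<bullet> k t r)) \<partial>lborel)"
proof -
  have Xm: "X r \<in> borel_measurable M" if "r \<ge> 0" for r using X that by (simp add: carma_state_def)
  have "\<forall>r. \<exists>I. r \<ge> 0 \<longrightarrow> has_stoch_integral M L (k r) {0..r} I \<and>
      (AE \<omega> in M. X r \<omega> = mexp (r *\<^sub>R A) *v X 0 \<omega> + I \<omega>)"
    using X unfolding carma_state_def k_def by blast
  from choice[OF this] obtain I where I0: "\<forall>r. r \<ge> 0 \<longrightarrow> has_stoch_integral M L (k r) {0..r} (I r) \<and>
      (AE \<omega> in M. X r \<omega> = mexp (r *\<^sub>R A) *v X 0 \<omega> + I r \<omega>)" ..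
  have I: "has_stoch_integral M L (k r) {0..r} (I r)"
    and XI: "AE \<omega> in M. X r \<omega> = mexp (r *\<^sub>R A) *v X 0 \<omega> + I r \<omega>" if "r \<ge> 0" for r
    using I0 that by auto
  have kc: "continuous_on UNIV (k r)" for r
    unfolding k_def by (intro continuous_on_mexp_vec continuous_intros)
  have km: "k r \<in> borel_measurable borel" for r
    by (rule borel_measurable_continuous_onI[OF kc])
  have kmult: "mexp ((b - a) *\<^sub>R A) *v k a r = k b r" for a b r
    unfolding k_def matrix_vector_mul_assoc mexp_add[symmetric] by simp
  have kernel: "indicator {0..b} r * (e \<bullet> k b r) - indicator {0..a} r * ((e v* mexp ((b - a) *\<^sub>R A)) \<bullet> k a r)
      = indicator {a<..b} r * (e \<bullet> k b r)" if "0 \<le> a" "a \<le> b" for a b r e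
    using that unfolding dot_lmul_matrix kmult by (auto simp: indicator_def)
  have W: "AE \<omega> in M. e \<bullet> I b \<omega> - (e v* mexp ((b - a) *\<^sub>R A)) \<bullet> I a \<omega> = e \<bullet> innovation A X a b \<omega>"
    if "0 \<le> a" "a \<le> b" for a b e
  proof -
    have b: "mexp (b *\<^sub>R A) = mexp ((b - a) *\<^sub>R A) ** mexp (a *\<^sub>R A)" unfolding mexp_add[symmetric] by simp
    have "b \<ge> 0" using that by simp
    from XI[OF that(1)] XI[OF this] show ?thesis
    proof eventually_elim
      case (elim \<omega>)
      then show ?case unfolding dot_lmul_matrix innovation_def b
        by (simp add: matrix_vector_right_distrib matrix_vector_mul_assoc inner_diff_right inner_add_right)
    qed
  qed
  have Wm: "(\<lambda>\<omega>. e \<bullet> innovation A X a b \<omega>) \<in> borel_measurable M" if "0 \<le> a" "a \<le> b" for a b e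
    unfolding innovation_def using Xm[of a] Xm[of b] that
    by (intro borel_measurable_inner borel_measurable_diff matrix_vector_measurable) auto
  note iso = stoch_integral_isometry[OF L I km I km]
  have sqI: "square_integrable M (\<lambda>\<omega>. e \<bullet> I r \<omega>)" "square_integrable lborel (\<lambda>x. indicator {0..r} x * (e \<bullet> k r x))"
    if "r \<ge> 0" for e r
    using iso(1,2)[OF that that] by auto
  have sqW: "square_integrable M (\<lambda>\<omega>. e \<bullet> innovation A X a b \<omega>)" if "0 \<le> a" "a \<le> b" for a b e
    by (rule square_integrable_cong_AE[OF square_integrable_diff W[OF that] Wm[OF that]]) (use that in \<open>auto intro: sqI\<close>)
  show "square_integrable M (\<lambda>\<omega>. c \<bullet> innovation A X u v \<omega>)" by (rule sqW[OF uv])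
  let ?c = "c v* mexp ((v - u) *\<^sub>R A)" and ?d = "d v* mexp ((t - s) *\<^sub>R A)"
  have nn: "0 \<le> v" "0 \<le> t" using uv st by auto
  have "(\<integral>\<omega>. (c \<bullet> innovation A X u v \<omega>) * (d \<bullet> innovation A X s t \<omega>) \<partial>M)
      = (\<integral>\<omega>. (c \<bullet> I v \<omega> - ?c \<bullet> I u \<omega>) * (d \<bullet> I t \<omega> - ?d \<bullet> I s \<omega>) \<partial>M)"
  proof (rule integral_cong_AE)
    show "AE \<omega> in M. (c \<bullet> innovation A X u v \<omega>) * (d \<bullet> innovation A X s t \<omega>)
      = (c \<bullet> I v \<omega> - ?c \<bullet> I u \<omega>) * (d \<bullet> I t \<omega> - ?d \<bullet> I s \<omega>)"
      using W[OF uv, of c] W[OF st, of d] by eventually_elim simp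
    have "(\<lambda>\<omega>. e \<bullet> I r \<omega>) \<in> borel_measurable M" if "r \<ge> 0" for e r
      using sqI(1)[OF that] by (simp add: square_integrable_def)
    then show "(\<lambda>\<omega>. (c \<bullet> I v \<omega> - ?c \<bullet> I u \<omega>) * (d \<bullet> I t \<omega> - ?d \<bullet> I s \<omega>)) \<in> borel_measurable M"
      using uv st nn by (intro borel_measurable_times borel_measurable_diff) auto
  qed (intro borel_measurable_times Wm uv st)
  also have "\<dots> = \<sigma>\<^sup>2 * (\<integral>r. (indicator {0..v} r * (c \<bullet> k v r) - indicator {0..u} r * (?c \<bullet> k u r))
        * (indicator {0..t} r * (d \<bullet> k t r) - indicator {0..s} r * (?d \<bullet> k s r)) \<partial>lborel)"
    unfolding integral_diff_mult_diff[OF sqI(1)[OF nn(1)] sqI(1)[OF uv(1)] sqI(1)[OF nn(2)] sqI(1)[OF st(1)]]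
      integral_diff_mult_diff[OF sqI(2)[OF nn(1)] sqI(2)[OF uv(1)] sqI(2)[OF nn(2)] sqI(2)[OF st(1)]]
      iso(3)[OF nn] iso(3)[OF nn(1) st(1)] iso(3)[OF uv(1) nn(2)] iso(3)[OF uv(1) st(1)]
    by (simp only: right_diff_distrib distrib_left)
  also have "\<dots> = \<sigma>\<^sup>2 * (\<integral>r. (indicator {u<..v} r * (c \<bullet> k v r)) * (indicator {s<..t} r * (d \<bullet> k t r)) \<partial>lborel)"
    unfolding kernel[OF uv] kernel[OF st] ..
  finally show "(\<integral>\<omega>. (c \<bullet> innovation A X u v \<omega>) * (d \<bullet> innovation A X s t \<omega>) \<partial>M)
      = \<sigma>\<^sup>2 * (\<integral>r. (indicator {u<..v} r * (c \<bullet> k v r)) * (indicator {s<..t} r * (d \<bullet> k t r)) \<partial>lborel)" .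
qed


text \<open>The kernels of innovations over disjoint intervals have disjoint supports.\<close>

lemma innovation_orthogonal:
  fixes A :: "real ^ 'n::{finite,linorder} ^ 'n::{finite,linorder}"
  assumes L: "orthogonal_driver M L \<sigma>" and X: "carma_state M L A X"
    and "0 \<le> u" "u \<le> v" "v \<le> s" "s \<le> t"
  shows "(\<integral>\<omega>. (c \<bullet> innovation A X u v \<omega>) * (d \<bullet> innovation A X s t \<omega>) \<partial>M) = 0"
proof -
  have st: "0 \<le> s" "s \<le> t" using assms by auto
  have "(\<lambda>r. (indicator {u<..v} r * a r) * (indicator {s<..t} r * b r) :: real) = (\<lambda>r. 0)" for a b
    using \<open>v \<le> s\<close> by (auto simp: indicator_def)
  then show ?thesis
    unfolding innovation_covariance(2)[OF L X \<open>0 \<le> u\<close> \<open>u \<le> v\<close> st] by simp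
qed

lemma exp_kernel_integral:
  fixes c t :: real
  assumes "c > 0" "t \<ge> 0"
  shows "integrable lborel (\<lambda>r. indicator {0<..t} r * exp (- c * (t - r)))"
    "(\<integral>r. indicator {0<..t} r * exp (- c * (t - r)) \<partial>lborel) \<le> 1 / c"
proof -
  have i: "has_bochner_integral lborel (\<lambda>r. exp (- c * (t - r)) * indicator {0..t} r)
      (exp (- c * (t - t)) / c - exp (- c * (t - 0)) / c)"
    using assms by (intro has_bochner_integral_FTC_Icc_real[where F = "\<lambda>r. exp (- c * (t - r)) / c"])
      (auto intro!: derivative_eq_intros continuous_intros)
  have "has_bochner_integral lborel (\<lambda>r. indicator {0<..t} r * exp (- c * (t - r)))
      (exp (- c * (t - t)) / c - exp (- c * (t - 0)) / c)"
  proof (rule has_bochner_integral_cong_AE[THEN iffD1, OF _ _ _ i])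
    have "AE r in lborel. r \<noteq> (0::real)" by (rule AE_lborel_singleton)
    then show "AE r in lborel. exp (- c * (t - r)) * indicator {0..t} r = indicator {0<..t} r * exp (- c * (t - r))"
      by eventually_elim (auto simp: indicator_def)
  qed auto
  then show "integrable lborel (\<lambda>r. indicator {0<..t} r * exp (- c * (t - r)))"
    "(\<integral>r. indicator {0<..t} r * exp (- c * (t - r)) \<partial>lborel) \<le> 1 / c"
    using assms by (auto simp: has_bochner_integral_iff)
qed

text \<open>For short intervals the kernel is bounded, so the innovation has variance of the order of the length.  For
  the moments of \<open>X t\<close>, which is \<open>mexp (t A) (X 0)\<close> plus the innovation from \<open>0\<close> to \<open>t\<close>, the bound must not grow with
  \<open>t\<close>; there the exponential decay of the kernel is integrated over the whole past.\<close>

lemma carma_second_moment_bounds: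
  fixes A :: "real ^ 'n::{finite,linorder} ^ 'n::{finite,linorder}"
  assumes L: "orthogonal_driver M L \<sigma>" and X: "carma_state M L A X"
    and stable: "\<And>z. is_eigenvalue (map_matrix complex_of_real A) z \<Longrightarrow> Re z < 0"
    and X0: "integrable M (\<lambda>\<omega>. (norm (X 0 \<omega>))\<^sup>2)"
  obtains K where "K \<ge> 0"
    "\<And>t. t \<ge> 0 \<Longrightarrow> integrable M (\<lambda>\<omega>. (norm (X t \<omega>))\<^sup>2)"
    "\<And>t. t \<ge> 0 \<Longrightarrow> (\<integral>\<omega>. (norm (X t \<omega>))\<^sup>2 \<partial>M) \<le> K"
    "\<And>u v c. 0 \<le> u \<Longrightarrow> u \<le> v \<Longrightarrow> (\<integral>\<omega>. (c \<bullet> innovation A X u v \<omega>)\<^sup>2 \<partial>M) \<le> K * (norm c)\<^sup>2 * (v - u)"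
proof -
  obtain C \<delta> where \<delta>: "\<delta> > 0" and C: "C \<ge> 0"
    and decay: "\<And>t v. t \<ge> 0 \<Longrightarrow> norm (mexp (t *\<^sub>R A) *v v) \<le> C * exp (- \<delta> * t) * norm v"
    using mexp_decay[OF stable] by metis
  let ?e = "e_vec :: real ^ 'n::{finite,linorder}"
  let ?W = "innovation A X"
  let ?k = "\<lambda>c v r. c \<bullet> (mexp ((v - r) *\<^sub>R A) *v ?e)"
  define B where "B = \<sigma>\<^sup>2 * (C * norm ?e)\<^sup>2"
  have B: "B \<ge> 0" by (simp add: B_def)
  have ker: "(?k c v r)\<^sup>2 \<le> ((norm c)\<^sup>2 * (C * norm ?e)\<^sup>2) * exp (- (2 * \<delta>) * (v - r))"
    if "r \<le> v" for c v r
  proof -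
    have "(?k c v r)\<^sup>2 \<le> (norm c)\<^sup>2 * (norm (mexp ((v - r) *\<^sub>R A) *v ?e))\<^sup>2"
      by (rule inner_square_le)
    also have "\<dots> \<le> (norm c)\<^sup>2 * (C * exp (- \<delta> * (v - r)) * norm ?e)\<^sup>2"
      using decay[of "v - r"] that by (intro mult_left_mono power_mono) auto
    also have "\<dots> = ((norm c)\<^sup>2 * (C * norm ?e)\<^sup>2) * (exp (- \<delta> * (v - r)))\<^sup>2"
      by (simp add: power_mult_distrib)
    also have "(exp (- \<delta> * (v - r)))\<^sup>2 = exp (- (2 * \<delta>) * (v - r))"
      by (simp add: power2_eq_square flip: exp_add)
    finally show ?thesis .
  qed
  have cov: "(\<integral>\<omega>. (c \<bullet> ?W u v \<omega>)\<^sup>2 \<partial>M)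
      = \<sigma>\<^sup>2 * (\<integral>r. indicator {u<..v} r * (?k c v r)\<^sup>2 \<partial>lborel)"
    if "0 \<le> u" "u \<le> v" for c u v
  proof -
    have "(\<integral>r. indicator {u<..v} r * (?k c v r)\<^sup>2 \<partial>lborel)
      = (\<integral>r. (indicator {u<..v} r * (?k c v r)) * (indicator {u<..v} r * (?k c v r)) \<partial>lborel)"
      by (intro Bochner_Integration.integral_cong) (auto simp: indicator_def power2_eq_square)
    then show ?thesis
      using innovation_covariance(2)[OF L X that that, of c c] by (simp add: power2_eq_square)
  qed
  have short: "(\<integral>\<omega>. (c \<bullet> ?W u v \<omega>)\<^sup>2 \<partial>M) \<le> B * (norm c)\<^sup>2 * (v - u)" if "0 \<le> u" "u \<le> v" for c u v
  proof -
    let ?b = "(norm c)\<^sup>2 * (C * norm ?e)\<^sup>2"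
    have "(\<integral>r. indicator {u<..v} r * (?k c v r)\<^sup>2 \<partial>lborel)
        \<le> (\<integral>r. indicator {u<..v} r * ?b \<partial>lborel)"
    proof (rule integral_mono')
      show "integrable lborel (\<lambda>r. indicator {u<..v} r * ?b)"
        using emeasure_bounded_finite[OF bounded_Ioc, of u v]
        by (intro integrable_mult_left integrable_real_indicator) auto
      show "indicator {u<..v} r * (?k c v r)\<^sup>2 \<le> indicator {u<..v} r * ?b" for r
      proof (cases "r \<in> {u<..v}")
        case True
        then have "(?k c v r)\<^sup>2 \<le> ?b * exp (- (2 * \<delta>) * (v - r))" by (intro ker) auto
        also have "\<dots> \<le> ?b * 1" using True \<delta> by (intro mult_left_mono) auto
        finally show ?thesis using True by simp
      qed simp
    qed auto
    also have "\<dots> = ?b * (v - u)" using that by simp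
    finally have "\<sigma>\<^sup>2 * (\<integral>r. indicator {u<..v} r * (?k c v r)\<^sup>2 \<partial>lborel) \<le> \<sigma>\<^sup>2 * (?b * (v - u))"
      by (rule mult_left_mono) simp
    then show ?thesis unfolding cov[OF that] by (simp add: B_def mult_ac)
  qed
  have long: "(\<integral>\<omega>. (c \<bullet> ?W 0 t \<omega>)\<^sup>2 \<partial>M) \<le> B * (norm c)\<^sup>2 / (2 * \<delta>)" if "t \<ge> 0" for c t
  proof -
    let ?b = "(norm c)\<^sup>2 * (C * norm ?e)\<^sup>2"
    note E = exp_kernel_integral[of "2 * \<delta>" t]
    have "(\<integral>r. indicator {0<..t} r * (?k c t r)\<^sup>2 \<partial>lborel)
        \<le> (\<integral>r. ?b * (indicator {0<..t} r * exp (- (2 * \<delta>) * (t - r))) \<partial>lborel)"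
    proof (rule integral_mono')
      show "integrable lborel (\<lambda>r. ?b * (indicator {0<..t} r * exp (- (2 * \<delta>) * (t - r))))"
        using E \<delta> that by (intro integrable_mult_right) auto
      show "indicator {0<..t} r * (?k c t r)\<^sup>2
          \<le> ?b * (indicator {0<..t} r * exp (- (2 * \<delta>) * (t - r)))" for r
        using ker[of r t c] by (auto simp: indicator_def)
    qed auto
    also have "\<dots> \<le> ?b * (1 / (2 * \<delta>))"
      unfolding integral_mult_right_zero using E(2) \<delta> that by (intro mult_left_mono) auto
    finally have "\<sigma>\<^sup>2 * (\<integral>r. indicator {0<..t} r * (?k c t r)\<^sup>2 \<partial>lborel) \<le> \<sigma>\<^sup>2 * (?b * (1 / (2 * \<delta>)))"
      by (rule mult_left_mono) simp
    then show ?thesis unfolding cov[OF order_refl that] by (simp add: B_def mult_ac)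
  qed
  define K where "K = 2 * C\<^sup>2 * (\<integral>\<omega>. (norm (X 0 \<omega>))\<^sup>2 \<partial>M) + 2 * (real CARD('n) * (B / (2 * \<delta>))) + B"
  have nonneg: "0 \<le> 2 * C\<^sup>2 * (\<integral>\<omega>. (norm (X 0 \<omega>))\<^sup>2 \<partial>M)" "0 \<le> 2 * (real CARD('n) * (B / (2 * \<delta>)))"
    using B \<delta> by auto
  have moment: "integrable M (\<lambda>\<omega>. (norm (X t \<omega>))\<^sup>2) \<and> (\<integral>\<omega>. (norm (X t \<omega>))\<^sup>2 \<partial>M) \<le> K" if t: "t \<ge> 0" for t
  proof -
    have Xm: "X t \<in> borel_measurable M" using X t by (simp add: carma_state_def)
    have sq: "square_integrable M (\<lambda>\<omega>. axis i 1 \<bullet> ?W 0 t \<omega>)" for i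
      by (rule innovation_covariance(1)[OF L X order_refl t order_refl t])
    have Wn: "(norm (?W 0 t \<omega>))\<^sup>2 = (\<Sum>i\<in>UNIV. (axis i 1 \<bullet> ?W 0 t \<omega>)\<^sup>2)" for \<omega>
    proof -
      have "axis i 1 \<bullet> ?W 0 t \<omega> = ?W 0 t \<omega> $ i" for i by (simp add: inner_axis')
      then show ?thesis unfolding power2_norm_eq_inner by (simp add: inner_vec_def power2_eq_square)
    qed
    have Wi: "integrable M (\<lambda>\<omega>. (norm (?W 0 t \<omega>))\<^sup>2)"
      unfolding Wn using sq by (intro Bochner_Integration.integrable_sum) (auto simp: square_integrable_def)
    have "(\<integral>\<omega>. (norm (?W 0 t \<omega>))\<^sup>2 \<partial>M) = (\<Sum>i\<in>UNIV. \<integral>\<omega>. (axis i 1 \<bullet> ?W 0 t \<omega>)\<^sup>2 \<partial>M)"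
      unfolding Wn using sq by (intro Bochner_Integration.integral_sum) (auto simp: square_integrable_def)
    also have "\<dots> \<le> (\<Sum>i\<in>(UNIV::'n set). B / (2 * \<delta>))"
      using long[OF t, of "axis _ 1"] by (intro sum_mono) simp
    finally have Wb: "(\<integral>\<omega>. (norm (?W 0 t \<omega>))\<^sup>2 \<partial>M) \<le> real CARD('n) * (B / (2 * \<delta>))" by simp
    have le: "(norm (X t \<omega>))\<^sup>2 \<le> 2 * C\<^sup>2 * (norm (X 0 \<omega>))\<^sup>2 + 2 * (norm (?W 0 t \<omega>))\<^sup>2" for \<omega>
    proof -
      have "X t \<omega> = mexp (t *\<^sub>R A) *v X 0 \<omega> + ?W 0 t \<omega>" by (simp add: innovation_def)
      then have "norm (X t \<omega>) \<le> norm (mexp (t *\<^sub>R A) *v X 0 \<omega>) + norm (?W 0 t \<omega>)"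
        by (simp add: norm_triangle_ineq)
      also have "norm (mexp (t *\<^sub>R A) *v X 0 \<omega>) \<le> C * exp (- \<delta> * t) * norm (X 0 \<omega>)" by (rule decay[OF t])
      also have "\<dots> \<le> C * 1 * norm (X 0 \<omega>)" using C \<delta> t by (intro mult_right_mono mult_left_mono) auto
      finally have "(norm (X t \<omega>))\<^sup>2 \<le> (C * norm (X 0 \<omega>) + norm (?W 0 t \<omega>))\<^sup>2" by (intro power_mono) auto
      also have "\<dots> \<le> 2 * (C * norm (X 0 \<omega>))\<^sup>2 + 2 * (norm (?W 0 t \<omega>))\<^sup>2"
        using sum_squares_bound[of "C * norm (X 0 \<omega>)" "norm (?W 0 t \<omega>)"] unfolding power2_sum by linarith
      finally show ?thesis by (simp add: power_mult_distrib)
    qed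
    have i: "integrable M (\<lambda>\<omega>. 2 * C\<^sup>2 * (norm (X 0 \<omega>))\<^sup>2 + 2 * (norm (?W 0 t \<omega>))\<^sup>2)"
      using X0 Wi by (intro Bochner_Integration.integrable_add integrable_mult_right)
    have iX: "integrable M (\<lambda>\<omega>. (norm (X t \<omega>))\<^sup>2)"
      by (rule Bochner_Integration.integrable_bound[OF i])
         (use Xm le in \<open>auto intro!: AE_I2 order.trans[OF _ abs_ge_self]\<close>)
    have "(\<integral>\<omega>. (norm (X t \<omega>))\<^sup>2 \<partial>M) \<le> (\<integral>\<omega>. 2 * C\<^sup>2 * (norm (X 0 \<omega>))\<^sup>2 + 2 * (norm (?W 0 t \<omega>))\<^sup>2 \<partial>M)"
      by (rule integral_mono[OF iX i le])
    also have "\<dots> = 2 * C\<^sup>2 * (\<integral>\<omega>. (norm (X 0 \<omega>))\<^sup>2 \<partial>M) + 2 * (\<integral>\<omega>. (norm (?W 0 t \<omega>))\<^sup>2 \<partial>M)"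
      using X0 Wi by simp
    also have "\<dots> \<le> K" using Wb B unfolding K_def by linarith
    finally show ?thesis using iX by simp
  qed
  show ?thesis
  proof (rule that[of K])
    show "K \<ge> 0" using nonneg B by (simp add: K_def)
    show "(\<integral>\<omega>. (c \<bullet> ?W u v \<omega>)\<^sup>2 \<partial>M) \<le> K * (norm c)\<^sup>2 * (v - u)" if "0 \<le> u" "u \<le> v" for u v c
    proof -
      have "B * (norm c)\<^sup>2 * (v - u) \<le> K * (norm c)\<^sup>2 * (v - u)"
        using nonneg that by (intro mult_right_mono) (auto simp: K_def)
      then show ?thesis using short[OF that, of c] by linarith
    qed
  qed (use moment in auto)
qed

section \<open>The trapezoidal rule for smooth functions\<close>

definition trap_err :: "real \<Rightarrow> real \<Rightarrow> (real \<Rightarrow> real) \<Rightarrow> real" where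
  "trap_err a b g = (b - a) / 2 * (g a + g b) - (LBINT t:{a..b}. g t)"

text \<open>Let \<open>P h\<close> be the error on \<open>[a, h]\<close> and \<open>H h = 2 P' h = g a - g h + (h - a) g' h\<close>.  Then
  \<open>H' h = (h - a) g'' h\<close>, and two applications of the mean value inequality give the claim.  The constant is
  not optimal.\<close>

lemma trapezoid_error:
  fixes g g' g'' :: "real \<Rightarrow> real"
  assumes ab: "a < b" and g: "\<And>t. (g has_real_derivative g' t) (at t)"
    and g': "\<And>t. (g' has_real_derivative g'' t) (at t)"
    and K: "\<And>t. a \<le> t \<Longrightarrow> t \<le> b \<Longrightarrow> \<bar>g'' t\<bar> \<le> K"
  shows "\<bar>trap_err a b g\<bar> \<le> K * (b - a) ^ 3"
proof -
  have cont: "continuous_on S g" "continuous_on S g'" for S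
    by (rule DERIV_continuous_on[OF DERIV_subset[OF g]], simp, rule DERIV_continuous_on[OF DERIV_subset[OF g']], simp)
  have K0: "K \<ge> 0" using K[of a] ab by simp
  define H where "H h = g a - g h + (h - a) * g' h" for h
  have H: "\<bar>H h\<bar> \<le> K * (b - a) * (b - a)" if h: "a < h" "h < b" for h
  proof -
    have "norm (H h - H a) \<le> K * (b - a) * h - K * (b - a) * a"
    proof (rule differentiable_bound_general[OF h(1)])
      show "continuous_on {a..h} H" "continuous_on {a..h} (\<lambda>h. K * (b - a) * h)"
        unfolding H_def by (intro continuous_intros cont)+
      show "(H has_vector_derivative (t - a) * g'' t) (at t)" for t
        unfolding has_real_derivative_iff_has_vector_derivative[symmetric] H_def
        by (auto intro!: derivative_eq_intros g g')
      show "((\<lambda>h. K * (b - a) * h) has_vector_derivative K * (b - a)) (at t)" for t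
        unfolding has_real_derivative_iff_has_vector_derivative[symmetric]
        by (auto intro!: derivative_eq_intros)
      show "norm ((t - a) * g'' t) \<le> K * (b - a)" if "a < t" "t < h" for t
        using mult_mono[of "t - a" "b - a" "\<bar>g'' t\<bar>" K] K[of t] that h by (simp add: abs_mult mult.commute)
    qed
    also have "\<dots> = K * (b - a) * (h - a)" by (simp add: right_diff_distrib)
    also have "\<dots> \<le> K * (b - a) * (b - a)" using K0 h by (intro mult_left_mono) auto
    finally show ?thesis by (simp add: H_def)
  qed
  define P where "P h = (h - a) / 2 * (g a + g h) - integral {a..h} g" for h
  have "norm (P b - P a) \<le> K * (b - a) * (b - a) / 2 * b - K * (b - a) * (b - a) / 2 * a"
  proof (rule differentiable_bound_general[OF ab])
    show "continuous_on {a..b} P"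
      unfolding P_def by (intro continuous_intros cont indefinite_integral_continuous_1 integrable_continuous_real) auto
    show "continuous_on {a..b} (\<lambda>h. K * (b - a) * (b - a) / 2 * h)" by (intro continuous_intros)
    show "(P has_vector_derivative H t / 2) (at t)" if t: "a < t" "t < b" for t
    proof -
      have "((\<lambda>u. integral {a..u} g) has_real_derivative g t) (at t within {a..b})"
        using t by (intro integral_has_real_derivative cont) auto
      then have "((\<lambda>u. integral {a..u} g) has_real_derivative g t) (at t)"
        using t by (simp add: at_within_Icc_at)
      then have "(P has_real_derivative (g a + g t) / 2 + (t - a) / 2 * g' t - g t) (at t)"
        unfolding P_def by (auto intro!: derivative_eq_intros g)
      moreover have "(g a + g t) / 2 + (t - a) / 2 * g' t - g t = H t / 2" by (simp add: H_def field_simps)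
      ultimately have "(P has_real_derivative H t / 2) (at t)" by (simp only:)
      then show ?thesis by (simp only: has_real_derivative_iff_has_vector_derivative)
    qed
    show "((\<lambda>h. K * (b - a) * (b - a) / 2 * h) has_vector_derivative K * (b - a) * (b - a) / 2) (at t)" for t
      unfolding has_real_derivative_iff_has_vector_derivative[symmetric]
      by (rule derivative_eq_intros refl | simp)+
    show "norm (H t / 2) \<le> K * (b - a) * (b - a) / 2" if "a < t" "t < b" for t
      using H[OF that] by simp
  qed
  also have "\<dots> = K * (b - a) ^ 3 / 2" by (simp add: power3_eq_cube flip: right_diff_distrib)
  also have "\<dots> \<le> K * (b - a) ^ 3" using K0 ab by simp
  also have "P b - P a = trap_err a b g"
  proof -
    have "set_integrable lborel {a..b} g" using cont(1) by (rule borel_integrable_atLeastAtMost')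
    from set_borel_integral_eq_integral(2)[OF this] show ?thesis by (simp add: P_def trap_err_def)
  qed
  finally show ?thesis by simp
qed

section \<open>Riemann sums and cadlag paths\<close>

text \<open>The step function on \<open>[a, b)\<close> that takes on each of \<open>n + 1\<close> equal cells the value of \<open>g\<close> at the right endpoint
  of the cell; right endpoints are forced by one-sided continuity.\<close>

definition riemann_step :: "nat \<Rightarrow> real \<Rightarrow> real \<Rightarrow> (real \<Rightarrow> real) \<Rightarrow> real \<Rightarrow> real" where
  "riemann_step n a b g r = (\<Sum>i<Suc n. g (a + (real i + 1) * ((b - a) / real (Suc n))) *
     indicator {a + real i * ((b - a) / real (Suc n)) ..< a + (real i + 1) * ((b - a) / real (Suc n))} r)"

lemma riemann_step_eq:
  assumes ab: "a < b" and r: "a \<le> r" "r < b"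
  shows "\<exists>\<tau>. riemann_step n a b g r = g \<tau> \<and> r < \<tau> \<and> \<tau> \<le> b \<and> \<tau> \<le> r + (b - a) / real (Suc n)"
proof -
  define \<delta> where "\<delta> = (b - a) / real (Suc n)"
  have \<delta>: "\<delta> > 0" using ab by (simp add: \<delta>_def)
  have b: "b = a + (real n + 1) * \<delta>" using ab by (simp add: \<delta>_def field_simps)
  define j where "j = nat \<lfloor>(r - a) / \<delta>\<rfloor>"
  have fl: "real j = real_of_int \<lfloor>(r - a) / \<delta>\<rfloor>" using r \<delta> by (simp add: j_def)
  have "real j \<le> (r - a) / \<delta>" "(r - a) / \<delta> < real j + 1" unfolding fl by linarith+
  then have j: "real j * \<delta> \<le> r - a" "r - a < (real j + 1) * \<delta>" using \<delta> by (auto simp: field_simps)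
  have "(real j) * \<delta> < (real n + 1) * \<delta>" using j(1) r b by linarith
  then have jn: "j < Suc n" using \<delta> by simp
  have mem: "r \<in> {a + real i * \<delta> ..< a + (real i + 1) * \<delta>} \<longleftrightarrow> i = j" for i
  proof
    assume "r \<in> {a + real i * \<delta> ..< a + (real i + 1) * \<delta>}"
    then have i: "real i * \<delta> \<le> r - a" "r - a < (real i + 1) * \<delta>" by auto
    have "real i * \<delta> < (real j + 1) * \<delta>" "real j * \<delta> < (real i + 1) * \<delta>" using i j by linarith+
    then have "real i < real j + 1" "real j < real i + 1" using \<delta> by simp_all
    then show "i = j" by linarith
  qed (use j in auto)
  have "riemann_step n a b g r = (\<Sum>i<Suc n. if i = j then g (a + (real i + 1) * \<delta>) else 0)"
    unfolding riemann_step_def \<delta>_def[symmetric] indicator_def mem by (intro sum.cong) auto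
  also have "\<dots> = g (a + (real j + 1) * \<delta>)" using jn by simp
  finally have "riemann_step n a b g r = g (a + (real j + 1) * \<delta>)" .
  moreover have "(real j + 1) * \<delta> \<le> (real n + 1) * \<delta>" using jn \<delta> by (intro mult_right_mono) auto
  then have "a + (real j + 1) * \<delta> \<le> b" using b by simp
  moreover have "a + (real j + 1) * \<delta> \<le> r + \<delta>" using j(1) by (simp add: distrib_right)
  ultimately show ?thesis using j(2) unfolding \<delta>_def[symmetric] by (intro exI[of _ "a + (real j + 1) * \<delta>"]) auto
qed

lemma riemann_step_outside:
  assumes "a < b" "\<not> (a \<le> r \<and> r < b)"
  shows "riemann_step n a b g r = 0"
proof -
  define \<delta> where "\<delta> = (b - a) / real (Suc n)"
  have \<delta>: "\<delta> > 0" using assms by (simp add: \<delta>_def)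
  have b: "b = a + (real n + 1) * \<delta>" using assms by (simp add: \<delta>_def field_simps)
  have "r \<notin> {a + real i * \<delta> ..< a + (real i + 1) * \<delta>}" if "i < Suc n" for i
  proof -
    have "(real i + 1) * \<delta> \<le> (real n + 1) * \<delta>" "0 \<le> real i * \<delta>"
      using that \<delta> by (auto intro!: mult_right_mono)
    then show ?thesis using assms b by auto
  qed
  then show ?thesis unfolding riemann_step_def \<delta>_def[symmetric] by (intro sum.neutral) auto
qed

text \<open>At a point \<open>r\<close> the step function takes a value \<open>g \<tau>\<close> with \<open>\<tau>\<close> slightly larger than \<open>r\<close>, so it converges by
  right-continuity, boundedly.  This also yields measurability of \<open>g\<close> on the interval.\<close>

lemma right_continuous_riemann:
  fixes g :: "real \<Rightarrow> real"
  assumes ab: "a < b" and rc: "\<And>t. a \<le> t \<Longrightarrow> t < b \<Longrightarrow> (g \<longlongrightarrow> g t) (at_right t)"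
    and B: "\<And>t. a \<le> t \<Longrightarrow> t \<le> b \<Longrightarrow> \<bar>g t\<bar> \<le> B"
  shows "set_integrable lborel {a..b} g"
    "(\<lambda>n. \<Sum>i<Suc n. (b - a) / real (Suc n) * g (a + (real i + 1) * ((b - a) / real (Suc n)))) \<longlonglongrightarrow> (LBINT t:{a..b}. g t)"
proof -
  let ?s = "\<lambda>n. riemann_step n a b g" and ?g = "\<lambda>r. indicator {a..<b} r * g r"
  have sm: "?s n \<in> borel_measurable lborel" for n unfolding riemann_step_def [abs_def] by measurable
  have lim: "(\<lambda>n. ?s n r) \<longlonglongrightarrow> ?g r" for r
  proof (cases "a \<le> r \<and> r < b")
    case True
    then have "\<forall>n. \<exists>\<tau>. ?s n r = g \<tau> \<and> r < \<tau> \<and> \<tau> \<le> b \<and> \<tau> \<le> r + (b - a) / real (Suc n)"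
      using riemann_step_eq[OF ab] by blast
    from choice[OF this] obtain \<tau> where "\<forall>n. ?s n r = g (\<tau> n) \<and> r < \<tau> n \<and> \<tau> n \<le> b \<and> \<tau> n \<le> r + (b - a) / real (Suc n)" ..
    then have \<tau>: "\<And>n. ?s n r = g (\<tau> n)" "\<And>n. r < \<tau> n" "\<And>n. \<tau> n \<le> r + (b - a) / real (Suc n)" by auto
    have "(\<lambda>n. r + (b - a) * (1 / real (Suc n))) \<longlonglongrightarrow> r + (b - a) * 0"
      by (intro tendsto_intros LIMSEQ_Suc[OF lim_1_over_n])
    then have up: "(\<lambda>n. r + (b - a) / real (Suc n)) \<longlonglongrightarrow> r" by simp
    have "\<tau> \<longlonglongrightarrow> r"
    proof (rule real_tendsto_sandwich[OF _ _ tendsto_const up])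
      show "\<forall>\<^sub>F n in sequentially. r \<le> \<tau> n" using \<tau>(2) by (intro always_eventually allI less_imp_le)
      show "\<forall>\<^sub>F n in sequentially. \<tau> n \<le> r + (b - a) / real (Suc n)" using \<tau>(3) by (intro always_eventually allI)
    qed
    moreover have "\<forall>\<^sub>F n in sequentially. \<tau> n \<in> {r<..} \<and> \<tau> n \<noteq> r"
    proof (intro always_eventually allI)
      fix n show "\<tau> n \<in> {r<..} \<and> \<tau> n \<noteq> r" using \<tau>(2)[of n] by simp
    qed
    ultimately have \<tau>lim: "filterlim \<tau> (at_right r) sequentially" unfolding filterlim_at by blast
    have "(g \<longlongrightarrow> g r) (at_right r)" using rc True by blast
    from filterlim_compose[OF this \<tau>lim] have "(\<lambda>n. g (\<tau> n)) \<longlonglongrightarrow> g r" .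
    then show ?thesis using True by (simp only: \<tau>(1)) simp
  next
    case False
    then have "?g r = 0" by (auto simp: indicator_def)
    then show ?thesis by (simp only: riemann_step_outside[OF ab False]) simp
  qed
  have gm: "?g \<in> borel_measurable lborel"
    by (rule borel_measurable_LIMSEQ_metric[OF sm lim])
  have dom: "norm (?s n r) \<le> B * indicator {a..b} r" for n r
  proof (cases "a \<le> r \<and> r < b")
    case True
    then obtain \<tau> where "?s n r = g \<tau>" "r < \<tau>" "\<tau> \<le> b" using riemann_step_eq[OF ab] by blast
    then show ?thesis using B[of \<tau>] True by auto
  next
    case False
    have "B \<ge> 0" using B[of a] ab abs_ge_zero[of "g a"] by linarith
    then show ?thesis by (simp add: riemann_step_outside[OF ab False])
  qed
  have domi: "integrable lborel (\<lambda>r. B * indicator {a..b} r :: real)"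
    using emeasure_bounded_finite[of "{a..b}"] by (intro integrable_mult_right integrable_real_indicator) auto
  have gi: "integrable lborel ?g"
    by (rule integrable_dominated_convergence[OF gm sm domi AE_I2[OF lim] AE_I2[OF dom]])
  have conv: "(\<lambda>n. integral\<^sup>L lborel (?s n)) \<longlonglongrightarrow> integral\<^sup>L lborel ?g"
    by (rule integral_dominated_convergence[OF gm sm domi AE_I2[OF lim] AE_I2[OF dom]])
  have fm: "(\<lambda>r. indicator {a..b} r * g r) \<in> borel_measurable lborel"
  proof -
    have "(\<lambda>r. indicator {a..b} r * g r) = (\<lambda>r. ?g r + g b * indicator {b} r)"
      using ab by (auto simp: indicator_def fun_eq_iff)
    then show ?thesis using gm by simp
  qed
  have AE: "AE r in lborel. ?g r = indicator {a..b} r * g r"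
    using AE_lborel_singleton[of b] by eventually_elim (auto simp: indicator_def)
  show "set_integrable lborel {a..b} g"
    using integrable_cong_AE[OF gm fm AE] gi by (simp add: set_integrable_def)
  have eq: "integral\<^sup>L lborel ?g = (LBINT t:{a..b}. g t)"
    unfolding set_lebesgue_integral_def using integral_cong_AE[OF gm fm AE] by simp
  have "integral\<^sup>L lborel (?s n) = (\<Sum>i<Suc n. (b - a) / real (Suc n) * g (a + (real i + 1) * ((b - a) / real (Suc n))))" for n
  proof -
    define \<delta> where "\<delta> = (b - a) / real (Suc n)"
    have \<delta>: "\<delta> > 0" using ab by (simp add: \<delta>_def)
    let ?J = "\<lambda>i::nat. {a + real i * \<delta> ..< a + (real i + 1) * \<delta>}"
    have m: "measure lborel (?J i) = \<delta>" for i using \<delta> by (simp add: distrib_right)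
    have ii: "integrable lborel (indicator (?J i) :: real \<Rightarrow> real)" for i
      using emeasure_bounded_finite[of "?J i"] by (intro integrable_real_indicator) auto
    have "integral\<^sup>L lborel (?s n) = (\<Sum>i<Suc n. \<integral>r. g (a + (real i + 1) * \<delta>) * indicator (?J i) r \<partial>lborel)"
      unfolding riemann_step_def [abs_def] \<delta>_def[symmetric]
      by (intro Bochner_Integration.integral_sum integrable_mult_right ii)
    also have "\<dots> = (\<Sum>i<Suc n. \<delta> * g (a + (real i + 1) * \<delta>))"
      using m by (intro sum.cong refl) (simp add: mult.commute)
    finally show ?thesis unfolding \<delta>_def .
  qed
  then show "(\<lambda>n. \<Sum>i<Suc n. (b - a) / real (Suc n) * g (a + (real i + 1) * ((b - a) / real (Suc n)))) \<longlonglongrightarrow> (LBINT t:{a..b}. g t)"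
    using conv unfolding eq by simp
qed

text \<open>Nodes and weights of a linear functional that approximates the trapezoid error: the cell endpoints carry
  the negative Riemann sum, and the last two nodes \<open>a\<close> and \<open>b\<close> the trapezoidal rule.\<close>

definition quad_node :: "nat \<Rightarrow> real \<Rightarrow> real \<Rightarrow> nat \<Rightarrow> real" where
  "quad_node n a b i = (if i < Suc n then a + (real i + 1) * ((b - a) / real (Suc n)) else if i = Suc n then a else b)"

definition quad_weight :: "nat \<Rightarrow> real \<Rightarrow> real \<Rightarrow> nat \<Rightarrow> real" where
  "quad_weight n a b i = (if i < Suc n then - ((b - a) / real (Suc n)) else (b - a) / 2)"

lemma quad_node_mem: "a \<le> b \<Longrightarrow> quad_node n a b i \<in> {a..b}"
proof -
  assume ab: "a \<le> b"
  have "(real i + 1) * ((b - a) / real (Suc n)) \<le> real (Suc n) * ((b - a) / real (Suc n))" if "i < Suc n"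
    using that ab by (intro mult_right_mono) auto
  moreover have "0 \<le> (real i + 1) * ((b - a) / real (Suc n))" using ab by simp
  ultimately show ?thesis using ab by (auto simp: quad_node_def simp del: of_nat_Suc)
qed

lemma quad_weight_sum: "a \<le> b \<Longrightarrow> (\<Sum>i<n+3. \<bar>quad_weight n a b i\<bar>) = 2 * (b - a)"
proof -
  assume ab: "a \<le> b"
  have "(\<Sum>i<Suc n. \<bar>quad_weight n a b i\<bar>) = (\<Sum>i<Suc n. (b - a) / real (Suc n))"
    using ab by (intro sum.cong) (auto simp: quad_weight_def abs_div_pos)
  also have "\<dots> = b - a" by simp
  finally show ?thesis using ab by (simp add: numeral_3_eq_3 quad_weight_def del: sum.lessThan_Suc) (simp add: quad_weight_def)
qed

lemma quad_tendsto_trap_err: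
  fixes g :: "real \<Rightarrow> real"
  assumes ab: "a < b" and rc: "\<And>t. a \<le> t \<Longrightarrow> t < b \<Longrightarrow> (g \<longlongrightarrow> g t) (at_right t)"
    and B: "\<And>t. a \<le> t \<Longrightarrow> t \<le> b \<Longrightarrow> \<bar>g t\<bar> \<le> B"
  shows "(\<lambda>n. \<Sum>i<n+3. quad_weight n a b i * g (quad_node n a b i)) \<longlonglongrightarrow> trap_err a b g"
proof -
  have "(\<Sum>i<n+3. quad_weight n a b i * g (quad_node n a b i)) = (b - a) / 2 * (g a + g b)
      - (\<Sum>i<Suc n. (b - a) / real (Suc n) * g (a + (real i + 1) * ((b - a) / real (Suc n))))" for n
  proof -
    have "(\<Sum>i<Suc n. quad_weight n a b i * g (quad_node n a b i))
      = - (\<Sum>i<Suc n. (b - a) / real (Suc n) * g (a + (real i + 1) * ((b - a) / real (Suc n))))"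
      unfolding sum_negf[symmetric] by (intro sum.cong) (auto simp: quad_weight_def quad_node_def)
    moreover have "{..<n+3} = insert (Suc (Suc n)) (insert (Suc n) {..<Suc n})" by auto
    ultimately show ?thesis
      by (simp add: quad_weight_def quad_node_def distrib_left del: sum.lessThan_Suc)
  qed
  then show ?thesis
    unfolding trap_err_def using right_continuous_riemann(2)[OF ab rc B] by (auto intro!: tendsto_intros)
qed

text \<open>One-sided limits make the path bounded near each time; finitely many such neighbourhoods cover \<open>[0, T]\<close>.\<close>

lemma cadlag_bounded:
  fixes f :: "real \<Rightarrow> 'b::real_normed_vector"
  assumes "cadlag f"
  shows "\<exists>B. \<forall>t\<in>{0..T}. norm (f t) \<le> B"
proof -
  have loc: "\<exists>U B. open U \<and> t \<in> U \<and> (\<forall>s\<in>U. 0 \<le> s \<longrightarrow> norm (f s) \<le> B)" if t: "t \<in> {0..T}" for t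
  proof -
    have near: "norm y \<le> norm l + 1" if "dist y l < 1" for y l :: 'b
      using norm_triangle_sub[of y l] that by (simp add: dist_norm)
    have "(f \<longlongrightarrow> f t) (at_right t)" using assms t by (simp add: cadlag_def)
    then have "\<forall>\<^sub>F s in at_right t. dist (f s) (f t) < 1" by (rule tendstoD) simp
    then obtain r where r: "t < r" "\<And>s. t < s \<Longrightarrow> s < r \<Longrightarrow> norm (f s) \<le> norm (f t) + 1"
      unfolding eventually_at_right_field using near by blast
    have "\<exists>l B. l < t \<and> (\<forall>s. l < s \<and> s < t \<and> 0 \<le> s \<longrightarrow> norm (f s) \<le> B)"
    proof (cases "t = 0")
      case True
      then show ?thesis by (intro exI[of _ "-1"] exI[of _ 0]) auto
    next
      case False
      then have "t > 0" using t by auto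
      then obtain y where "(f \<longlongrightarrow> y) (at_left t)" using assms unfolding cadlag_def by blast
      then have "\<forall>\<^sub>F s in at_left t. dist (f s) y < 1" by (rule tendstoD) simp
      then obtain l where "l < t" "\<And>s. l < s \<Longrightarrow> s < t \<Longrightarrow> norm (f s) \<le> norm y + 1"
        unfolding eventually_at_left_field using near by blast
      then show ?thesis by blast
    qed
    then obtain l B where l: "l < t" "\<And>s. l < s \<Longrightarrow> s < t \<Longrightarrow> 0 \<le> s \<Longrightarrow> norm (f s) \<le> B" by blast
    have "norm (f s) \<le> max B (norm (f t) + 1)" if "s \<in> {l<..<r}" "0 \<le> s" for s
      using l(2)[of s] r(2)[of s] that by (cases s t rule: linorder_cases) auto
    then show ?thesis using l r by (intro exI[of _ "{l<..<r}"] exI[of _ "max B (norm (f t) + 1)"]) auto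
  qed
  then have "\<forall>t. \<exists>U. t \<in> {0..T} \<longrightarrow> open U \<and> t \<in> U \<and> (\<exists>B. \<forall>s\<in>U. 0 \<le> s \<longrightarrow> norm (f s) \<le> B)" by blast
  from choice[OF this] obtain U
    where U: "\<forall>t. t \<in> {0..T} \<longrightarrow> open (U t) \<and> t \<in> U t \<and> (\<exists>B. \<forall>s\<in>U t. 0 \<le> s \<longrightarrow> norm (f s) \<le> B)" ..
  then have "\<forall>t. \<exists>B. t \<in> {0..T} \<longrightarrow> (\<forall>s\<in>U t. 0 \<le> s \<longrightarrow> norm (f s) \<le> B)" by blast
  from choice[OF this] obtain B where B: "\<forall>t. t \<in> {0..T} \<longrightarrow> (\<forall>s\<in>U t. 0 \<le> s \<longrightarrow> norm (f s) \<le> B t)" ..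
  obtain D where D: "D \<subseteq> {0..T}" "finite D" "{0..T} \<subseteq> (\<Union>t\<in>D. U t)"
    by (rule compactE_image[OF compact_Icc[of 0 T], of "{0..T}" U]) (use U in auto)
  have "norm (f s) \<le> (\<Sum>t\<in>D. \<bar>B t\<bar>)" if s: "s \<in> {0..T}" for s
  proof -
    obtain t where t: "t \<in> D" "s \<in> U t" using D(3) s by blast
    then have "norm (f s) \<le> B t" using B D s by auto
    also have "\<dots> \<le> \<bar>B t\<bar>" by simp
    also have "\<dots> \<le> (\<Sum>t\<in>D. \<bar>B t\<bar>)" using t D by (intro member_le_sum) auto
    finally show ?thesis .
  qed
  then show ?thesis by blast
qed

text \<open>Needed because path integrals are meaningful only on the event, of full measure, that the path is cadlag.\<close>

lemma (in complete_measure) borel_measurable_AE_limit: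
  fixes f :: "nat \<Rightarrow> 'a \<Rightarrow> 'b::{banach, second_countable_topology}"
  assumes f: "\<And>n. f n \<in> borel_measurable M" and lim: "AE x in M. (\<lambda>n. f n x) \<longlonglongrightarrow> g x"
  shows "g \<in> borel_measurable M"
proof (rule measurableI)
  let ?h = "\<lambda>x. lim (\<lambda>n. f n x)"
  have h: "?h \<in> borel_measurable M" using f by measurable
  fix B :: "'b set" assume B: "B \<in> sets borel"
  have "AE x in M. x \<in> ?h -` B \<inter> space M \<longleftrightarrow> x \<in> g -` B \<inter> space M"
    using lim by eventually_elim (auto dest: limI)
  then show "g -` B \<inter> space M \<in> sets M"
    by (rule in_sets_AE[OF _ measurable_sets[OF h B]]) auto
qed simp

text \<open>The Cauchy-Schwarz inequality for the measure with weights \<open>\<bar>q i\<bar>\<close>.\<close>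

lemma weighted_sum_square:
  fixes q y :: "'i \<Rightarrow> real"
  shows "(\<Sum>i\<in>I. q i * y i)\<^sup>2 \<le> (\<Sum>i\<in>I. \<bar>q i\<bar>) * (\<Sum>i\<in>I. \<bar>q i\<bar> * (y i)\<^sup>2)"
proof -
  have "(\<Sum>i\<in>I. q i * y i) = (\<Sum>i\<in>I. sqrt \<bar>q i\<bar> * (sgn (q i) * sqrt \<bar>q i\<bar> * y i))"
  proof (rule sum.cong)
    fix i
    have "sqrt \<bar>q i\<bar> * sqrt \<bar>q i\<bar> * sgn (q i) = q i" by (auto simp: sgn_if)
    then show "q i * y i = sqrt \<bar>q i\<bar> * (sgn (q i) * sqrt \<bar>q i\<bar> * y i)" by (metis mult.assoc mult.commute)
  qed simp
  also have "\<dots>\<^sup>2 \<le> (\<Sum>i\<in>I. (sqrt \<bar>q i\<bar>)\<^sup>2) * (\<Sum>i\<in>I. (sgn (q i) * sqrt \<bar>q i\<bar> * y i)\<^sup>2)"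
    by (rule Cauchy_Schwarz_ineq_sum)
  also have "(\<Sum>i\<in>I. (sgn (q i) * sqrt \<bar>q i\<bar> * y i)\<^sup>2) = (\<Sum>i\<in>I. \<bar>q i\<bar> * (y i)\<^sup>2)"
    by (intro sum.cong) (auto simp: power_mult_distrib sgn_if)
  finally show ?thesis by simp
qed

section \<open>Trapezoid errors on one grid interval\<close>

text \<open>Captures what is used of the real and imaginary parts of \<open>exp (- \<i> w t)\<close>, with \<open>W = \<bar>w\<bar>\<close>.\<close>

definition modulation :: "real \<Rightarrow> (real \<Rightarrow> real) \<Rightarrow> bool" where
  "modulation W \<phi> \<longleftrightarrow> (\<exists>\<phi>' \<phi>''. (\<forall>t. (\<phi> has_real_derivative \<phi>' t) (at t)) \<and> (\<forall>t. (\<phi>' has_real_derivative \<phi>'' t) (at t)) \<and>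
     (\<forall>t. \<bar>\<phi> t\<bar> \<le> 1 \<and> \<bar>\<phi>' t\<bar> \<le> W \<and> \<bar>\<phi>'' t\<bar> \<le> W\<^sup>2))"

lemma modulation_le_1: "modulation W \<phi> \<Longrightarrow> \<bar>\<phi> t\<bar> \<le> 1"
  by (auto simp: modulation_def)

lemma modulation_continuous: "modulation W \<phi> \<Longrightarrow> continuous_on UNIV \<phi>"
  by (auto simp: modulation_def intro: DERIV_continuous_on DERIV_subset)

text \<open>The second derivative of \<open>\<beta> \<bullet> mexp ((t - a) A) \<xi> * \<phi> t\<close> is bounded by a multiple of \<open>norm \<xi>\<close>, uniformly in \<open>t \<ge> a\<close>;
  so one constant serves all intervals.\<close>

lemma drift_trapezoid_error:
  fixes A :: "real ^ 'n ^ 'n" and \<beta> :: "real ^ 'n"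
  assumes bounded: "\<And>t v. t \<ge> 0 \<Longrightarrow> norm (mexp (t *\<^sub>R A) *v v) \<le> C * norm v" and W: "W \<ge> 0"
  shows "\<exists>K\<ge>0. \<forall>\<phi> a b \<xi>. modulation W \<phi> \<longrightarrow> a < b \<longrightarrow>
       \<bar>trap_err a b (\<lambda>t. (\<beta> \<bullet> (mexp ((t - a) *\<^sub>R A) *v \<xi>)) * \<phi> t)\<bar> \<le> K * norm \<xi> * (b - a) ^ 3"
proof -
  obtain \<kappa> where \<kappa>: "\<kappa> > 0" "\<And>v. norm (A *v v) \<le> norm v * \<kappa>"
    using bounded_linear.pos_bounded[OF matrix_vector_mul_bounded_linear[of A]] by blast
  have "norm (mexp (0 *\<^sub>R A) *v (axis undefined 1 :: real ^ 'n)) \<le> C * norm (axis undefined 1 :: real ^ 'n)"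
    by (rule bounded) simp
  then have C: "C \<ge> 0" by simp
  define K where "K = norm \<beta> * C * (\<kappa> * \<kappa> + 2 * \<kappa> * W + W\<^sup>2)"
  have K0: "K \<ge> 0" using \<kappa> C W by (simp add: K_def)
  have main: "\<bar>trap_err a b (\<lambda>t. (\<beta> \<bullet> (mexp ((t - a) *\<^sub>R A) *v \<xi>)) * \<phi> t)\<bar> \<le> K * norm \<xi> * (b - a) ^ 3"
    if mod: "modulation W \<phi>" and ab: "a < b" for \<phi> a b \<xi>
  proof -
    obtain \<phi>' \<phi>'' where \<phi>: "\<And>t. (\<phi> has_real_derivative \<phi>' t) (at t)" "\<And>t. (\<phi>' has_real_derivative \<phi>'' t) (at t)"
      and b: "\<And>t. \<bar>\<phi> t\<bar> \<le> 1" "\<And>t. \<bar>\<phi>' t\<bar> \<le> W" "\<And>t. \<bar>\<phi>'' t\<bar> \<le> W\<^sup>2"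
      using mod unfolding modulation_def by blast
    define m where "m v t = \<beta> \<bullet> (mexp ((t - a) *\<^sub>R A) *v v)" for v t
    have m': "(m v has_real_derivative m (A *v v) t) (at t)" for v t
    proof -
      have "((\<lambda>t. \<beta> \<bullet> (mexp ((t - a) *\<^sub>R A) *v v)) has_real_derivative
          \<beta> \<bullet> (mexp ((t - a) *\<^sub>R A) *v (A *v v)) * 1) (at t)"
        by (rule DERIV_chain2[OF mexp_inner_deriv]) (auto intro!: derivative_eq_intros)
      then show ?thesis by (simp add: m_def [abs_def])
    qed
    have mb: "\<bar>m v t\<bar> \<le> norm \<beta> * C * norm v" if "t \<ge> a" for v t
    proof -
      have "\<bar>m v t\<bar> \<le> norm \<beta> * norm (mexp ((t - a) *\<^sub>R A) *v v)" unfolding m_def by (rule Cauchy_Schwarz_ineq2)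
      also have "\<dots> \<le> norm \<beta> * (C * norm v)" using that by (intro mult_left_mono bounded) auto
      finally show ?thesis by simp
    qed
    have "\<bar>trap_err a b (\<lambda>t. m \<xi> t * \<phi> t)\<bar> \<le> (K * norm \<xi>) * (b - a) ^ 3"
    proof (rule trapezoid_error[OF ab])
      show "((\<lambda>t. m \<xi> t * \<phi> t) has_real_derivative m (A *v \<xi>) t * \<phi> t + m \<xi> t * \<phi>' t) (at t)" for t
        by (auto intro!: derivative_eq_intros m' \<phi>)
      show "((\<lambda>t. m (A *v \<xi>) t * \<phi> t + m \<xi> t * \<phi>' t) has_real_derivative
          m (A *v (A *v \<xi>)) t * \<phi> t + 2 * (m (A *v \<xi>) t * \<phi>' t) + m \<xi> t * \<phi>'' t) (at t)" for t
        by (auto intro!: derivative_eq_intros m' \<phi>)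
      fix t assume t: "a \<le> t" "t \<le> b"
      have n1: "norm (A *v \<xi>) \<le> \<kappa> * norm \<xi>" using \<kappa>(2)[of \<xi>] by (simp add: mult.commute)
      have "norm (A *v (A *v \<xi>)) \<le> \<kappa> * norm (A *v \<xi>)" using \<kappa>(2)[of "A *v \<xi>"] by (simp add: mult.commute)
      also have "\<dots> \<le> \<kappa> * (\<kappa> * norm \<xi>)" using n1 \<kappa> by (intro mult_left_mono) auto
      finally have n2: "norm (A *v (A *v \<xi>)) \<le> \<kappa> * \<kappa> * norm \<xi>" by simp
      have "\<bar>m (A *v (A *v \<xi>)) t\<bar> * \<bar>\<phi> t\<bar> \<le> (norm \<beta> * C * (\<kappa> * \<kappa> * norm \<xi>)) * 1"
        by (rule mult_mono[OF order.trans[OF mb[OF t(1)] mult_left_mono[OF n2]] b(1)]) (use C \<kappa> in auto)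
      moreover have "\<bar>m (A *v \<xi>) t\<bar> * \<bar>\<phi>' t\<bar> \<le> (norm \<beta> * C * (\<kappa> * norm \<xi>)) * W"
        by (rule mult_mono[OF order.trans[OF mb[OF t(1)] mult_left_mono[OF n1]] b(2)]) (use C \<kappa> in auto)
      moreover have "\<bar>m \<xi> t\<bar> * \<bar>\<phi>'' t\<bar> \<le> (norm \<beta> * C * norm \<xi>) * W\<^sup>2"
        by (rule mult_mono[OF mb[OF t(1)] b(3)]) (use C in auto)
      moreover have "\<bar>m (A *v (A *v \<xi>)) t * \<phi> t + 2 * (m (A *v \<xi>) t * \<phi>' t) + m \<xi> t * \<phi>'' t\<bar>
         \<le> \<bar>m (A *v (A *v \<xi>)) t\<bar> * \<bar>\<phi> t\<bar> + 2 * (\<bar>m (A *v \<xi>) t\<bar> * \<bar>\<phi>' t\<bar>) + \<bar>m \<xi> t\<bar> * \<bar>\<phi>'' t\<bar>"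
        unfolding abs_mult[symmetric] by linarith
      ultimately have "\<bar>m (A *v (A *v \<xi>)) t * \<phi> t + 2 * (m (A *v \<xi>) t * \<phi>' t) + m \<xi> t * \<phi>'' t\<bar>
         \<le> (norm \<beta> * C * (\<kappa> * \<kappa> * norm \<xi>)) * 1 + 2 * ((norm \<beta> * C * (\<kappa> * norm \<xi>)) * W) + (norm \<beta> * C * norm \<xi>) * W\<^sup>2"
        by linarith
      also have "\<dots> = K * norm \<xi>" by (simp add: K_def algebra_simps)
      finally show "\<bar>m (A *v (A *v \<xi>)) t * \<phi> t + 2 * (m (A *v \<xi>) t * \<phi>' t) + m \<xi> t * \<phi>'' t\<bar> \<le> K * norm \<xi>" .
    qed
    then show ?thesis by (simp add: m_def [abs_def])
  qed
  show ?thesis using K0 main by blast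
qed

lemma integral_sum_mult_sum:
  fixes f :: "'i \<Rightarrow> 'a \<Rightarrow> real" and g :: "'j \<Rightarrow> 'a \<Rightarrow> real"
  assumes "\<And>i. i \<in> I \<Longrightarrow> square_integrable M (f i)" "\<And>j. j \<in> J \<Longrightarrow> square_integrable M (g j)"
  shows "(\<integral>x. (\<Sum>i\<in>I. f i x) * (\<Sum>j\<in>J. g j x) \<partial>M) = (\<Sum>i\<in>I. \<Sum>j\<in>J. \<integral>x. f i x * g j x \<partial>M)"
proof -
  have i: "integrable M (\<lambda>x. f i x * g j x)" if "i \<in> I" "j \<in> J" for i j
    using square_integrable_mult assms that by blast
  have "(\<integral>x. (\<Sum>i\<in>I. f i x) * (\<Sum>j\<in>J. g j x) \<partial>M) = (\<integral>x. (\<Sum>i\<in>I. \<Sum>j\<in>J. f i x * g j x) \<partial>M)"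
    by (simp only: sum_product)
  also have "\<dots> = (\<Sum>i\<in>I. \<integral>x. (\<Sum>j\<in>J. f i x * g j x) \<partial>M)"
    by (intro Bochner_Integration.integral_sum Bochner_Integration.integrable_sum i)
  also have "\<dots> = (\<Sum>i\<in>I. \<Sum>j\<in>J. \<integral>x. f i x * g j x \<partial>M)"
    by (intro sum.cong refl Bochner_Integration.integral_sum i)
  finally show ?thesis .
qed

lemma integral_orthogonal_sum_square:
  fixes f :: "'i \<Rightarrow> 'a \<Rightarrow> real"
  assumes "finite I" and sq: "\<And>i. i \<in> I \<Longrightarrow> square_integrable M (f i)"
    and orth: "\<And>i j. i \<in> I \<Longrightarrow> j \<in> I \<Longrightarrow> i \<noteq> j \<Longrightarrow> (\<integral>x. f i x * f j x \<partial>M) = 0"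
  shows "(\<integral>x. (\<Sum>i\<in>I. f i x)\<^sup>2 \<partial>M) = (\<Sum>i\<in>I. \<integral>x. (f i x)\<^sup>2 \<partial>M)"
proof -
  have "(\<integral>x. (\<Sum>i\<in>I. f i x)\<^sup>2 \<partial>M) = (\<Sum>i\<in>I. \<Sum>j\<in>I. \<integral>x. f i x * f j x \<partial>M)"
    unfolding power2_eq_square by (rule integral_sum_mult_sum[OF sq sq])
  also have "\<dots> = (\<Sum>i\<in>I. \<Sum>j\<in>I. if i = j then \<integral>x. f i x * f i x \<partial>M else 0)"
    using orth by (intro sum.cong) auto
  also have "\<dots> = (\<Sum>i\<in>I. \<integral>x. (f i x)\<^sup>2 \<partial>M)"
    using \<open>finite I\<close> by (simp add: power2_eq_square)
  finally show ?thesis .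
qed

text \<open>The quadrature functional applied to the modulated innovation after time \<open>a\<close>; a finite linear combination of
  square-integrable variables.\<close>

definition quad_innovation ::
    "real ^ 'n ^ 'n \<Rightarrow> (real \<Rightarrow> 'w \<Rightarrow> real ^ 'n) \<Rightarrow> real ^ 'n \<Rightarrow> (real \<Rightarrow> real) \<Rightarrow> nat \<Rightarrow> real \<Rightarrow> real \<Rightarrow> 'w \<Rightarrow> real" where
  "quad_innovation A X \<beta> \<phi> n a b \<omega> = (\<Sum>i<n+3. quad_weight n a b i *
     ((\<beta> \<bullet> innovation A X a (quad_node n a b i) \<omega>) * \<phi> (quad_node n a b i)))"

text \<open>The weights have total mass \<open>2 (b - a)\<close> and each value of the innovation has variance at most
  \<open>K * (norm \<beta>)\<^sup>2 * (b - a)\<close>.\<close>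

lemma quad_innovation_square:
  fixes A :: "real ^ 'n::{finite,linorder} ^ 'n::{finite,linorder}"
  assumes L: "orthogonal_driver M L \<sigma>" and X: "carma_state M L A X"
    and K0: "K \<ge> 0" and K: "\<And>u v c. 0 \<le> u \<Longrightarrow> u \<le> v \<Longrightarrow> (\<integral>\<omega>. (c \<bullet> innovation A X u v \<omega>)\<^sup>2 \<partial>M) \<le> K * (norm c)\<^sup>2 * (v - u)"
    and \<phi>: "\<And>t. \<bar>\<phi> t\<bar> \<le> 1" and ab: "0 \<le> a" "a \<le> b"
  shows "square_integrable M (quad_innovation A X \<beta> \<phi> n a b)"
    "(\<integral>\<omega>. (quad_innovation A X \<beta> \<phi> n a b \<omega>)\<^sup>2 \<partial>M) \<le> 4 * K * (norm \<beta>)\<^sup>2 * (b - a) ^ 3"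
proof -
  let ?p = "quad_node n a b" and ?q = "quad_weight n a b"
  let ?V = "\<lambda>i \<omega>. (\<beta> \<bullet> innovation A X a (?p i) \<omega>) * \<phi> (?p i)"
  have p: "a \<le> ?p i" "?p i \<le> b" for i using quad_node_mem[OF ab(2), of n i] by auto
  have sqW: "square_integrable M (\<lambda>\<omega>. \<beta> \<bullet> innovation A X a (?p i) \<omega>)" for i
    using innovation_covariance(1)[OF L X ab(1) p(1) ab(1) p(1)] .
  have sqV: "square_integrable M (?V i)" for i
    using square_integrable_cmult[OF sqW[of i], of "\<phi> (?p i)"] by (simp add: mult.commute)
  show sq: "square_integrable M (quad_innovation A X \<beta> \<phi> n a b)"
    unfolding quad_innovation_def [abs_def] by (intro square_integrable_sum square_integrable_cmult sqV)
  have V2: "(\<integral>\<omega>. (?V i \<omega>)\<^sup>2 \<partial>M) \<le> K * (norm \<beta>)\<^sup>2 * (b - a)" for i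
  proof -
    have "(\<integral>\<omega>. (?V i \<omega>)\<^sup>2 \<partial>M) = (\<phi> (?p i))\<^sup>2 * (\<integral>\<omega>. (\<beta> \<bullet> innovation A X a (?p i) \<omega>)\<^sup>2 \<partial>M)"
      by (simp add: power_mult_distrib mult.commute)
    also have "\<dots> \<le> 1 * (K * (norm \<beta>)\<^sup>2 * (?p i - a))"
      using \<phi> p ab by (intro mult_mono K) (auto simp: abs_square_le_1)
    also have "\<dots> \<le> K * (norm \<beta>)\<^sup>2 * (b - a)" using p[of i] K0 by (auto intro!: mult_left_mono)
    finally show ?thesis .
  qed
  have "(\<integral>\<omega>. (quad_innovation A X \<beta> \<phi> n a b \<omega>)\<^sup>2 \<partial>M)
      \<le> (\<integral>\<omega>. 2 * (b - a) * (\<Sum>i<n+3. \<bar>?q i\<bar> * (?V i \<omega>)\<^sup>2) \<partial>M)"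
  proof (rule integral_mono)
    show "integrable M (\<lambda>\<omega>. (quad_innovation A X \<beta> \<phi> n a b \<omega>)\<^sup>2)" using sq by (simp add: square_integrable_def)
    show "integrable M (\<lambda>\<omega>. 2 * (b - a) * (\<Sum>i<n+3. \<bar>?q i\<bar> * (?V i \<omega>)\<^sup>2))"
      using sqV by (intro integrable_mult_right Bochner_Integration.integrable_sum) (auto simp: square_integrable_def)
    show "(quad_innovation A X \<beta> \<phi> n a b \<omega>)\<^sup>2 \<le> 2 * (b - a) * (\<Sum>i<n+3. \<bar>?q i\<bar> * (?V i \<omega>)\<^sup>2)" for \<omega>
      unfolding quad_innovation_def quad_weight_sum[OF ab(2), of n, symmetric] by (rule weighted_sum_square)
  qed
  also have "\<dots> = 2 * (b - a) * (\<Sum>i<n+3. \<bar>?q i\<bar> * (\<integral>\<omega>. (?V i \<omega>)\<^sup>2 \<partial>M))"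
  proof -
    have "(\<integral>\<omega>. (\<Sum>i<n+3. \<bar>?q i\<bar> * (?V i \<omega>)\<^sup>2) \<partial>M) = (\<Sum>i<n+3. \<integral>\<omega>. \<bar>?q i\<bar> * (?V i \<omega>)\<^sup>2 \<partial>M)"
      using sqV by (intro Bochner_Integration.integral_sum integrable_mult_right) (auto simp: square_integrable_def)
    then show ?thesis by (simp only: integral_mult_right_zero)
  qed
  also have "\<dots> \<le> 2 * (b - a) * (\<Sum>i<n+3. \<bar>?q i\<bar> * (K * (norm \<beta>)\<^sup>2 * (b - a)))"
    using ab V2 by (intro mult_left_mono sum_mono) auto
  also have "\<dots> = 4 * K * (norm \<beta>)\<^sup>2 * (b - a) ^ 3"
    unfolding sum_distrib_right[symmetric] quad_weight_sum[OF ab(2)] by (simp add: power3_eq_cube algebra_simps)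
  finally show "(\<integral>\<omega>. (quad_innovation A X \<beta> \<phi> n a b \<omega>)\<^sup>2 \<partial>M) \<le> 4 * K * (norm \<beta>)\<^sup>2 * (b - a) ^ 3" .
qed

lemma quad_innovation_orthogonal:
  fixes A :: "real ^ 'n::{finite,linorder} ^ 'n::{finite,linorder}"
  assumes L: "orthogonal_driver M L \<sigma>" and X: "carma_state M L A X"
    and "0 \<le> a" "a \<le> b" "b \<le> c" "c \<le> d"
  shows "(\<integral>\<omega>. quad_innovation A X \<beta> \<phi> n a b \<omega> * quad_innovation A X \<beta> \<phi> n c d \<omega> \<partial>M) = 0"
proof -
  let ?V = "\<lambda>a b i \<omega>. quad_weight n a b i * ((\<beta> \<bullet> innovation A X a (quad_node n a b i) \<omega>) * \<phi> (quad_node n a b i))"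
  have p: "a \<le> quad_node n a b i" "quad_node n a b i \<le> b" if "a \<le> b" for a b i
    using quad_node_mem[OF that, of n i] by auto
  have sq: "square_integrable M (?V a b i)" if "0 \<le> a" "a \<le> b" for a b i
  proof -
    have "square_integrable M (\<lambda>\<omega>. \<beta> \<bullet> innovation A X a (quad_node n a b i) \<omega>)"
      by (rule innovation_covariance(1)[OF L X that(1) p(1)[OF that(2)] that(1) p(1)[OF that(2)]])
    from square_integrable_cmult[OF this, of "quad_weight n a b i * \<phi> (quad_node n a b i)"]
    show ?thesis by (simp add: mult_ac)
  qed
  have "c \<ge> 0" using assms by simp
  have "(\<integral>\<omega>. ?V a b i \<omega> * ?V c d j \<omega> \<partial>M) = 0" for i j
  proof -
    have "(\<integral>\<omega>. ?V a b i \<omega> * ?V c d j \<omega> \<partial>M)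
      = (\<integral>\<omega>. (quad_weight n a b i * \<phi> (quad_node n a b i) * (quad_weight n c d j * \<phi> (quad_node n c d j))) *
          ((\<beta> \<bullet> innovation A X a (quad_node n a b i) \<omega>) * (\<beta> \<bullet> innovation A X c (quad_node n c d j) \<omega>)) \<partial>M)"
      by (simp add: mult_ac)
    also have "\<dots> = 0"
      unfolding integral_mult_right_zero
      using p[of a b i] p[of c d j] assms by (subst innovation_orthogonal[OF L X]) auto
    finally show ?thesis .
  qed
  then show ?thesis
    unfolding quad_innovation_def
    by (subst integral_sum_mult_sum) (use assms \<open>c \<ge> 0\<close> sq in auto)
qed

lemma continuous_right_limit:
  "continuous_on UNIV f \<Longrightarrow> (f \<longlongrightarrow> f t) (at_right t)" for f :: "real \<Rightarrow> 'b::topological_space"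
  unfolding continuous_on_def using tendsto_within_subset by blast

lemma cadlag_inner_right_continuous:
  fixes f :: "real \<Rightarrow> 'b::euclidean_space"
  assumes "cadlag f" "t \<ge> 0"
  shows "((\<lambda>t. c \<bullet> f t) \<longlongrightarrow> c \<bullet> f t) (at_right t)"
  using assms by (auto simp: cadlag_def intro!: tendsto_intros)

lemma modulated_path_regular:
  fixes f :: "real \<Rightarrow> 'b::euclidean_space"
  assumes f: "cadlag f" and \<phi>: "continuous_on UNIV \<phi>" "\<And>t. \<bar>\<phi> t\<bar> \<le> 1" and ab: "0 \<le> a"
  shows "\<And>t. a \<le> t \<Longrightarrow> t < b \<Longrightarrow> ((\<lambda>t. (c \<bullet> f t) * \<phi> t) \<longlongrightarrow> (c \<bullet> f t) * \<phi> t) (at_right t)"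
    "\<exists>B. \<forall>t. a \<le> t \<longrightarrow> t \<le> b \<longrightarrow> \<bar>(c \<bullet> f t) * \<phi> t\<bar> \<le> B"
proof -
  have "(\<phi> \<longlongrightarrow> \<phi> t) (at_right t)" for t
    by (rule continuous_right_limit[OF \<phi>(1)])
  then show "((\<lambda>t. (c \<bullet> f t) * \<phi> t) \<longlongrightarrow> (c \<bullet> f t) * \<phi> t) (at_right t)" if "a \<le> t" "t < b" for t
    using that ab by (intro tendsto_mult cadlag_inner_right_continuous f) auto
  obtain B where B: "\<forall>t\<in>{0..b}. norm (f t) \<le> B" using cadlag_bounded[OF f] by blast
  have "\<bar>(c \<bullet> f t) * \<phi> t\<bar> \<le> norm c * B" if "a \<le> t" "t \<le> b" for t
  proof -
    have "\<bar>c \<bullet> f t\<bar> \<le> norm c * norm (f t)" by (rule Cauchy_Schwarz_ineq2)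
    also have "\<dots> \<le> norm c * B" using B that ab by (intro mult_left_mono) auto
    finally have "\<bar>c \<bullet> f t\<bar> * \<bar>\<phi> t\<bar> \<le> (norm c * B) * 1" using \<phi>(2)[of t] by (intro mult_mono) auto
    then show ?thesis by (simp add: abs_mult)
  qed
  then show "\<exists>B. \<forall>t. a \<le> t \<longrightarrow> t \<le> b \<longrightarrow> \<bar>(c \<bullet> f t) * \<phi> t\<bar> \<le> B" by blast
qed

text \<open>The limit is expressed through the trapezoid errors of the path and of its predicted part, both of which are
  limits of the quadrature functional.\<close>

lemma quad_innovation_tendsto:
  fixes A :: "real ^ 'n ^ 'n"
  assumes path: "cadlag (\<lambda>t. X t \<omega>)" and \<phi>: "continuous_on UNIV \<phi>" "\<And>t. \<bar>\<phi> t\<bar> \<le> 1"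
    and ab: "0 \<le> a" "a < b"
  shows "(\<lambda>n. quad_innovation A X \<beta> \<phi> n a b \<omega>) \<longlonglongrightarrow>
    trap_err a b (\<lambda>t. (\<beta> \<bullet> X t \<omega>) * \<phi> t) - trap_err a b (\<lambda>t. (\<beta> \<bullet> (mexp ((t - a) *\<^sub>R A) *v X a \<omega>)) * \<phi> t)"
proof -
  let ?y = "\<lambda>t. (\<beta> \<bullet> X t \<omega>) * \<phi> t" and ?d = "\<lambda>t. (\<beta> \<bullet> (mexp ((t - a) *\<^sub>R A) *v X a \<omega>)) * \<phi> t"
  note reg = modulated_path_regular[OF path \<phi> ab(1)]
  obtain B where B: "\<And>t. a \<le> t \<Longrightarrow> t \<le> b \<Longrightarrow> \<bar>?y t\<bar> \<le> B" using reg(2) by blast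
  have y: "(\<lambda>n. \<Sum>i<n+3. quad_weight n a b i * ?y (quad_node n a b i)) \<longlonglongrightarrow> trap_err a b ?y"
    by (rule quad_tendsto_trap_err[OF ab(2) reg(1) B])
  have dc: "continuous_on UNIV ?d"
    by (intro continuous_intros continuous_on_mexp_vec \<phi>)
  have "bounded (?d ` {a..b})"
    by (intro compact_imp_bounded compact_continuous_image continuous_on_subset[OF dc]) auto
  then obtain B' where B': "\<forall>t\<in>{a..b}. \<bar>?d t\<bar> \<le> B'" unfolding bounded_iff by auto
  have "(?d \<longlongrightarrow> ?d t) (at_right t)" for t
    by (rule continuous_right_limit[OF dc])
  then have d: "(\<lambda>n. \<Sum>i<n+3. quad_weight n a b i * ?d (quad_node n a b i)) \<longlonglongrightarrow> trap_err a b ?d"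
    using B' by (intro quad_tendsto_trap_err[OF ab(2)]) auto
  have "quad_innovation A X \<beta> \<phi> n a b \<omega> = (\<Sum>i<n+3. quad_weight n a b i * ?y (quad_node n a b i))
      - (\<Sum>i<n+3. quad_weight n a b i * ?d (quad_node n a b i))" for n
    unfolding quad_innovation_def innovation_def sum_subtractf[symmetric]
    by (intro sum.cong refl) (simp add: inner_diff_right algebra_simps)
  then show ?thesis using tendsto_diff[OF y d] by simp
qed

section \<open>The sum of the trapezoid errors\<close>

text \<open>The sum \<open>S\<close> of the trapezoid errors is \<open>Dr + N\<close>.  The predictable part \<open>Dr\<close> is dominated by
  \<open>Kd * R\<close>, where \<open>R\<close> is the sum of the \<open>h\<^sub>j\<^sup>3 * norm (X(x\<^sub>j))\<close>, so its second moment is of order \<open>H\<^sup>2\<close> by the weighted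
  Cauchy-Schwarz inequality.  The part \<open>N\<close> is almost surely the limit of sums of orthogonal
  variables \<open>quad_innovation\<close>, so its second moment is of order \<open>H\<close> by Fatou's lemma.\<close>

lemma trapezoid_error_second_moment:
  fixes A :: "real ^ 'n::{finite,linorder} ^ 'n::{finite,linorder}" and \<beta> :: "real ^ 'n::{finite,linorder}"
  assumes complete: "complete_measure M"
    and L: "orthogonal_driver M L \<sigma>" and X: "carma_state M L A X"
    and stable: "\<And>z. is_eigenvalue (map_matrix complex_of_real A) z \<Longrightarrow> Re z < 0"
    and X0: "integrable M (\<lambda>\<omega>. (norm (X 0 \<omega>))\<^sup>2)" and W: "W \<ge> 0"
  shows "\<exists>C\<ge>0. \<forall>\<phi> n x. modulation W \<phi> \<longrightarrow> 0 \<le> x 0 \<longrightarrow> (\<forall>i j. i < j \<longrightarrow> j \<le> n \<longrightarrow> x i < x j) \<longrightarrow>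
       (\<lambda>\<omega>. \<Sum>j<n. trap_err (x j) (x (Suc j)) (\<lambda>t. (\<beta> \<bullet> X t \<omega>) * \<phi> t)) \<in> borel_measurable M \<and>
       (\<integral>\<^sup>+\<omega>. ennreal ((\<Sum>j<n. trap_err (x j) (x (Suc j)) (\<lambda>t. (\<beta> \<bullet> X t \<omega>) * \<phi> t))\<^sup>2) \<partial>M)
         \<le> ennreal (C * ((\<Sum>j<n. (x (Suc j) - x j) ^ 3)\<^sup>2 + (\<Sum>j<n. (x (Suc j) - x j) ^ 3)))"
proof -
  interpret complete_measure M by (rule complete)
  obtain K where K0: "K \<ge> 0"
    and Xi: "\<And>t. t \<ge> 0 \<Longrightarrow> integrable M (\<lambda>\<omega>. (norm (X t \<omega>))\<^sup>2)"
    and XK: "\<And>t. t \<ge> 0 \<Longrightarrow> (\<integral>\<omega>. (norm (X t \<omega>))\<^sup>2 \<partial>M) \<le> K"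
    and WK: "\<And>u v c. 0 \<le> u \<Longrightarrow> u \<le> v \<Longrightarrow> (\<integral>\<omega>. (c \<bullet> innovation A X u v \<omega>)\<^sup>2 \<partial>M) \<le> K * (norm c)\<^sup>2 * (v - u)"
    by (rule carma_second_moment_bounds[OF L X stable X0]) (assumption | rule that)+
  obtain C0 \<delta> where \<delta>: "\<delta> > 0" and C0: "C0 \<ge> 0"
    and decay: "\<And>t v. t \<ge> 0 \<Longrightarrow> norm (mexp (t *\<^sub>R A) *v v) \<le> C0 * exp (- \<delta> * t) * norm v"
    by (rule mexp_decay[OF stable]) (assumption | rule that)+
  have bounded: "norm (mexp (t *\<^sub>R A) *v v) \<le> C0 * norm v" if "t \<ge> 0" for t and v :: "real ^ 'n::{finite,linorder}"
  proof -
    have "norm (mexp (t *\<^sub>R A) *v v) \<le> C0 * exp (- \<delta> * t) * norm v" by (rule decay[OF that])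
    also have "\<dots> \<le> C0 * 1 * norm v" using C0 \<delta> that by (intro mult_right_mono mult_left_mono) auto
    finally show ?thesis by simp
  qed
  obtain Kd where Kd0: "Kd \<ge> 0" and Kd: "\<And>\<phi> a b \<xi>. modulation W \<phi> \<Longrightarrow> a < b \<Longrightarrow>
       \<bar>trap_err a b (\<lambda>t. (\<beta> \<bullet> (mexp ((t - a) *\<^sub>R A) *v \<xi>)) * \<phi> t)\<bar> \<le> Kd * norm \<xi> * (b - a) ^ 3"
    using drift_trapezoid_error[OF bounded W, of \<beta>] by blast
  define C where "C = 2 * (Kd\<^sup>2 * K) + 8 * K * (norm \<beta>)\<^sup>2"
  have C: "C \<ge> 0" using K0 by (simp add: C_def)
  have main: "(\<lambda>\<omega>. \<Sum>j<n. trap_err (x j) (x (Suc j)) (\<lambda>t. (\<beta> \<bullet> X t \<omega>) * \<phi> t)) \<in> borel_measurable M \<and>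
       (\<integral>\<^sup>+\<omega>. ennreal ((\<Sum>j<n. trap_err (x j) (x (Suc j)) (\<lambda>t. (\<beta> \<bullet> X t \<omega>) * \<phi> t))\<^sup>2) \<partial>M)
         \<le> ennreal (C * ((\<Sum>j<n. (x (Suc j) - x j) ^ 3)\<^sup>2 + (\<Sum>j<n. (x (Suc j) - x j) ^ 3)))"
    if mod: "modulation W \<phi>" and x0: "0 \<le> x 0" and mono: "\<And>i j. i < j \<Longrightarrow> j \<le> n \<Longrightarrow> x i < x j"
    for \<phi> n and x :: "nat \<Rightarrow> real"
  proof -
    let ?y = "\<lambda>\<omega> t. (\<beta> \<bullet> X t \<omega>) * \<phi> t"
    let ?d = "\<lambda>j \<omega> t. (\<beta> \<bullet> (mexp ((t - x j) *\<^sub>R A) *v X (x j) \<omega>)) * \<phi> t"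
    let ?S = "\<lambda>\<omega>. \<Sum>j<n. trap_err (x j) (x (Suc j)) (?y \<omega>)"
    let ?h = "\<lambda>j. (x (Suc j) - x j) ^ 3"
    let ?H = "\<Sum>j<n. ?h j"
    define Dr where "Dr \<omega> = (\<Sum>j<n. trap_err (x j) (x (Suc j)) (?d j \<omega>))" for \<omega>
    define Q where "Q m \<omega> = (\<Sum>j<n. quad_innovation A X \<beta> \<phi> m (x j) (x (Suc j)) \<omega>)" for m \<omega>
    define N where "N \<omega> = ?S \<omega> - Dr \<omega>" for \<omega>
    note b = modulation_le_1[OF mod] and cont = modulation_continuous[OF mod]
    have grid: "0 \<le> x j" "x j < x (Suc j)" if "j < n" for j
    proof -
      show "x j < x (Suc j)" using mono[of j "Suc j"] that by simp
      show "0 \<le> x j" using mono[of 0 j] x0 that by (cases "j = 0") auto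
    qed
    have h0: "?h j \<ge> 0" if "j < n" for j using grid(2)[OF that] by simp
    have H0: "?H \<ge> 0" using h0 by (intro sum_nonneg) auto
    have Xm: "X t \<in> borel_measurable M" if "t \<ge> 0" for t using X that by (simp add: carma_state_def)
    have path: "AE \<omega> in M. cadlag (\<lambda>t. X t \<omega>)" using X by (simp add: carma_state_def)

    have sqQ: "square_integrable M (quad_innovation A X \<beta> \<phi> m (x j) (x (Suc j)))"
      and bQ: "(\<integral>\<omega>. (quad_innovation A X \<beta> \<phi> m (x j) (x (Suc j)) \<omega>)\<^sup>2 \<partial>M) \<le> 4 * K * (norm \<beta>)\<^sup>2 * ?h j"
      if "j < n" for m j
      using quad_innovation_square[OF L X K0 WK b, where a = "x j" and b = "x (Suc j)" and \<beta> = \<beta> and n = m] grid[OF that] by auto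
    have QQ: "square_integrable M (Q m)" for m
      unfolding Q_def [abs_def] by (intro square_integrable_sum sqQ) auto
    have orth: "(\<integral>\<omega>. quad_innovation A X \<beta> \<phi> m (x i) (x (Suc i)) \<omega> * quad_innovation A X \<beta> \<phi> m (x j) (x (Suc j)) \<omega> \<partial>M) = 0"
      if "i < n" "j < n" "i < j" for m i j
    proof (rule quad_innovation_orthogonal[OF L X])
      show "x (Suc i) \<le> x j" using mono[of "Suc i" j] that by (cases "Suc i = j") auto
    qed (use grid[OF that(1)] grid[OF that(2)] in auto)
    have Qb: "(\<integral>\<omega>. (Q m \<omega>)\<^sup>2 \<partial>M) \<le> 4 * K * (norm \<beta>)\<^sup>2 * ?H" for m
    proof -
      have "(\<integral>\<omega>. (Q m \<omega>)\<^sup>2 \<partial>M) = (\<Sum>j<n. \<integral>\<omega>. (quad_innovation A X \<beta> \<phi> m (x j) (x (Suc j)) \<omega>)\<^sup>2 \<partial>M)"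
        unfolding Q_def
      proof (rule integral_orthogonal_sum_square)
        fix i j assume ij: "i \<in> {..<n}" "j \<in> {..<n}" "i \<noteq> j"
        show "(\<integral>\<omega>. quad_innovation A X \<beta> \<phi> m (x i) (x (Suc i)) \<omega> * quad_innovation A X \<beta> \<phi> m (x j) (x (Suc j)) \<omega> \<partial>M) = 0"
        proof (cases "i < j")
          case True
          then show ?thesis using orth ij by simp
        next
          case False
          then have "(\<integral>\<omega>. quad_innovation A X \<beta> \<phi> m (x j) (x (Suc j)) \<omega> * quad_innovation A X \<beta> \<phi> m (x i) (x (Suc i)) \<omega> \<partial>M) = 0"
            using orth ij by simp
          then show ?thesis by (simp only: mult.commute)
        qed
      qed (auto intro: sqQ)
      also have "\<dots> \<le> (\<Sum>j<n. 4 * K * (norm \<beta>)\<^sup>2 * ?h j)" by (intro sum_mono bQ) auto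
      finally show ?thesis by (simp only: sum_distrib_left)
    qed
    have Qlim: "AE \<omega> in M. (\<lambda>m. Q m \<omega>) \<longlonglongrightarrow> N \<omega>"
      using path
    proof eventually_elim
      case (elim \<omega>)
      have "(\<lambda>m. Q m \<omega>) \<longlonglongrightarrow> (\<Sum>j<n. trap_err (x j) (x (Suc j)) (?y \<omega>) - trap_err (x j) (x (Suc j)) (?d j \<omega>))"
        unfolding Q_def by (intro tendsto_sum quad_innovation_tendsto elim cont b grid) auto
      then show ?case by (simp add: N_def Dr_def sum_subtractf)
    qed
    have Qm: "Q m \<in> borel_measurable M" for m using QQ by (simp add: square_integrable_def)
    have Nm [measurable]: "N \<in> borel_measurable M"
      by (rule borel_measurable_AE_limit[OF Qm Qlim])
    have N2: "(\<integral>\<^sup>+\<omega>. ennreal ((N \<omega>)\<^sup>2) \<partial>M) \<le> ennreal (4 * K * (norm \<beta>)\<^sup>2 * ?H)"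
    proof -
      have "AE \<omega> in M. ennreal ((N \<omega>)\<^sup>2) = liminf (\<lambda>m. ennreal ((Q m \<omega>)\<^sup>2))"
        using Qlim
      proof eventually_elim
        case (elim \<omega>)
        have "(\<lambda>m. ennreal ((Q m \<omega>)\<^sup>2)) \<longlonglongrightarrow> ennreal ((N \<omega>)\<^sup>2)" by (intro tendsto_intros elim)
        from lim_imp_Liminf[OF sequentially_bot this] show ?case by (rule sym)
      qed
      then have "(\<integral>\<^sup>+\<omega>. ennreal ((N \<omega>)\<^sup>2) \<partial>M) = (\<integral>\<^sup>+\<omega>. liminf (\<lambda>m. ennreal ((Q m \<omega>)\<^sup>2)) \<partial>M)"
        by (rule nn_integral_cong_AE)
      also have "\<dots> \<le> liminf (\<lambda>m. \<integral>\<^sup>+\<omega>. ennreal ((Q m \<omega>)\<^sup>2) \<partial>M)"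
        using Qm by (intro nn_integral_liminf) measurable
      also have "\<dots> \<le> liminf (\<lambda>m::nat. ennreal (4 * K * (norm \<beta>)\<^sup>2 * ?H))"
      proof (intro Liminf_mono always_eventually allI)
        fix m
        have "(\<integral>\<^sup>+\<omega>. ennreal ((Q m \<omega>)\<^sup>2) \<partial>M) = ennreal (\<integral>\<omega>. (Q m \<omega>)\<^sup>2 \<partial>M)"
          using QQ[of m] by (intro nn_integral_eq_integral) (auto simp: square_integrable_def)
        also have "\<dots> \<le> ennreal (4 * K * (norm \<beta>)\<^sup>2 * ?H)" by (rule ennreal_leI[OF Qb])
        finally show "(\<integral>\<^sup>+\<omega>. ennreal ((Q m \<omega>)\<^sup>2) \<partial>M) \<le> ennreal (4 * K * (norm \<beta>)\<^sup>2 * ?H)" .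
      qed
      also have "\<dots> = ennreal (4 * K * (norm \<beta>)\<^sup>2 * ?H)" by (simp add: Liminf_const)
      finally show ?thesis .
    qed

    define R where "R \<omega> = (\<Sum>j<n. ?h j * norm (X (x j) \<omega>))" for \<omega>
    have DR: "\<bar>Dr \<omega>\<bar> \<le> Kd * R \<omega>" for \<omega>
    proof -
      have "\<bar>Dr \<omega>\<bar> \<le> (\<Sum>j<n. \<bar>trap_err (x j) (x (Suc j)) (?d j \<omega>)\<bar>)" unfolding Dr_def by (rule sum_abs)
      also have "\<dots> \<le> (\<Sum>j<n. Kd * norm (X (x j) \<omega>) * ?h j)"
        by (intro sum_mono Kd[OF mod] grid) auto
      also have "\<dots> = Kd * R \<omega>" by (simp add: R_def sum_distrib_left mult_ac)
      finally show ?thesis .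
    qed
    have Rle: "(R \<omega>)\<^sup>2 \<le> ?H * (\<Sum>j<n. ?h j * (norm (X (x j) \<omega>))\<^sup>2)" for \<omega>
    proof -
      have e: "(\<Sum>j<n. \<bar>?h j\<bar>) = ?H"
        "(\<Sum>j<n. \<bar>?h j\<bar> * (norm (X (x j) \<omega>))\<^sup>2) = (\<Sum>j<n. ?h j * (norm (X (x j) \<omega>))\<^sup>2)"
        using h0 by (auto intro!: sum.cong simp del: power_abs)
      show ?thesis
        unfolding R_def using weighted_sum_square[of ?h "\<lambda>j. norm (X (x j) \<omega>)" "{..<n}"] unfolding e .
    qed
    have Rm [measurable]: "R \<in> borel_measurable M"
      unfolding R_def [abs_def] using Xm grid
      by (intro borel_measurable_sum borel_measurable_times borel_measurable_const borel_measurable_norm) auto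
    have R2: "(\<integral>\<^sup>+\<omega>. ennreal ((R \<omega>)\<^sup>2) \<partial>M) \<le> ennreal (K * ?H\<^sup>2)"
    proof -
      have i: "integrable M (\<lambda>\<omega>. ?H * (\<Sum>j<n. ?h j * (norm (X (x j) \<omega>))\<^sup>2))"
        using Xi grid by (intro integrable_mult_right Bochner_Integration.integrable_sum) auto
      have "(\<integral>\<^sup>+\<omega>. ennreal ((R \<omega>)\<^sup>2) \<partial>M) \<le> (\<integral>\<^sup>+\<omega>. ennreal (?H * (\<Sum>j<n. ?h j * (norm (X (x j) \<omega>))\<^sup>2)) \<partial>M)"
        by (intro nn_integral_mono ennreal_leI Rle)
      also have "\<dots> = ennreal (\<integral>\<omega>. ?H * (\<Sum>j<n. ?h j * (norm (X (x j) \<omega>))\<^sup>2) \<partial>M)"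
        using H0 h0 by (intro nn_integral_eq_integral[OF i] AE_I2 mult_nonneg_nonneg sum_nonneg) auto
      also have "(\<integral>\<omega>. ?H * (\<Sum>j<n. ?h j * (norm (X (x j) \<omega>))\<^sup>2) \<partial>M) = ?H * (\<Sum>j<n. ?h j * (\<integral>\<omega>. (norm (X (x j) \<omega>))\<^sup>2 \<partial>M))"
      proof -
        have "(\<integral>\<omega>. (\<Sum>j<n. ?h j * (norm (X (x j) \<omega>))\<^sup>2) \<partial>M) = (\<Sum>j<n. \<integral>\<omega>. ?h j * (norm (X (x j) \<omega>))\<^sup>2 \<partial>M)"
          using Xi grid by (intro Bochner_Integration.integral_sum integrable_mult_right) auto
        then show ?thesis by (simp only: integral_mult_right_zero)
      qed
      also have "\<dots> \<le> ?H * (\<Sum>j<n. ?h j * K)"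
        using H0 h0 XK grid by (intro mult_left_mono sum_mono) auto
      also have "\<dots> = K * ?H\<^sup>2" unfolding sum_distrib_right[symmetric] by (simp add: power2_eq_square)
      finally show ?thesis by (simp add: ennreal_leI)
    qed

    have "(\<integral>\<^sup>+\<omega>. ennreal ((?S \<omega>)\<^sup>2) \<partial>M)
        \<le> (\<integral>\<^sup>+\<omega>. ennreal (2 * Kd\<^sup>2) * ennreal ((R \<omega>)\<^sup>2) + ennreal 2 * ennreal ((N \<omega>)\<^sup>2) \<partial>M)"
    proof (intro nn_integral_mono)
      fix \<omega>
      have "?S \<omega> = Dr \<omega> + N \<omega>" by (simp add: N_def)
      then have "(?S \<omega>)\<^sup>2 \<le> 2 * (Dr \<omega>)\<^sup>2 + 2 * (N \<omega>)\<^sup>2"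
        using sum_squares_bound[of "Dr \<omega>" "N \<omega>"] by (simp add: power2_sum)
      moreover have "(Dr \<omega>)\<^sup>2 \<le> (Kd * R \<omega>)\<^sup>2" using power_mono[OF DR abs_ge_zero, of \<omega> 2] by simp
      ultimately have "(?S \<omega>)\<^sup>2 \<le> 2 * Kd\<^sup>2 * (R \<omega>)\<^sup>2 + 2 * (N \<omega>)\<^sup>2" by (simp add: power_mult_distrib)
      then have "ennreal ((?S \<omega>)\<^sup>2) \<le> ennreal (2 * Kd\<^sup>2 * (R \<omega>)\<^sup>2 + 2 * (N \<omega>)\<^sup>2)" by (rule ennreal_leI)
      also have "\<dots> = ennreal (2 * Kd\<^sup>2) * ennreal ((R \<omega>)\<^sup>2) + ennreal 2 * ennreal ((N \<omega>)\<^sup>2)"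
        by (simp add: ennreal_mult ennreal_plus del: ennreal_numeral)
      finally show "ennreal ((?S \<omega>)\<^sup>2) \<le> ennreal (2 * Kd\<^sup>2) * ennreal ((R \<omega>)\<^sup>2) + ennreal 2 * ennreal ((N \<omega>)\<^sup>2)" .
    qed
    also have "\<dots> = ennreal (2 * Kd\<^sup>2) * (\<integral>\<^sup>+\<omega>. ennreal ((R \<omega>)\<^sup>2) \<partial>M) + ennreal 2 * (\<integral>\<^sup>+\<omega>. ennreal ((N \<omega>)\<^sup>2) \<partial>M)"
      by (simp add: nn_integral_add nn_integral_cmult del: ennreal_numeral)
    also have "\<dots> \<le> ennreal (2 * Kd\<^sup>2) * ennreal (K * ?H\<^sup>2) + ennreal 2 * ennreal (4 * K * (norm \<beta>)\<^sup>2 * ?H)"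
      by (intro add_mono mult_left_mono R2 N2) auto
    also have "\<dots> = ennreal (2 * Kd\<^sup>2 * (K * ?H\<^sup>2) + 2 * (4 * K * (norm \<beta>)\<^sup>2 * ?H))"
      using K0 H0 by (simp only: ennreal_mult[symmetric] ennreal_plus[symmetric] mult_nonneg_nonneg zero_le_power2 zero_le_numeral norm_ge_zero)
    also have "\<dots> \<le> ennreal (C * (?H\<^sup>2 + ?H))"
    proof (rule ennreal_leI)
      have "0 \<le> 2 * (Kd\<^sup>2 * K) * ?H" "0 \<le> 8 * K * (norm \<beta>)\<^sup>2 * ?H\<^sup>2" using K0 H0 by simp_all
      moreover have "C * (?H\<^sup>2 + ?H) = 2 * Kd\<^sup>2 * (K * ?H\<^sup>2) + 2 * (4 * K * (norm \<beta>)\<^sup>2 * ?H)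
          + 2 * (Kd\<^sup>2 * K) * ?H + 8 * K * (norm \<beta>)\<^sup>2 * ?H\<^sup>2"
        by (simp add: C_def algebra_simps)
      ultimately show "2 * Kd\<^sup>2 * (K * ?H\<^sup>2) + 2 * (4 * K * (norm \<beta>)\<^sup>2 * ?H) \<le> C * (?H\<^sup>2 + ?H)" by linarith
    qed
    finally have bound: "(\<integral>\<^sup>+\<omega>. ennreal ((?S \<omega>)\<^sup>2) \<partial>M) \<le> ennreal (C * (?H\<^sup>2 + ?H))" .

    \<comment> \<open>Quadrature sums of the path itself are used: measurability of \<open>Dr\<close> in the random
        initial value would call for a separate argument.\<close>
    have "?S \<in> borel_measurable M"
    proof (rule borel_measurable_AE_limit)
      let ?q = "\<lambda>m \<omega>. \<Sum>j<n. \<Sum>i<m+3. quad_weight m (x j) (x (Suc j)) i * ?y \<omega> (quad_node m (x j) (x (Suc j)) i)"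
      show "?q m \<in> borel_measurable M" for m
      proof (intro borel_measurable_sum borel_measurable_times borel_measurable_const borel_measurable_inner Xm)
        fix j i assume "j \<in> {..<n}"
        then have "quad_node m (x j) (x (Suc j)) i \<in> {x j..x (Suc j)}" "0 \<le> x j"
          using grid[of j] by (auto intro!: quad_node_mem simp del: atLeastAtMost_iff)
        then show "0 \<le> quad_node m (x j) (x (Suc j)) i" by auto
      qed
      show "AE \<omega> in M. (\<lambda>m. ?q m \<omega>) \<longlonglongrightarrow> ?S \<omega>"
        using path
      proof eventually_elim
        case (elim \<omega>)
        show ?case
        proof (rule tendsto_sum)
          fix j assume "j \<in> {..<n}"
          then have j: "0 \<le> x j" "x j < x (Suc j)" using grid by auto
          note reg = modulated_path_regular[OF elim cont b j(1)]
          obtain B where B: "\<And>t. x j \<le> t \<Longrightarrow> t \<le> x (Suc j) \<Longrightarrow> \<bar>?y \<omega> t\<bar> \<le> B" using reg(2) by blast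
          show "(\<lambda>m. \<Sum>i<m+3. quad_weight m (x j) (x (Suc j)) i * ?y \<omega> (quad_node m (x j) (x (Suc j)) i))
              \<longlonglongrightarrow> trap_err (x j) (x (Suc j)) (?y \<omega>)"
            by (rule quad_tendsto_trap_err[OF j(2) reg(1) B])
        qed
      qed
    qed
    with bound show ?thesis by blast
  qed
  show ?thesis using C main by blast
qed

section \<open>From trapezoid errors to Fourier transforms\<close>

lemma modulation_bounds:
  fixes w c :: real
  assumes "\<bar>c\<bar> \<le> 1"
  shows "\<bar>w * c\<bar> \<le> \<bar>w\<bar>" "\<bar>w * (w * c)\<bar> \<le> \<bar>w\<bar>\<^sup>2"
proof -
  show 1: "\<bar>w * c\<bar> \<le> \<bar>w\<bar>" unfolding abs_mult using assms by (intro mult_left_le) auto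
  show "\<bar>w * (w * c)\<bar> \<le> \<bar>w\<bar>\<^sup>2"
    unfolding abs_mult[of w "w * c"] power2_eq_square by (intro mult_left_mono 1) auto
qed

lemma modulation_cos: "modulation \<bar>w\<bar> (\<lambda>t. cos (w * t))"
  unfolding modulation_def
proof (intro exI conjI allI)
  fix t
  show "((\<lambda>t. cos (w * t)) has_real_derivative w * - sin (w * t)) (at t)"
    "((\<lambda>t. w * - sin (w * t)) has_real_derivative w * (w * - cos (w * t))) (at t)"
    by (auto intro!: derivative_eq_intros)
qed (use modulation_bounds[of "cos (w * _)" w] modulation_bounds[of "sin (w * _)" w] in auto)

lemma modulation_minus_sin: "modulation \<bar>w\<bar> (\<lambda>t. - sin (w * t))"
  unfolding modulation_def
proof (intro exI conjI allI)
  fix t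
  show "((\<lambda>t. - sin (w * t)) has_real_derivative w * - cos (w * t)) (at t)"
    "((\<lambda>t. w * - cos (w * t)) has_real_derivative w * (w * sin (w * t))) (at t)"
    by (auto intro!: derivative_eq_intros)
qed (use modulation_bounds[of "cos (w * _)" w] modulation_bounds[of "sin (w * _)" w] in auto)

text \<open>The weights group the sum by nodes instead of by intervals.\<close>

lemma trapezoid_weights:
  fixes v :: "nat \<Rightarrow> 'b::real_vector"
  assumes "n \<ge> 1"
  shows "(\<Sum>j<Suc n. (if j = 0 then (x 1 - x 0) / 2 else if j = n then (x n - x (n - 1)) / 2
            else (x (j + 1) - x (j - 1)) / 2) *\<^sub>R v j)
       = (\<Sum>j<n. ((x (Suc j) - x j) / 2) *\<^sub>R (v j + v (Suc j)))"
proof -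
  define d where "d j = (x (Suc j) - x j) / 2" for j
  have "(\<Sum>j<n. d j *\<^sub>R (v j + v (Suc j))) = (\<Sum>j<n. d j *\<^sub>R v j) + (\<Sum>j<n. d j *\<^sub>R v (Suc j))"
    by (simp add: scaleR_right_distrib sum.distrib)
  also have "(\<Sum>j<n. d j *\<^sub>R v j) = (\<Sum>j<Suc n. (if j < n then d j else 0) *\<^sub>R v j)" by simp
  also have "(\<Sum>j<n. d j *\<^sub>R v (Suc j)) = (\<Sum>j<Suc n. (if 0 < j then d (j - 1) else 0) *\<^sub>R v j)"
    by (simp add: sum.lessThan_Suc_shift del: sum.lessThan_Suc)
  also have "(\<Sum>j<Suc n. (if j < n then d j else 0) *\<^sub>R v j) + (\<Sum>j<Suc n. (if 0 < j then d (j - 1) else 0) *\<^sub>R v j)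
      = (\<Sum>j<Suc n. ((if j < n then d j else 0) + (if 0 < j then d (j - 1) else 0)) *\<^sub>R v j)"
    by (simp only: scaleR_left_distrib sum.distrib)
  also have "\<dots> = (\<Sum>j<Suc n. (if j = 0 then (x 1 - x 0) / 2 else if j = n then (x n - x (n - 1)) / 2
            else (x (j + 1) - x (j - 1)) / 2) *\<^sub>R v j)"
  proof (intro sum.cong refl)
    fix j assume j: "j \<in> {..<Suc n}"
    have "(if j < n then d j else 0) + (if 0 < j then d (j - 1) else 0)
        = (if j = 0 then (x 1 - x 0) / 2 else if j = n then (x n - x (n - 1)) / 2 else (x (j + 1) - x (j - 1)) / 2)"
      using j assms by (cases j) (auto simp: d_def field_simps)
    then show "((if j < n then d j else 0) + (if 0 < j then d (j - 1) else 0)) *\<^sub>R v j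
        = (if j = 0 then (x 1 - x 0) / 2 else if j = n then (x n - x (n - 1)) / 2 else (x (j + 1) - x (j - 1)) / 2) *\<^sub>R v j"
      by (simp only:)
  qed
  finally show ?thesis by (simp only: d_def)
qed

lemma integral_over_grid:
  fixes g :: "real \<Rightarrow> real"
  assumes "\<And>j. j < n \<Longrightarrow> x j \<le> x (Suc j)" and "set_integrable lborel {x 0..x n} g"
  shows "(LBINT t:{x 0..x n}. g t) = (\<Sum>j<n. LBINT t:{x j..x (Suc j)}. g t)"
  using assms
proof (induction n)
  case 0
  have "(LBINT t:{x 0..x 0}. g t) = integral {x 0..x 0} g" by (rule set_borel_integral_eq_integral(2)) (rule 0)
  then show ?case by simp
next
  case (Suc n)
  have le: "x 0 \<le> x n"
  proof -
    have "x 0 \<le> x m" if "m \<le> n" for m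
      using that by (induction m) (auto intro: order.trans[OF _ Suc.prems(1)])
    then show ?thesis by simp
  qed
  have le': "x n \<le> x (Suc n)" using Suc.prems(1) by simp
  have i1: "set_integrable lborel {x 0..x n} g" and i2: "set_integrable lborel {x n..x (Suc n)} g"
    using le le' by (auto intro: set_integrable_subset[OF Suc.prems(2)])
  have "(LBINT t:{x 0..x (Suc n)}. g t) = integral {x 0..x (Suc n)} g"
    by (rule set_borel_integral_eq_integral(2)[OF Suc.prems(2)])
  also have "\<dots> = integral {x 0..x n} g + integral {x n..x (Suc n)} g"
    by (rule Henstock_Kurzweil_Integration.integral_combine[OF le le' set_borel_integral_eq_integral(1)[OF Suc.prems(2)], symmetric])
  also have "\<dots> = (LBINT t:{x 0..x n}. g t) + (LBINT t:{x n..x (Suc n)}. g t)"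
    using set_borel_integral_eq_integral(2)[OF i1] set_borel_integral_eq_integral(2)[OF i2] by simp
  also have "(LBINT t:{x 0..x n}. g t) = (\<Sum>j<n. LBINT t:{x j..x (Suc j)}. g t)"
    by (rule Suc.IH[OF Suc.prems(1) i1]) simp
  finally show ?case by simp
qed

text \<open>The trapezoidal rule and the integral are both additive over the grid intervals, and both commute with taking real
  and imaginary parts.\<close>

lemma fourier_error_as_trap_err:
  fixes f :: "real \<Rightarrow> 'b::euclidean_space"
  assumes f: "cadlag f" and T: "T > 0" and N: "N \<ge> 2" and x: "x 0 = 0" "x (N - 1) = T" "strict_mono_on {..<N} x"
  shows "trap_fourier N x (\<lambda>t. \<beta> \<bullet> f t) w T - trunc_fourier (\<lambda>t. \<beta> \<bullet> f t) w T
    = of_real (1 / sqrt T) * Complex (\<Sum>j<N-1. trap_err (x j) (x (Suc j)) (\<lambda>t. (\<beta> \<bullet> f t) * cos (w * t)))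
        (\<Sum>j<N-1. trap_err (x j) (x (Suc j)) (\<lambda>t. (\<beta> \<bullet> f t) * - sin (w * t)))"
proof -
  let ?y = "\<lambda>t. \<beta> \<bullet> f t" and ?E = "\<lambda>t. exp (- (\<i> * w * t))"
  let ?c = "\<lambda>t. (\<beta> \<bullet> f t) * cos (w * t)" and ?s = "\<lambda>t. (\<beta> \<bullet> f t) * - sin (w * t)"
  define n where "n = N - 1"
  have n: "n \<ge> 1" "N = Suc n" using N by (auto simp: n_def)
  have E: "of_real (?y t) * ?E t = Complex (?c t) (?s t)" for t
  proof -
    have "?E t = cis (- (w * t))" by (simp add: cis_conv_exp mult.assoc)
    then show ?thesis by (simp add: complex_eq_iff)
  qed
  have mono: "x j \<le> x (Suc j)" if "j < n" for j
    using strict_mono_onD[OF x(3), of j "Suc j"] that n by simp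
  let ?sum = "\<Sum>j<n. ((x (Suc j) - x j) / 2) *\<^sub>R (Complex (?c (x j)) (?s (x j)) + Complex (?c (x (Suc j))) (?s (x (Suc j))))"
  have trap: "(\<Sum>j<N. trap_weight N x w j * of_real (?y (x j)))
      = ?sum"
  proof -
    have "(\<Sum>j<N. trap_weight N x w j * of_real (?y (x j)))
      = (\<Sum>j<Suc n. (if j = 0 then (x 1 - x 0) / 2 else if j = n then (x n - x (n - 1)) / 2
            else (x (j + 1) - x (j - 1)) / 2) *\<^sub>R (of_real (?y (x j)) * ?E (x j)))"
      unfolding n(2) by (intro sum.cong refl) (simp add: trap_weight_def scaleR_conv_of_real mult_ac numeral_2_eq_2)
    also have "\<dots> = (\<Sum>j<n. ((x (Suc j) - x j) / 2) *\<^sub>R (of_real (?y (x j)) * ?E (x j) + of_real (?y (x (Suc j))) * ?E (x (Suc j))))"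
      by (rule trapezoid_weights[OF n(1)])
    finally show ?thesis unfolding E .
  qed
  have i: "set_integrable lborel {0..T} ?c" "set_integrable lborel {0..T} ?s"
  proof -
    have "set_integrable lborel {0..T} (\<lambda>t. ?y t * \<phi> t)"
      if "continuous_on UNIV \<phi>" "\<And>t. \<bar>\<phi> t\<bar> \<le> 1" for \<phi>
    proof -
      note reg = modulated_path_regular[OF f that order_refl]
      obtain B where B: "\<And>t. 0 \<le> t \<Longrightarrow> t \<le> T \<Longrightarrow> \<bar>?y t * \<phi> t\<bar> \<le> B" using reg(2) by blast
      show ?thesis by (rule right_continuous_riemann(1)[OF T reg(1) B])
    qed
    from this[OF modulation_continuous[OF modulation_cos] modulation_le_1[OF modulation_cos]]
      this[OF modulation_continuous[OF modulation_minus_sin] modulation_le_1[OF modulation_minus_sin]]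
    show "set_integrable lborel {0..T} ?c" "set_integrable lborel {0..T} ?s" .
  qed
  have int: "(LBINT t:{0..T}. of_real (?y t) * ?E t) = Complex (LBINT t:{0..T}. ?c t) (LBINT t:{0..T}. ?s t)"
  proof -
    have "(LBINT t:{0..T}. of_real (?y t) * ?E t)
        = (\<integral>t. complex_of_real (indicator {0..T} t *\<^sub>R ?c t) + \<i> * complex_of_real (indicator {0..T} t *\<^sub>R ?s t) \<partial>lborel)"
      unfolding set_lebesgue_integral_def E by (intro Bochner_Integration.integral_cong) (auto simp: complex_eq_iff)
    also have "\<dots> = complex_of_real (LBINT t:{0..T}. ?c t) + \<i> * complex_of_real (LBINT t:{0..T}. ?s t)"
      using i unfolding set_integrable_def set_lebesgue_integral_def
      by (subst Bochner_Integration.integral_add) (auto simp del: of_real_mult)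
    finally show ?thesis by (simp add: complex_eq_iff)
  qed
  have sp: "(LBINT t:{0..T}. g t) = (\<Sum>j<n. LBINT t:{x j..x (Suc j)}. g t)" if "set_integrable lborel {0..T} g" for g :: "real \<Rightarrow> real"
    using integral_over_grid[of n x g] mono that x by (simp add: n_def)
  have Re: "Re (?sum)
       - (LBINT t:{0..T}. ?c t) = (\<Sum>j<n. trap_err (x j) (x (Suc j)) ?c)"
    unfolding sp[OF i(1)] trap_err_def by (simp add: sum_subtractf)
  have Im: "Im (?sum)
       - (LBINT t:{0..T}. ?s t) = (\<Sum>j<n. trap_err (x j) (x (Suc j)) ?s)"
    unfolding sp[OF i(2)] trap_err_def by (simp add: sum_subtractf)
  show ?thesis
    unfolding trap_fourier_def trunc_fourier_def trap int right_diff_distrib[symmetric] n_def[symmetric] Re[symmetric] Im[symmetric]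
    by (simp add: complex_eq_iff)
qed

theorem theorem3p14:
  fixes M :: "'w measure" and F :: "real \<Rightarrow> 'w measure"
    and L L' :: "real \<Rightarrow> 'w \<Rightarrow> real"
    and a b :: "real poly" and q :: nat
    and A :: "real ^ 'n::{finite,linorder} ^ 'n::{finite,linorder}"
    and X :: "real \<Rightarrow> 'w \<Rightarrow> real ^ 'n::{finite,linorder}" and Z :: "'w \<Rightarrow> real ^ 'n::{finite,linorder}"
    and Y :: "real \<Rightarrow> 'w \<Rightarrow> real"
    and \<sigma> w :: real
    and N :: "real \<Rightarrow> nat" and x :: "real \<Rightarrow> nat \<Rightarrow> real" and hmax :: "real \<Rightarrow> real"
    and D :: "real \<Rightarrow> 'w \<Rightarrow> complex"
  defines "A \<equiv> companion a"
    and "Y \<equiv> (\<lambda>t \<omega>. coeff_vec b \<bullet> X t \<omega>)"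
    and "hmax \<equiv> (\<lambda>T. Max ((\<lambda>j. x T (j + 1) - x T j) ` {0..N T - 2}))"
    and "D \<equiv> (\<lambda>T \<omega>. trap_fourier (N T) (x T) (\<lambda>t. Y t \<omega>) w T - trunc_fourier (\<lambda>t. Y t \<omega>) w T)"
  assumes "degree a = CARD('n)" and "lead_coeff a = 1"
    and "q < CARD('n)" and "poly.coeff b q \<noteq> 0" and "\<And>j. q < j \<Longrightarrow> poly.coeff b j = 0"
    and "prob_space M" and "usual_filtration M F"
    and "levy_process M F L"
    and "integrable M (L 1)" and "(\<integral>\<omega>. L 1 \<omega> \<partial>M) = 0"
    and "integrable M (\<lambda>\<omega>. \<bar>L 1 \<omega>\<bar>\<^sup>2)" and "(\<integral>\<omega>. \<bar>L 1 \<omega>\<bar>\<^sup>2 \<partial>M) = \<sigma>\<^sup>2"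
    and "independent_copy M L L'"
    and "carma_state M L A X"
    and "indep_elements M borel (X 0) path_space (sample_path L)"
    and "\<And>z. is_eigenvalue (map_matrix complex_of_real A) z \<Longrightarrow> Re z < 0"
    and "has_stoch_integral M (two_sided L L') (\<lambda>u. mexp (- u *\<^sub>R A) *v e_vec) {..0} Z"
    and "distr M borel (X 0) = distr M borel Z"
    and "\<And>T. T > 0 \<Longrightarrow> N T \<ge> 2 \<and> x T 0 = 0 \<and> x T (N T - 1) = T \<and> strict_mono_on {..<N T} (x T)"
    and "((\<lambda>T. real (N T) * hmax T ^ 3) \<longlongrightarrow> 0) at_top"
  shows "(\<forall>T>0. D T \<in> L2_space M) \<and>
         ((\<lambda>T. L2_norm M (D T)) \<longlongrightarrow> 0) at_top \<and>
         tendsto_in_prob M D (\<lambda>_. 0) at_top"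
proof -
  interpret prob_space M by (rule \<open>prob_space M\<close>)
  have complM: "complete_measure M" using \<open>usual_filtration M F\<close> by (simp add: usual_filtration_def)
  interpret complete_measure M by (rule complM)
  note X = \<open>carma_state M L A X\<close>
  have L: "orthogonal_driver M L \<sigma>"
    using levy_process_orthogonal[OF \<open>levy_process M F L\<close> \<open>usual_filtration M F\<close>]
      \<open>integrable M (\<lambda>\<omega>. \<bar>L 1 \<omega>\<bar>\<^sup>2)\<close> \<open>(\<integral>\<omega>. L 1 \<omega> \<partial>M) = 0\<close> \<open>(\<integral>\<omega>. \<bar>L 1 \<omega>\<bar>\<^sup>2 \<partial>M) = \<sigma>\<^sup>2\<close> by simp
  have "X 0 \<in> borel_measurable M" using X by (simp add: carma_state_def)
  note X0 = stationary_initial_second_moment[OF L \<open>independent_copy M L L'\<close>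
      \<open>has_stoch_integral M (two_sided L L') (\<lambda>u. mexp (- u *\<^sub>R A) *v e_vec) {..0} Z\<close> this
      \<open>distr M borel (X 0) = distr M borel Z\<close>]
  have grid: "N T \<ge> 2" "x T 0 = 0" "x T (N T - 1) = T" "strict_mono_on {..<N T} (x T)" if "T > 0" for T
    using \<open>\<And>T. T > 0 \<Longrightarrow> N T \<ge> 2 \<and> x T 0 = 0 \<and> x T (N T - 1) = T \<and> strict_mono_on {..<N T} (x T)\<close>[OF that] by auto
  define S where "S \<phi> T \<omega> = (\<Sum>j<N T - 1. trap_err (x T j) (x T (Suc j)) (\<lambda>t. (coeff_vec b \<bullet> X t \<omega>) * \<phi> t))" for \<phi> T \<omega>
  define H where "H T = (\<Sum>j<N T - 1. (x T (Suc j) - x T j) ^ 3)" for T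
  obtain C where C: "C \<ge> 0" and bound:
    "\<And>\<phi> n x. modulation \<bar>w\<bar> \<phi> \<Longrightarrow> 0 \<le> x 0 \<Longrightarrow> (\<forall>i j. i < j \<longrightarrow> j \<le> n \<longrightarrow> x i < x j) \<Longrightarrow>
       (\<lambda>\<omega>. \<Sum>j<n. trap_err (x j) (x (Suc j)) (\<lambda>t. (coeff_vec b \<bullet> X t \<omega>) * \<phi> t)) \<in> borel_measurable M \<and>
       (\<integral>\<^sup>+\<omega>. ennreal ((\<Sum>j<n. trap_err (x j) (x (Suc j)) (\<lambda>t. (coeff_vec b \<bullet> X t \<omega>) * \<phi> t))\<^sup>2) \<partial>M)
         \<le> ennreal (C * ((\<Sum>j<n. (x (Suc j) - x j) ^ 3)\<^sup>2 + (\<Sum>j<n. (x (Suc j) - x j) ^ 3)))"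
    using trapezoid_error_second_moment[OF complM L X
        \<open>\<And>z. is_eigenvalue (map_matrix complex_of_real A) z \<Longrightarrow> Re z < 0\<close> X0 abs_ge_zero[of w], of "coeff_vec b"]
    by blast
  have S: "S \<phi> T \<in> borel_measurable M" "(\<integral>\<^sup>+\<omega>. ennreal ((S \<phi> T \<omega>)\<^sup>2) \<partial>M) \<le> ennreal (C * ((H T)\<^sup>2 + H T))"
    if T: "T > 0" and \<phi>: "\<phi> = (\<lambda>t. cos (w * t)) \<or> \<phi> = (\<lambda>t. - sin (w * t))" for \<phi> T
  proof -
    have g0: "0 \<le> x T 0" using grid[OF T] by simp
    have g1: "x T i < x T j" if "i < j" "j \<le> N T - 1" for i j
      using strict_mono_onD[OF grid(4)[OF T], of i j] grid(1)[OF T] that by simp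
    have "modulation \<bar>w\<bar> \<phi>" using \<phi> modulation_cos[of w] modulation_minus_sin[of w] by auto
    then have "S \<phi> T \<in> borel_measurable M \<and> (\<integral>\<^sup>+\<omega>. ennreal ((S \<phi> T \<omega>)\<^sup>2) \<partial>M) \<le> ennreal (C * ((H T)\<^sup>2 + H T))"
      unfolding S_def [abs_def] H_def using g0 g1 by (intro bound) auto
    then show "S \<phi> T \<in> borel_measurable M" "(\<integral>\<^sup>+\<omega>. ennreal ((S \<phi> T \<omega>)\<^sup>2) \<partial>M) \<le> ennreal (C * ((H T)\<^sup>2 + H T))" by auto
  qed
  let ?c = "\<lambda>t. cos (w * t)" and ?s = "\<lambda>t. - sin (w * t)"
  have DS: "AE \<omega> in M. of_real (1 / sqrt T) * Complex (S ?c T \<omega>) (S ?s T \<omega>) = D T \<omega>" if T: "T > 0" for T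
  proof -
    have "AE \<omega> in M. cadlag (\<lambda>t. X t \<omega>)" using X by (simp add: carma_state_def)
    then show ?thesis
    proof eventually_elim
      case (elim \<omega>)
      show ?case unfolding D_def Y_def S_def
        by (rule fourier_error_as_trap_err[OF elim T grid[OF T], symmetric])
    qed
  qed
  define \<eta> where "\<eta> T = real (N T) * hmax T ^ 3" for T
  have H\<eta>: "0 \<le> H T" "H T \<le> \<eta> T" if T: "T > 0" for T
  proof -
    have h: "0 \<le> x T (Suc j) - x T j" "x T (Suc j) - x T j \<le> hmax T" if "j < N T - 1" for j
    proof -
      show "0 \<le> x T (Suc j) - x T j"
        using strict_mono_onD[OF grid(4)[OF T], of j "Suc j"] that by (simp add: less_diff_conv)
      have "x T (j + 1) - x T j \<in> (\<lambda>j. x T (j + 1) - x T j) ` {0..N T - 2}" using that by (intro imageI) auto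
      then show "x T (Suc j) - x T j \<le> hmax T" unfolding hmax_def by (intro Max_ge) auto
    qed
    show "0 \<le> H T" unfolding H_def using h by (intro sum_nonneg zero_le_power) auto
    have hm: "0 \<le> hmax T" using h[of 0] grid(1)[OF T] by simp
    have "H T \<le> (\<Sum>j<N T - 1. hmax T ^ 3)" unfolding H_def using h by (intro sum_mono power_mono) auto
    also have "\<dots> = real (N T - 1) * hmax T ^ 3" by simp
    also have "\<dots> \<le> \<eta> T" unfolding \<eta>_def using hm by (intro mult_right_mono) auto
    finally show "H T \<le> \<eta> T" .
  qed
  have Dm [measurable]: "D T \<in> borel_measurable M" if T: "T > 0" for T
  proof (rule borel_measurable_AE_limit)
    have [measurable]: "S ?c T \<in> borel_measurable M" "S ?s T \<in> borel_measurable M"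
      by (auto intro: S(1)[OF T])
    have "(\<lambda>\<omega>. complex_of_real (S ?c T \<omega>) + \<i> * complex_of_real (S ?s T \<omega>)) \<in> borel_measurable M"
      by measurable
    moreover have "(\<lambda>\<omega>. Complex (S ?c T \<omega>) (S ?s T \<omega>)) = (\<lambda>\<omega>. complex_of_real (S ?c T \<omega>) + \<i> * complex_of_real (S ?s T \<omega>))"
      by (auto simp: complex_eq_iff)
    ultimately have "(\<lambda>\<omega>. Complex (S ?c T \<omega>) (S ?s T \<omega>)) \<in> borel_measurable M" by (simp only:)
    then show "(\<lambda>\<omega>. of_real (1 / sqrt T) * Complex (S ?c T \<omega>) (S ?s T \<omega>)) \<in> borel_measurable M" for n :: nat
      by (intro borel_measurable_times borel_measurable_const)
    show "AE \<omega> in M. (\<lambda>n::nat. of_real (1 / sqrt T) * Complex (S ?c T \<omega>) (S ?s T \<omega>)) \<longlonglongrightarrow> D T \<omega>"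
      using DS[OF T] by eventually_elim (simp add: tendsto_const_iff)
  qed
  have D2: "(\<integral>\<^sup>+\<omega>. ennreal ((cmod (D T \<omega>))\<^sup>2) \<partial>M) \<le> ennreal (2 * C * ((\<eta> T)\<^sup>2 + \<eta> T) / T)" if T: "T > 0" for T
  proof -
    have "(\<integral>\<^sup>+\<omega>. ennreal ((cmod (D T \<omega>))\<^sup>2) \<partial>M)
        = (\<integral>\<^sup>+\<omega>. ennreal (1 / T) * (ennreal ((S ?c T \<omega>)\<^sup>2) + ennreal ((S ?s T \<omega>)\<^sup>2)) \<partial>M)"
    proof (rule nn_integral_cong_AE, use DS[OF T] in eventually_elim)
      case (elim \<omega>)
      have "(cmod (D T \<omega>))\<^sup>2 = (1 / T) * ((S ?c T \<omega>)\<^sup>2 + (S ?s T \<omega>)\<^sup>2)"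
        unfolding elim[symmetric] norm_mult power_mult_distrib using T
        by (simp add: cmod_power2 power_divide)
      then show ?case using T by (simp only:) (subst ennreal_mult, auto simp: ennreal_plus)
    qed
    also have "\<dots> = ennreal (1 / T) * ((\<integral>\<^sup>+\<omega>. ennreal ((S ?c T \<omega>)\<^sup>2) \<partial>M) + (\<integral>\<^sup>+\<omega>. ennreal ((S ?s T \<omega>)\<^sup>2) \<partial>M))"
      using S(1)[OF T, of ?c] S(1)[OF T, of ?s] by (simp add: nn_integral_cmult nn_integral_add)
    also have "\<dots> \<le> ennreal (1 / T) * (ennreal (C * ((H T)\<^sup>2 + H T)) + ennreal (C * ((H T)\<^sup>2 + H T)))"
      by (intro mult_left_mono add_mono S(2)[OF T]) auto
    also have "\<dots> = ennreal ((1 / T) * (C * ((H T)\<^sup>2 + H T) + C * ((H T)\<^sup>2 + H T)))"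
    proof -
      have c: "0 \<le> C * ((H T)\<^sup>2 + H T)" using C H\<eta>(1)[OF T] by simp
      show ?thesis unfolding ennreal_plus[OF c c, symmetric]
        by (rule ennreal_mult[symmetric]) (use c T in auto)
    qed
    also have "\<dots> \<le> ennreal ((1 / T) * (C * ((\<eta> T)\<^sup>2 + \<eta> T) + C * ((\<eta> T)\<^sup>2 + \<eta> T)))"
      using C H\<eta>[OF T] T by (intro ennreal_leI mult_left_mono add_mono power_mono) auto
    also have "(1 / T) * (C * ((\<eta> T)\<^sup>2 + \<eta> T) + C * ((\<eta> T)\<^sup>2 + \<eta> T)) = 2 * C * ((\<eta> T)\<^sup>2 + \<eta> T) / T"
      by (simp add: field_simps)
    finally show ?thesis .
  qed
  have Dint: "integrable M (\<lambda>\<omega>. (cmod (D T \<omega>))\<^sup>2)" if T: "T > 0" for T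
    using Dm[OF T] order.strict_trans1[OF D2[OF T] ennreal_less_top] by (simp add: integrable_iff_bounded)
  let ?D2 = "\<lambda>T. \<integral>\<omega>. (cmod (D T \<omega>))\<^sup>2 \<partial>M"
  have Dle: "?D2 T \<le> 2 * C * ((\<eta> T)\<^sup>2 + \<eta> T) / T" if T: "T > 0" for T
  proof -
    have "0 \<le> \<eta> T" using H\<eta>[OF T] by linarith
    then have "0 \<le> 2 * C * ((\<eta> T)\<^sup>2 + \<eta> T) / T" using C T by simp
    moreover have "ennreal (?D2 T) \<le> ennreal (2 * C * ((\<eta> T)\<^sup>2 + \<eta> T) / T)"
      using D2[OF T] nn_integral_eq_integral[OF Dint[OF T]] by simp
    ultimately show ?thesis by simp
  qed
  have pos: "\<forall>\<^sub>F T :: real in at_top. T > 0" by (rule eventually_gt_at_top)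
  have "((\<lambda>T. 2 * C * ((\<eta> T)\<^sup>2 + \<eta> T) * inverse T) \<longlongrightarrow> 2 * C * (0\<^sup>2 + 0) * 0) at_top"
    using \<open>((\<lambda>T. real (N T) * hmax T ^ 3) \<longlongrightarrow> 0) at_top\<close>
    unfolding \<eta>_def [symmetric] by (intro tendsto_intros tendsto_inverse_0_at_top filterlim_ident)
  then have up: "((\<lambda>T. 2 * C * ((\<eta> T)\<^sup>2 + \<eta> T) / T) \<longlongrightarrow> 0) at_top"
    by (simp add: divide_inverse)
  have lim: "(?D2 \<longlongrightarrow> 0) at_top"
  proof (rule real_tendsto_sandwich[OF _ _ tendsto_const up])
    show "\<forall>\<^sub>F T in at_top. ?D2 T \<le> 2 * C * ((\<eta> T)\<^sup>2 + \<eta> T) / T"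
      using pos by eventually_elim (rule Dle)
  qed simp
  have "\<forall>T>0. D T \<in> L2_space M" using Dm Dint by (simp add: L2_space_def)
  moreover have "((\<lambda>T. L2_norm M (D T)) \<longlongrightarrow> 0) at_top"
    unfolding L2_norm_def using tendsto_real_sqrt[OF lim] by simp
  moreover have "tendsto_in_prob M D (\<lambda>_. 0) at_top"
    unfolding tendsto_in_prob_def
  proof (intro allI impI)
    fix \<epsilon> :: real assume \<epsilon>: "\<epsilon> > 0"
    have "((\<lambda>T. ?D2 T / \<epsilon>\<^sup>2) \<longlongrightarrow> 0 / \<epsilon>\<^sup>2) at_top"
      using \<epsilon> by (intro tendsto_divide lim tendsto_const) auto
    then have up': "((\<lambda>T. ?D2 T / \<epsilon>\<^sup>2) \<longlongrightarrow> 0) at_top" by simp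
    show "((\<lambda>T. measure M {\<omega> \<in> space M. cmod (D T \<omega> - 0) > \<epsilon>}) \<longlongrightarrow> 0) at_top"
    proof (rule real_tendsto_sandwich[OF _ _ tendsto_const up'])
      show "\<forall>\<^sub>F T in at_top. measure M {\<omega> \<in> space M. cmod (D T \<omega> - 0) > \<epsilon>} \<le> ?D2 T / \<epsilon>\<^sup>2"
        using pos
      proof eventually_elim
        case (elim T)
        note [measurable] = Dm[OF elim]
        have "measure M {\<omega> \<in> space M. cmod (D T \<omega> - 0) > \<epsilon>} \<le> measure M {\<omega> \<in> space M. \<epsilon>\<^sup>2 \<le> (cmod (D T \<omega>))\<^sup>2}"
        proof (rule finite_measure_mono)
          show "{\<omega> \<in> space M. cmod (D T \<omega> - 0) > \<epsilon>} \<subseteq> {\<omega> \<in> space M. \<epsilon>\<^sup>2 \<le> (cmod (D T \<omega>))\<^sup>2}"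
            using \<epsilon> by (auto intro!: power_mono)
        qed measurable
        also have "\<dots> \<le> ?D2 T / \<epsilon>\<^sup>2"
          using \<epsilon> by (intro integral_Markov_inequality_measure[OF Dint[OF elim]]) auto
        finally show ?case .
      qed
    qed simp
  qed
  ultimately show ?thesis by blast
qed

end
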